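(* The function $$\Xi^{(2)}=\frac14\left(G_0^{(2)}-G_1^{(2)}+2G_2^{(2)}\right)$$ is a holomorphic modular form of weight $8$ with respect to $\Gamma_2(1,2)$ and satisfies the factorization constraint $$\Xi^{(2)}|_{\mathcal H_1\times\mathcal H_1}=\Xi^{(1)}\cdot\Xi^{(1)}.$$
   Context: $\mathcal H_g$ is the Siegel upper half-space of symmetric complex $g\times g$ matrices with positive-definite imaginary part. The group $\mathrm{Sp}(2g,\mathbb Z)$ acts on $\mathcal H_g$ by $\gamma\circ\tau=(A\tau+B)(C\tau+D)^{-1}$ for $\gamma=\begin{pmatrix}A&B\\C&D\end{pmatrix}$. Let $\Gamma_g(1,2)\subset\mathrm{Sp}(2g,\mathbb Z)$ be the subgroup of those $\gamma$ for which the diagonals of $A\,{}^tB$ and $C\,{}^tD$ are $\equiv 0 \bmod 2$. A modular form of weight $w$ with respect to $\Gamma\subset\mathrm{Sp}(2g,\mathbb Z)$, for $g\ge 2$, is a holomorphic function $f:\mathcal H_g\to\mathbb C$ with $f(\gamma\circ\tau)=\det(C\tau+D)^w f(\tau)$ for all $\gamma\in\Gamma$, $\tau\in\mathcal H_g$. Let $\mathbb Z_2=\mathbb Z/2\mathbb Z=\{0,1\}$. A characteristic is $v=\begin{bmatrix}\varepsilon\\\delta\end{bmatrix}\in\mathbb Z_2^{2g}$ with $\varepsilon,\delta\in\mathbb Z_2^g$. Lifting entries to $\{0,1\}\subset\mathbb Z$, the theta constant with characteristic $v$ is $$\theta[v](\tau)=\sum_{n\in\mathbb Z^g}\exp\Big(\pi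 i\big((n+\tfrac{\varepsilon}{2})^t\tau(n+\tfrac{\varepsilon}{2})+(n+\tfrac{\varepsilon}{2})^t\delta\big)\Big).$$ For $M\subset\mathbb Z_2^{2g}$ put $P_M(\tau)=\prod_{v\in M}\theta[v](\tau)$. For $0\le i\le 4$ put $$G_i^{(g)}(\tau)=\sum_{V\subset\mathbb Z_2^{2g},\ \dim V=i}P_V(\tau)^{2^{4-i}},$$ the sum being over all $i$-dimensional $\mathbb Z_2$-vector subspaces. The genus $1$ form is $\Xi^{(1)}=\theta\begin{bmatrix}0\\0\end{bmatrix}^8\theta\begin{bmatrix}0\\1\end{bmatrix}^4\theta\begin{bmatrix}1\\0\end{bmatrix}^4=\frac12\big(G_0^{(1)}-G_1^{(1)}\big)$. $\mathcal H_1\times\mathcal H_1$ is embedded in $\mathcal H_2$ as the diagonal matrices $\mathrm{diag}(\tau_1,\tau_2)$, and $f\cdot h$ denotes $(\tau_1,\tau_2)\mapsto f(\tau_1)h(\tau_2)$. *)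

theory Defs
  imports "HOL-Analysis.Analysis" "HOL-Library.Z2"
begin

instance bit :: finite
proof
  have "(UNIV :: bit set) \<subseteq> {0, 1}" by (auto simp: bit_not_one_iff)
  then show "finite (UNIV :: bit set)" by (rule finite_subset) simp
qed


section \<open>The Siegel upper half-space and the symplectic group\<close>

definition pos_def_matrix :: "real^'n^'n \<Rightarrow> bool"
  where "pos_def_matrix Y \<longleftrightarrow> (\<forall>x. x \<noteq> 0 \<longrightarrow> x \<bullet> (Y *v x) > 0)"

definition siegel :: "(complex^'g^'g) set"
  where "siegel = {\<tau>. transpose \<tau> = \<tau> \<and> pos_def_matrix (map_matrix Im \<tau>)}"

text \<open>A \<open>2g \<times> 2g\<close> matrix is indexed by \<^typ>\<open>'g + 'g\<close>: \<^const>\<open>Inl\<close> is the first block of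
  \<open>g\<close> indices, \<^const>\<open>Inr\<close> the second one.\<close>

definition blkA :: "'a^('g + 'g)^('g + 'g) \<Rightarrow> 'a^'g^'g"
  where "blkA \<gamma> = (\<chi> i j. \<gamma> $ Inl i $ Inl j)"
definition blkB :: "'a^('g + 'g)^('g + 'g) \<Rightarrow> 'a^'g^'g"
  where "blkB \<gamma> = (\<chi> i j. \<gamma> $ Inl i $ Inr j)"
definition blkC :: "'a^('g + 'g)^('g + 'g) \<Rightarrow> 'a^'g^'g"
  where "blkC \<gamma> = (\<chi> i j. \<gamma> $ Inr i $ Inl j)"
definition blkD :: "'a^('g + 'g)^('g + 'g) \<Rightarrow> 'a^'g^'g"
  where "blkD \<gamma> = (\<chi> i j. \<gamma> $ Inr i $ Inr j)"

definition sympl_J :: "int^(('g::finite) + 'g)^('g + 'g)"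
  where "sympl_J = (\<chi> i j. case (i, j) of
      (Inl a, Inr b) \<Rightarrow> of_bool (a = b)
    | (Inr a, Inl b) \<Rightarrow> - of_bool (a = b)
    | _ \<Rightarrow> 0)"

definition Sp_Z :: "(int^(('g::finite) + 'g)^('g + 'g)) set"
  where "Sp_Z = {\<gamma>. transpose \<gamma> ** sympl_J ** \<gamma> = sympl_J}"

definition Gamma12 :: "(int^(('g::finite) + 'g)^('g + 'g)) set"
  where "Gamma12 = {\<gamma> \<in> Sp_Z. \<forall>i. even ((blkA \<gamma> ** transpose (blkB \<gamma>)) $ i $ i)
                              \<and> even ((blkC \<gamma> ** transpose (blkD \<gamma>)) $ i $ i)}"

definition autom_mat :: "int^('g + 'g)^('g + 'g) \<Rightarrow> complex^'g^'g \<Rightarrow> complex^'g^'g"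
  where "autom_mat \<gamma> \<tau> = map_matrix of_int (blkC \<gamma>) ** \<tau> + map_matrix of_int (blkD \<gamma>)"

definition sp_act :: "int^('g + 'g)^('g + 'g) \<Rightarrow> complex^'g^'g \<Rightarrow> complex^'g^'g"
  where "sp_act \<gamma> \<tau> = (map_matrix of_int (blkA \<gamma>) ** \<tau> + map_matrix of_int (blkB \<gamma>))
                        ** matrix_inv (autom_mat \<gamma> \<tau>)"


section \<open>Modular forms\<close>

text \<open>\<^const>\<open>siegel\<close> is open in the complex vector space of symmetric matrices, so the derivative is
  taken within \<^const>\<open>siegel\<close>: only symmetric directions are constrained, and a complex-linear map
  on symmetric matrices always extends to a complex-linear map on all matrices.\<close>

definition siegel_holomorphic :: "(complex^'g^'g \<Rightarrow> complex) \<Rightarrow> bool"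
  where "siegel_holomorphic f \<longleftrightarrow>
    (\<forall>\<tau>\<in>siegel. \<exists>L. (f has_derivative L) (at \<tau> within siegel)
                     \<and> (\<forall>c X. L (map_matrix (\<lambda>x. c * x) X) = c * L X))"

text \<open>There is no condition at the cusps, hence the restriction to \<open>g \<ge> 2\<close>.\<close>

definition modular_form ::
    "nat \<Rightarrow> (int^('g + 'g)^('g + 'g)) set \<Rightarrow> (complex^'g^'g \<Rightarrow> complex) \<Rightarrow> bool"
  where "modular_form w \<Gamma> f \<longleftrightarrow> CARD('g) \<ge> 2 \<and> siegel_holomorphic f \<and>
    (\<forall>\<gamma>\<in>\<Gamma>. \<forall>\<tau>\<in>siegel. f (sp_act \<gamma> \<tau>) = det (autom_mat \<gamma> \<tau>) ^ w * f \<tau>)"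


section \<open>Theta constants\<close>

text \<open>A characteristic with rows \<open>\<epsilon>\<close> and \<open>\<delta>\<close> is a vector over \<^typ>\<open>bit\<close> indexed by
  \<^typ>\<open>'g + 'g\<close>, with \<open>\<epsilon>\<close> in the \<^const>\<open>Inl\<close> and \<open>\<delta>\<close> in the \<^const>\<open>Inr\<close> coordinates;
  \<open>of_bit\<close> lifts the entries to 0 and 1.\<close>

definition theta :: "bit^('g + 'g) \<Rightarrow> complex^'g^'g \<Rightarrow> complex"
  where "theta v \<tau> =
    (\<Sum>\<^sub>\<infinity>n\<in>(UNIV :: (int^'g) set).
       let m = (\<chi> i. of_int (n $ i) + of_bit (v $ Inl i) / 2) :: complex^'g in
       exp (pi * \<i> * ((\<Sum>i\<in>UNIV. \<Sum>j\<in>UNIV. m $ i * \<tau> $ i $ j * m $ j)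
                     + (\<Sum>i\<in>UNIV. m $ i * of_bit (v $ Inr i)))))"

definition theta_prod :: "(bit^('g + 'g)) set \<Rightarrow> complex^'g^'g \<Rightarrow> complex"
  where "theta_prod M \<tau> = (\<Prod>v\<in>M. theta v \<tau>)"

definition G_form :: "nat \<Rightarrow> complex^'g^'g \<Rightarrow> complex"
  where "G_form i \<tau> =
    (\<Sum>V | vec.subspace V \<and> vec.dim V = i. theta_prod V \<tau> ^ (2 ^ (4 - i)))"

definition char1 :: "bit \<Rightarrow> bit \<Rightarrow> bit^(1 + 1)"
  where "char1 \<epsilon> \<delta> = (\<chi> k. case k of Inl _ \<Rightarrow> \<epsilon> | Inr _ \<Rightarrow> \<delta>)"

definition Xi1 :: "complex^1^1 \<Rightarrow> complex"
  where "Xi1 \<tau> = theta (char1 0 0) \<tau> ^ 8 * theta (char1 0 1) \<tau> ^ 4 * theta (char1 1 0) \<tau> ^ 4"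

definition Xi2 :: "complex^2^2 \<Rightarrow> complex"
  where "Xi2 \<tau> = (G_form 0 \<tau> - G_form 1 \<tau> + 2 * G_form 2 \<tau>) / 4"

definition diag2 :: "complex^1^1 \<Rightarrow> complex^1^1 \<Rightarrow> complex^2^2"
  where "diag2 \<tau>\<^sub>1 \<tau>\<^sub>2 = vector [vector [\<tau>\<^sub>1 $ 1 $ 1, 0], vector [0, \<tau>\<^sub>2 $ 1 $ 1]]"

end

theory Submission
  imports Defs "HOL-Complex_Analysis.Conformal_Mappings" "HOL-Probability.Characteristic_Functions"
begin

text \<open>
  Write \<open>t\<^sub>v\<close> for the fourth power of the theta constant with characteristic \<open>v\<close>. Summing over pairs of
  characteristics instead of subspaces gives
  \<open>12 \<Xi> = \<Sum>\<^sub>u\<^sub>,\<^sub>v t\<^sub>0 t\<^sub>u t\<^sub>v t\<^sub>u\<^sub>+\<^sub>v + 8 t\<^sub>0\<^sup>4 - 6 t\<^sub>0\<^sup>2 \<Sum>\<^sub>v t\<^sub>v\<^sup>2\<close>,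
  and replacing 0 by a characteristic \<open>c\<close> (and \<open>u + v\<close> by \<open>u + v + c\<close>) gives a form \<open>\<Xi>\<^sub>c\<close>. Each of the
  following generators of \<open>Sp(4, \<int>)\<close> sends \<open>t\<^sub>v\<close> to \<open>t\<^bsub>\<sigma>v\<^esub>\<close> with \<open>\<sigma>\<close> affine, up to a factor independent of
  \<open>v\<close> and a sign that is a character of \<open>v\<close>: translations, changes of basis of the lattice, and the
  inversion in the first variable alone, which needs only the classical inversion formula in one
  variable. The signs cancel in all monomials of \<open>\<Xi>\<^sub>c\<close>, so the symplectic group permutes the forms
  \<open>\<Xi>\<^sub>c\<close>. On the quadratic forms \<open>x \<cdot> y + c \<cdot> (x, y)\<close> over the field with two elements the permutation
  is substitution, and \<open>\<Gamma>(1,2)\<close> is the stabilizer of \<open>x \<cdot> y\<close>, that is, of \<open>c = 0\<close>.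

  On diagonal matrices both sums factor, and the genus 1 factors reduce to \<open>\<Xi>\<^sup>(\<^sup>1\<^sup>)\<close> by Jacobi's quartic
  identity.
\<close>

section \<open>Exponential series\<close>

text \<open>The sum over all pairs carries no independence condition, so any affine bijection of the
  characteristics reindexes it, and on diagonal matrices it is a product of two sums of the same
  kind. Fourth powers serve twice. They remove the sign ambiguity in lifting characteristics from
  the field with two elements to the integers, and they turn the roots of unity and the square root
  in the transformation formulas into signs and powers of the determinant. No theta multiplier has
  to be tracked: on each generator the common factor is \<open>det(C\<tau> + D)^2\<close> up to
  sign, and degree 4 in \<open>t\<close> gives weight 8. Affine maps of characteristics have
  translation parts that compose awkwardly; on quadratic forms the action is substitution by a
  linear map. The diagonals of \<open>A B^t\<close> and \<open>C D^t\<close> are the linear terms by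
  which this substitution alters \<open>x \<cdot> y\<close>, which is how the definition of the
  group enters. Inverting one variable only keeps the other summation index fixed. Poisson summation
  is therefore needed only on the line and for real Gaussians; the identity theorem, first in the
  argument and then in the period, does the rest.\<close>

lemma exp_remainder_bound:
  fixes h :: complex
  shows "norm (exp h - 1 - h) \<le> norm h ^ 2 * exp (norm h)"
proof -
  have "norm (exp h - 1 - h) \<le> exp \<bar>Re h\<bar> * norm h ^ 2"
    using Taylor_exp[of h 1] by (simp add: numeral_2_eq_2 algebra_simps)
  also have "\<dots> \<le> exp (norm h) * norm h ^ 2"
    by (intro mult_right_mono) (auto simp: abs_Re_le_cmod)
  finally show ?thesis by (simp add: mult.commute)
qed

lemma has_sum_diff:
  fixes f g :: "'i \<Rightarrow> 'a::real_normed_vector"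
  assumes "(f has_sum a) A" "(g has_sum b) A"
  shows "((\<lambda>x. f x - g x) has_sum (a - b)) A"
  using has_sum_add[OF assms(1), of "\<lambda>x. - g x" "- b"] assms(2) by (simp add: has_sum_uminus)

lemma exp_series_summable:
  fixes a :: "'i \<Rightarrow> complex"
  assumes "(\<lambda>i. exp (Re (a i))) summable_on A"
  shows "(\<lambda>i. exp (a i)) summable_on A"
  using assms by (auto intro: abs_summable_summable[where f = "\<lambda>i. exp (a i)"])

text \<open>The slack \<open>d * B i\<close> in the summability hypothesis pays for termwise
  differentiation: it dominates the factor \<open>B i\<close> of the derivative and, for increments
  of norm at most \<open>d / 2\<close>, the quadratic remainder. The maps \<open>l i\<close> are
  real-linear on any normed space, so the lemma serves a complex variable and a complex matrix
  alike.\<close>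

lemma exp_series_has_derivative:
  fixes l :: "'i \<Rightarrow> 'a::real_normed_vector \<Rightarrow> complex" and c :: "'i \<Rightarrow> complex"
  assumes lin: "\<And>i. linear (l i)"
    and B: "\<And>i h. norm (l i h) \<le> B i * norm h" "\<And>i. B i \<ge> 0"
    and d: "d > 0"
    and sm: "(\<lambda>i. exp (Re (c i + l i z) + d * B i)) summable_on A"
  shows "((\<lambda>z. \<Sum>\<^sub>\<infinity>i\<in>A. exp (c i + l i z)) has_derivative
          (\<lambda>h. \<Sum>\<^sub>\<infinity>i\<in>A. l i h * exp (c i + l i z))) (at z)"
proof -
  define E where "E = (\<lambda>i. exp (c i + l i z))"
  define g where "g = (\<lambda>i. exp (Re (c i + l i z) + d * B i))"
  define M where "M = (\<Sum>\<^sub>\<infinity>i\<in>A. g i)"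
  have g0: "g i \<ge> 0" for i by (simp add: g_def)
  have nE: "norm (E i) = exp (Re (c i + l i z))" for i by (simp add: E_def)
  have gsum: "(g has_sum M) A" using sm unfolding M_def g_def by (intro has_sum_infsum)
  have M0: "M \<ge> 0" unfolding M_def by (intro infsum_nonneg g0)
  have sE: "E summable_on A"
    by (rule abs_summable_summable, rule Infinite_Sum.abs_summable_on_comparison_test'[OF sm[folded g_def]])
       (use d B(2) in \<open>auto simp: nE g_def\<close>)
  have xb: "x \<le> exp x" for x :: real using exp_ge_add_one_self[of x] by linarith
  have bd1: "norm (l i h * E i) \<le> (norm h / d) * g i" for i h
  proof -
    have "B i \<le> exp (d * B i) / d"
      using xb[of "d * B i"] d by (simp add: field_simps)
    then have "norm (l i h) \<le> exp (d * B i) / d * norm h"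
      using B(1)[of i h] by (meson mult_right_mono norm_ge_zero order_trans)
    then have "norm (l i h) * norm (E i) \<le> exp (d * B i) / d * norm h * norm (E i)"
      by (intro mult_right_mono) auto
    also have "\<dots> = (norm h / d) * g i" by (simp add: nE g_def exp_add)
    finally show ?thesis by (simp add: norm_mult)
  qed
  have s1: "(\<lambda>i. l i h * E i) summable_on A" for h
    by (rule abs_summable_summable, rule Infinite_Sum.abs_summable_on_comparison_test'[OF _ bd1])
       (intro summable_on_cmult_right sm[folded g_def])
  define L where "L = (\<lambda>h. \<Sum>\<^sub>\<infinity>i\<in>A. l i h * E i)"
  have bl: "bounded_linear L"
  proof (rule bounded_linear_intro)
    show "L (x + y) = L x + L y" for x y
      unfolding L_def by (simp add: linear_add[OF lin] distrib_right infsum_add s1)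
    show "L (r *\<^sub>R x) = r *\<^sub>R L x" for r x
      unfolding L_def by (simp add: linear_scale[OF lin] infsum_scaleR_right)
    show "norm (L x) \<le> norm x * (M / d)" for x
    proof -
      have "norm (L x) \<le> (norm x / d) * M"
        unfolding L_def
        by (rule norm_infsum_le[OF has_sum_infsum[OF s1] has_sum_cmult_right[OF gsum] bd1])
      then show ?thesis by simp
    qed
  qed
  have key: "norm ((\<Sum>\<^sub>\<infinity>i\<in>A. exp (c i + l i w)) - (\<Sum>\<^sub>\<infinity>i\<in>A. exp (c i + l i z)) - L (w - z))
      \<le> 8 / d^2 * M * norm (w - z) ^ 2" if w: "norm (w - z) \<le> d / 2" for w
  proof -
    define h where "h = w - z"
    have eq: "exp (c i + l i w) = E i * exp (l i h)" for i
      unfolding E_def h_def by (simp add: exp_add[symmetric] linear_diff[OF lin] algebra_simps)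
    have lb: "norm (l i h) \<le> d/2 * B i" for i
    proof -
      have "norm (l i h) \<le> B i * norm h" by (rule B(1))
      also have "\<dots> \<le> B i * (d/2)" using w by (intro mult_left_mono B(2)) (simp add: h_def)
      finally show ?thesis by (simp add: mult.commute)
    qed
    have "(\<lambda>i. E i * exp (l i h)) summable_on A"
    proof (rule abs_summable_summable, rule Infinite_Sum.abs_summable_on_comparison_test'[OF sm[folded g_def]])
      fix i
      have "Re (l i h) \<le> d * B i"
        using lb[of i] complex_Re_le_cmod[of "l i h"] mult_nonneg_nonneg[OF less_imp_le[OF d] B(2)[of i]] by linarith
      then show "norm (E i * exp (l i h)) \<le> g i"
        by (simp add: norm_mult nE g_def exp_add)
    qed
    then have s2: "(\<lambda>i. exp (c i + l i w)) summable_on A" by (simp add: eq)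
    have eqd: "(\<Sum>\<^sub>\<infinity>i\<in>A. exp (c i + l i w)) - (\<Sum>\<^sub>\<infinity>i\<in>A. exp (c i + l i z)) - L h
        = (\<Sum>\<^sub>\<infinity>i\<in>A. exp (c i + l i w) - E i - l i h * E i)"
      unfolding L_def E_def[symmetric]
      by (rule infsumI[symmetric]) (intro has_sum_diff has_sum_infsum s1 s2 sE)
    have sd: "(\<lambda>i. exp (c i + l i w) - E i - l i h * E i) summable_on A"
      by (rule has_sum_imp_summable,
          rule has_sum_diff[OF has_sum_diff[OF has_sum_infsum[OF s2] has_sum_infsum[OF sE]] has_sum_infsum[OF s1]])
    have bd: "norm (exp (c i + l i w) - E i - l i h * E i) \<le> (8 / d^2 * norm h ^ 2) * g i" for i
    proof -
      have e1: "exp (c i + l i w) - E i - l i h * E i = E i * (exp (l i h) - 1 - l i h)"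
        by (simp add: eq algebra_simps)
      \<comment> \<open>\<open>y\<close> bounds \<open>norm (l i h)\<close>. Half of the slack
        covers \<open>exp (norm (l i h))\<close>, the other half covers \<open>B i ^ 2\<close>
        through \<open>y^2 \<le> 2 * exp y\<close>; writing \<open>B i\<close> as
        \<open>2 * y / d\<close> produces the constant \<open>8 / d^2\<close>.\<close>
      define y where "y = d / 2 * B i"
      have y0: "y \<ge> 0" using d B(2) by (simp add: y_def)
      have y2: "y^2 \<le> 2 * exp y"
        using exp_lower_Taylor_quadratic[OF y0] y0 by simp
      have "norm (exp (l i h) - 1 - l i h) \<le> norm (l i h) ^ 2 * exp (norm (l i h))"
        by (rule exp_remainder_bound)
      also have "\<dots> \<le> (B i * norm h) ^ 2 * exp y"
        using B(1)[of i h] lb[of i] by (intro mult_mono power_mono) (auto simp: y_def)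
      also have "\<dots> = (4 / d^2 * norm h ^ 2) * (y ^ 2 * exp y)"
        using d by (simp add: y_def power_mult_distrib power_divide field_simps)
      also have "\<dots> \<le> (4 / d^2 * norm h ^ 2) * ((2 * exp y) * exp y)"
        by (intro mult_left_mono mult_right_mono y2) auto
      also have "\<dots> = (8 / d^2 * norm h ^ 2) * exp (d * B i)"
        by (simp add: y_def exp_add[symmetric])
      finally have "norm (exp (l i h) - 1 - l i h) \<le> (8 / d^2 * norm h ^ 2) * exp (d * B i)" .
      then have "norm (E i) * norm (exp (l i h) - 1 - l i h) \<le> norm (E i) * ((8 / d^2 * norm h ^ 2) * exp (d * B i))"
        by (intro mult_left_mono) auto
      then show ?thesis unfolding e1 by (simp add: norm_mult nE g_def exp_add mult_ac)
    qed
    have "norm (\<Sum>\<^sub>\<infinity>i\<in>A. exp (c i + l i w) - E i - l i h * E i) \<le> (8 / d^2 * norm h ^ 2) * M"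
      by (rule norm_infsum_le[OF has_sum_infsum[OF sd] has_sum_cmult_right[OF gsum] bd])
    then show ?thesis using eqd by (simp add: h_def mult_ac)
  qed
  have "((\<lambda>z. \<Sum>\<^sub>\<infinity>i\<in>A. exp (c i + l i z)) has_derivative L) (at z)"
    unfolding has_derivative_iff_norm
  proof (intro conjI bl)
    let ?F = "\<lambda>w. norm ((\<Sum>\<^sub>\<infinity>i\<in>A. exp (c i + l i w)) - (\<Sum>\<^sub>\<infinity>i\<in>A. exp (c i + l i z)) - L (w - z)) / norm (w - z)"
    have lim: "((\<lambda>w. 8 / d^2 * M * norm (w - z)) \<longlongrightarrow> 0) (at z)"
    proof -
      have "((\<lambda>w. 8 / d^2 * M * norm (w - z)) \<longlongrightarrow> 8 / d^2 * M * norm (z - z)) (at z)"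
        by (intro tendsto_intros)
      then show ?thesis by simp
    qed
    show "(?F \<longlongrightarrow> 0) (at z)"
    proof (rule Lim_null_comparison[OF _ lim])
      have "\<forall>\<^sub>F w in at z. dist w z < d/2" using d unfolding eventually_at by (intro exI[of _ "d/2"]) auto
      then show "\<forall>\<^sub>F w in at z. norm (?F w) \<le> 8 / d^2 * M * norm (w - z)"
      proof (rule eventually_mono)
        fix w assume "dist w z < d/2"
        then have "norm (w - z) \<le> d/2" by (simp add: dist_norm)
        from key[OF this] show "norm (?F w) \<le> 8 / d^2 * M * norm (w - z)"
          using M0 by (cases "w = z") (auto simp: divide_simps power2_eq_square mult_ac)
      qed
    qed
  qed
  then show ?thesis by (simp add: L_def E_def)
qed

lemma exp_series_field_differentiable:
  fixes b c :: "'i \<Rightarrow> complex"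
  assumes "d > 0" and sm: "(\<lambda>i. exp (Re (c i + b i * z) + d * norm (b i))) summable_on A"
  shows "(\<lambda>z. \<Sum>\<^sub>\<infinity>i\<in>A. exp (c i + b i * z)) field_differentiable (at z)"
proof -
  have "((\<lambda>z. \<Sum>\<^sub>\<infinity>i\<in>A. exp (c i + b i * z)) has_derivative
          (\<lambda>h. \<Sum>\<^sub>\<infinity>i\<in>A. b i * h * exp (c i + b i * z))) (at z)"
    by (rule exp_series_has_derivative[where B = "\<lambda>i. norm (b i)"])
       (use assms in \<open>simp_all add: norm_mult bounded_linear.linear[OF bounded_linear_mult_right]\<close>)
  also have "(\<lambda>h. \<Sum>\<^sub>\<infinity>i\<in>A. b i * h * exp (c i + b i * z)) = (*) (\<Sum>\<^sub>\<infinity>i\<in>A. b i * exp (c i + b i * z))"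
  proof
    fix h
    have "(\<lambda>i. b i * h * exp (c i + b i * z)) = (\<lambda>i. h * (b i * exp (c i + b i * z)))"
      by (simp add: mult_ac)
    then show "(\<Sum>\<^sub>\<infinity>i\<in>A. b i * h * exp (c i + b i * z)) = (\<Sum>\<^sub>\<infinity>i\<in>A. b i * exp (c i + b i * z)) * h"
      by (simp add: infsum_cmult_right')
  qed
  finally show ?thesis
    unfolding field_differentiable_def has_field_derivative_def by blast
qed

section \<open>Gaussian sums over the integers and over pairs of integers\<close>

lemma summable_on_exp_neg_abs_int:
  "(\<lambda>n::int. exp (- real_of_int \<bar>n\<bar>)) summable_on UNIV"
proof -
  have s: "summable (\<lambda>n::nat. exp (-1 :: real) ^ n)"
    by (intro summable_geometric) simp
  have s': "(\<lambda>n::nat. exp (- real n)) summable_on UNIV"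
    by (rule norm_summable_imp_summable_on) (use s in \<open>simp add: exp_of_nat_mult[symmetric]\<close>)
  have 1: "(\<lambda>n::int. exp (- real_of_int \<bar>n\<bar>)) summable_on (range int)"
    by (subst summable_on_reindex) (use s' in \<open>auto simp: o_def\<close>)
  have 2: "(\<lambda>n::int. exp (- real_of_int \<bar>n\<bar>)) summable_on (range (\<lambda>n. - int n))"
    by (subst summable_on_reindex) (use s' in \<open>auto simp: o_def inj_on_def\<close>)
  have "(UNIV :: int set) = range int \<union> range (\<lambda>n. - int n)"
  proof (intro equalityI subsetI)
    fix x :: int
    show "x \<in> range int \<union> range (\<lambda>n. - int n)"
      by (cases x rule: int_cases2) auto
  qed auto
  then show ?thesis using summable_on_union[OF 1 2] by simp
qed

lemma summable_on_gaussian_int: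
  assumes "c > 0"
  shows "(\<lambda>n::int. exp (- c * (real_of_int n)^2 + b * \<bar>real_of_int n\<bar>)) summable_on UNIV"
proof -
  \<comment> \<open>The maximum of \<open>(b + 1) * y - c * y^2\<close> over real \<open>y\<close>;
    what is left over is the geometric majorant \<open>exp (- \<bar>n\<bar>)\<close>.\<close>
  define K where "K = (b + 1)^2 / (4 * c)"
  have bd: "- c * x^2 + b * \<bar>x\<bar> \<le> K - \<bar>x\<bar>" for x :: real
  proof -
    have "0 \<le> (2 * c * \<bar>x\<bar> - (b + 1))^2" by simp
    then have "4 * c * ((b+1) * \<bar>x\<bar>) \<le> 4 * c * (c * x^2) + (b+1)^2"
      by (simp add: power2_eq_square algebra_simps)
    then have "4 * c * ((b+1) * \<bar>x\<bar>) \<le> 4 * c * (c * x^2 + K)"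
      using assms by (simp add: K_def distrib_left)
    then have "(b+1) * \<bar>x\<bar> \<le> c * x^2 + K" using assms by simp
    then show ?thesis by (simp add: algebra_simps)
  qed
  have "(\<lambda>n::int. exp K * exp (- real_of_int \<bar>n\<bar>)) summable_on UNIV"
    by (intro summable_on_cmult_right summable_on_exp_neg_abs_int)
  then have "(\<lambda>n::int. norm (exp (- c * (real_of_int n)^2 + b * \<bar>real_of_int n\<bar>))) summable_on UNIV"
  proof (rule Infinite_Sum.abs_summable_on_comparison_test')
    show "norm (exp (- c * (real_of_int n)^2 + b * \<bar>real_of_int n\<bar>)) \<le> exp K * exp (- real_of_int \<bar>n\<bar>)" for n
      using bd[of "real_of_int n"] by (simp add: exp_add[symmetric])
  qed
  then show ?thesis by (rule abs_summable_summable)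
qed

lemma summable_on_gaussian_int2:
  assumes "c > 0"
  shows "(\<lambda>(m::int, n::int). exp (- c * ((real_of_int m)^2 + (real_of_int n)^2)
            + b * (\<bar>real_of_int m\<bar> + \<bar>real_of_int n\<bar>))) summable_on UNIV"
proof -
  let ?g = "\<lambda>n::int. exp (- c * (real_of_int n)^2 + b * \<bar>real_of_int n\<bar>)"
  have "(\<lambda>(m,n). ?g m * ?g n) summable_on (UNIV \<times> UNIV)"
  proof (rule summable_on_SigmaI[where g = "\<lambda>m. ?g m * (\<Sum>\<^sub>\<infinity>n. ?g n)"])
    show "((\<lambda>n. case (m, n) of (m, n) \<Rightarrow> ?g m * ?g n) has_sum ?g m * (\<Sum>\<^sub>\<infinity>n. ?g n)) UNIV" for m
      using has_sum_cmult_right[OF has_sum_infsum[OF summable_on_gaussian_int[OF assms]], of "?g m" b] by simp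
    show "(\<lambda>m. ?g m * (\<Sum>\<^sub>\<infinity>n. ?g n)) summable_on UNIV"
      by (intro summable_on_cmult_left summable_on_gaussian_int[OF assms])
  qed auto
  also have "(\<lambda>(m,n). ?g m * ?g n) = (\<lambda>(m::int, n::int). exp (- c * ((real_of_int m)^2 + (real_of_int n)^2)
            + b * (\<bar>real_of_int m\<bar> + \<bar>real_of_int n\<bar>)))"
    by (auto simp: fun_eq_iff exp_add[symmetric] algebra_simps)
  finally show ?thesis by simp
qed

section \<open>The inversion formula for the Jacobi theta function\<close>

lemma exp_int_two_pi_i: "exp (2 * of_real pi * \<i> * of_int k) = (1 :: complex)"
  using exp_integer_2pi[of "of_int k"] by (simp add: mult_ac)

lemma int_Icc_Suc: "{- int (Suc N)..int (Suc N)} = insert (- int (Suc N)) (insert (int (Suc N)) {- int N..int N})"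
  by auto

text \<open>Dividing \<open>F z - F 0\<close> by \<open>g z - 1\<close>, with
  \<open>g z = exp (2 pi i z)\<close>, leaves a function \<open>h\<close> holomorphic on the unit
  disc. Multiplication by \<open>g\<close> shifts Fourier coefficients by one, so the partial sums
  telescope to \<open>F 0\<close> plus two coefficients of \<open>h\<close>, and these tend to
  0.\<close>

lemma fourier_partial_sums_tendsto:
  fixes F :: "complex \<Rightarrow> complex"
  assumes hol: "F holomorphic_on UNIV" and per: "\<And>z. F (z + 1) = F z"
  shows "(\<lambda>N::nat. \<Sum>k = - int N..int N.
            integral {-1/2..1/2} (\<lambda>x::real. F x * exp (- (2 * pi * \<i> * of_int k * x)))) \<longlonglongrightarrow> F 0"
proof -
  define e where "e = (\<lambda>(k::int) (z::complex). exp (- (2 * of_real pi * \<i> * of_int k * z)))"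
  define g where "g = (\<lambda>z::complex. exp (2 * of_real pi * \<i> * z))"
  \<comment> \<open>\<open>A\<close> and \<open>E\<close> are difference quotients with the
    removable singularity at 0 filled in, so that \<open>h\<close> continues
    \<open>(F z - F 0) / (g z - 1)\<close> across 0, the only zero of \<open>g z - 1\<close> in the
    unit disc.\<close>
  define A where "A = (\<lambda>z. if z = 0 then deriv F 0 else (F z - F 0) / (z - 0))"
  define E where "E = (\<lambda>z. if z = 0 then deriv g 0 else (g z - g 0) / (z - 0))"
  define h where "h = (\<lambda>z. A z / E z)"
  have g0: "g 0 = 1" by (simp add: g_def)
  have gd: "(g has_field_derivative 2 * of_real pi * \<i> * g z) (at z)" for z
    unfolding g_def by (auto intro!: derivative_eq_intros)
  have gh: "g holomorphic_on S" for S
    unfolding g_def by (intro holomorphic_intros)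
  have E0: "E z \<noteq> 0" if "z \<in> ball 0 1" for z
  proof (cases "z = 0")
    case True
    then show ?thesis using DERIV_imp_deriv[OF gd, of 0] by (simp add: E_def g_def)
  next
    case False
    have "g z \<noteq> 1"
    proof
      assume "g z = 1"
      then obtain n :: int where n: "Re (2 * of_real pi * \<i> * z) = 0" "Im (2 * of_real pi * \<i> * z) = of_int (2 * n) * pi"
        unfolding g_def exp_eq_1 by blast
      then have z: "Im z = 0" "Re z = of_int n" by auto
      then have "\<bar>Re z\<bar> < 1" using that abs_Re_le_cmod[of z] by simp
      then have "n = 0" using z by auto
      then show False using z False by (auto simp: complex_eq_iff)
    qed
    then show ?thesis using False g0 by (simp add: E_def)
  qed
  have hA: "A holomorphic_on ball 0 1"
    unfolding A_def by (rule pole_lemma_open) (use hol in \<open>auto intro: holomorphic_on_subset\<close>)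
  have hE: "E holomorphic_on ball 0 1"
    unfolding E_def by (rule pole_lemma_open) (use gh in auto)
  have hh: "h holomorphic_on ball 0 1"
    unfolding h_def by (intro holomorphic_on_divide hA hE E0)
  have hF: "F z = F 0 + h z * (g z - 1)" if "z \<in> ball 0 1" for z
    using E0[OF that] by (cases "z = 0") (auto simp: h_def A_def E_def g0 divide_simps)
  have inb: "complex_of_real x \<in> ball 0 1" if "x \<in> {-1/2..1/2}" for x
    using that by auto
  \<comment> \<open>At both end points \<open>g\<close> is -1, so the periodicity of
    \<open>F\<close> passes to \<open>h\<close>. This makes the boundary terms cancel in the
    integration by parts below.\<close>
  have hend: "h (of_real (1/2)) = h (of_real (-1/2))"
  proof -
    have "F (of_real (-1/2)) = F (of_real (1/2))" using per[of "of_real (-1/2)"] by simp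
    moreover have "g (of_real (1/2)) = -1" "g (of_real (-1/2)) = -1"
      by (simp_all add: g_def exp_minus)
    ultimately show ?thesis
      using hF[OF inb[of "1/2"]] hF[OF inb[of "-1/2"]] by simp
  qed
  have conth: "continuous_on {-1/2..1/2} (\<lambda>x::real. h x)"
    by (rule continuous_on_compose2[OF holomorphic_on_imp_continuous_on[OF hh]])
       (use inb in \<open>auto intro!: continuous_intros\<close>)
  have conte: "continuous_on S (\<lambda>x::real. e k x)" for k S
    unfolding e_def by (intro continuous_intros)
  define d where "d = (\<lambda>k. integral {-1/2..1/2} (\<lambda>x::real. h x * e k x))"
  have inth: "(\<lambda>x::real. h x * e k x) integrable_on {-1/2..1/2}" for k
    by (intro integrable_continuous_real continuous_on_mult conth conte)
  have ed: "(e k has_field_derivative - (2 * of_real pi * \<i> * of_int k) * e k z) (at z)" for k z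
    unfolding e_def by (auto intro!: derivative_eq_intros)
  have eend: "e k (of_real (1/2)) = e k (of_real (-1/2))" for k
  proof -
    have "e k (of_real (-1/2)) = e k (of_real (1/2)) * exp (2 * of_real pi * \<i> * of_int k)"
      unfolding e_def exp_add[symmetric] by (simp add: algebra_simps)
    then show ?thesis by (simp only: exp_int_two_pi_i mult_1_right)
  qed
  have ie: "((\<lambda>x::real. e k x) has_integral (if k = 0 then 1 else 0)) {-1/2..1/2}" for k
  proof (cases "k = 0")
    case True
    have "((\<lambda>x::real. 1::complex) has_integral (1/2 - (-1/2)) *\<^sub>R 1) {-1/2..1/2}"
      using has_integral_const_real[of "1::complex" "-1/2" "1/2"] by simp
    then show ?thesis using True by (simp add: e_def)
  next
    case False
    let ?c = "- (2 * of_real pi * \<i> * of_int k) :: complex"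
    have "((\<lambda>x::real. ?c * e k x) has_integral (e k (of_real (1/2)) - e k (of_real (-1/2)))) {-1/2..1/2}"
      by (rule fundamental_theorem_of_calculus) (simp, rule has_vector_derivative_real_field[OF ed])
    from has_integral_mult_right[OF this, of "inverse ?c"] show ?thesis
      using False eend[of k] by (simp add: field_simps)
  qed
  define c where "c = (\<lambda>k. integral {-1/2..1/2} (\<lambda>x::real. F x * e k x))"
  have c: "c k = d (k - 1) - d k + (if k = 0 then F 0 else 0)" for k
  proof -
    have "c k = integral {-1/2..1/2} (\<lambda>x::real. h x * e (k - 1) x
        - h x * e k x + F 0 * e k x)"
      unfolding c_def
    proof (rule integral_cong)
      fix x :: real assume x: "x \<in> {-1/2..1/2}"
      have "g x * e k x = e (k - 1) x"
        unfolding g_def e_def exp_add[symmetric] by (simp add: algebra_simps)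
      moreover have "F x * e k x = (F 0 + h x * (g x - 1)) * e k x"
        using hF[OF inb[OF x]] by simp
      ultimately show "F x * e k x = h x * e (k - 1) x
        - h x * e k x + F 0 * e k x"
        by (simp add: algebra_simps)
    qed
    also have "\<dots> = d (k - 1) - d k + F 0 * (if k = 0 then 1 else 0)"
      unfolding d_def
      by (intro integral_unique has_integral_add has_integral_diff has_integral_mult_right ie
            integrable_integral inth)
    finally show ?thesis by simp
  qed
  have sumc: "(\<Sum>k = - int N..int N. c k) = d (- int N - 1) - d (int N) + F 0" for N
  proof (induction N)
    case 0 then show ?case by (simp add: c)
  next
    case (Suc N)
    have eq: "(\<Sum>k = - int (Suc N)..int (Suc N). c k) = c (- int (Suc N)) + (c (int (Suc N)) + (\<Sum>k = - int N..int N. c k))"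
      unfolding int_Icc_Suc by simp
    have e: "d (- 1 - int N) = d (- int N - 1)" by (rule arg_cong[of _ _ d]) simp
    show ?case unfolding eq Suc.IH by (simp add: c algebra_simps e)
  qed
  \<comment> \<open>Integration by parts: the derivative of \<open>h * e k\<close> has integral 0
    over the period, which expresses \<open>d k\<close> as the corresponding coefficient of
    \<open>deriv h\<close> divided by \<open>2 * pi * \<i> * k\<close>.\<close>
  have dec: "\<exists>K. \<forall>k. k \<noteq> 0 \<longrightarrow> norm (d k) \<le> K / \<bar>of_int k\<bar>"
  proof -
    define K where "K = integral {-1/2..1/2} (\<lambda>x::real. norm (deriv h x))"
    have hd: "(h has_field_derivative deriv h x) (at x)" if "x \<in> {-1/2..1/2}" for x :: real
      using holomorphic_derivI[OF hh _ inb[OF that]] by simp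
    have contd: "continuous_on {-1/2..1/2} (\<lambda>x::real. deriv h x)"
      by (rule continuous_on_compose2[OF holomorphic_on_imp_continuous_on[OF holomorphic_deriv[OF hh]]])
         (use inb in \<open>auto intro!: continuous_intros\<close>)
    have intd: "(\<lambda>x::real. deriv h x * e k x) integrable_on {-1/2..1/2}" for k
      by (intro integrable_continuous_real continuous_on_mult contd conte)
    have "norm (d k) \<le> K / \<bar>of_int k\<bar>" if k: "k \<noteq> 0" for k
    proof -
      let ?c = "2 * of_real pi * \<i> * of_int k :: complex"
      have "((\<lambda>x::real. h x * (- ?c * e k x) + deriv h x * e k x)
         has_integral (h (of_real (1/2)) * e k (of_real (1/2)) - h (of_real (-1/2)) * e k (of_real (-1/2)))) {-1/2..1/2}"
      proof (rule fundamental_theorem_of_calculus)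
        fix x :: real assume x: "x \<in> {-1/2..1/2}"
        show "((\<lambda>x. h x * e k x) has_vector_derivative
          h x * (- ?c * e k x) + deriv h x * e k x) (at x within {-1/2..1/2})"
          by (rule has_vector_derivative_real_field[OF DERIV_mult'[OF hd[OF x] ed]])
      qed simp
      then have z: "((\<lambda>x::real. h x * (- ?c * e k x) + deriv h x * e k x) has_integral 0) {-1/2..1/2}"
        using hend eend[of k] by simp
      have fe: "(\<lambda>x::real. h x * (- ?c * e k x) + deriv h x * e k x)
         = (\<lambda>x::real. - ?c * (h x * e k x) + deriv h x * e k x)"
        by (rule ext) (simp add: mult_ac)
      have "((\<lambda>x::real. h x * (- ?c * e k x) + deriv h x * e k x) has_integral
          (- ?c * d k + integral {-1/2..1/2} (\<lambda>x::real. deriv h x * e k x))) {-1/2..1/2}"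
        unfolding fe d_def by (intro has_integral_add has_integral_mult_right integrable_integral inth intd)
      then have "- ?c * d k + integral {-1/2..1/2} (\<lambda>x::real. deriv h x * e k x) = 0"
        by (rule has_integral_unique[OF _ z])
      then have eq: "?c * d k = integral {-1/2..1/2} (\<lambda>x::real. deriv h x * e k x)"
        by simp
      have "norm (?c * d k) \<le> K"
        unfolding eq K_def
      proof (rule integral_norm_bound_integral[OF intd])
        show "(\<lambda>x::real. norm (deriv h x)) integrable_on {-1/2..1/2}"
          by (intro integrable_continuous_real continuous_on_norm contd)
        show "norm (deriv h x * e k x) \<le> norm (deriv h x)" for x :: real
          by (simp add: norm_mult e_def)
      qed
      then have "2 * pi * \<bar>of_int k\<bar> * norm (d k) \<le> K" by (simp add: norm_mult)
      moreover have "\<bar>of_int k\<bar> * norm (d k) \<le> 2 * pi * (\<bar>of_int k\<bar> * norm (d k))"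
        using mult_right_mono[of 1 "2 * pi" "\<bar>of_int k\<bar> * norm (d k)"] pi_ge_two by simp
      ultimately have "\<bar>of_int k\<bar> * norm (d k) \<le> K" by (simp add: mult_ac)
      then show ?thesis using k by (simp add: field_simps)
    qed
    then show ?thesis by blast
  qed
  then obtain K where K: "\<And>k. k \<noteq> 0 \<Longrightarrow> norm (d k) \<le> K / \<bar>of_int k\<bar>" by blast
  have lim1: "(\<lambda>N. d (- int N - 1)) \<longlonglongrightarrow> 0"
  proof (rule Lim_null_comparison)
    have "norm (d (- int N - 1)) \<le> K / real (Suc N)" for N
      using K[of "- int N - 1"] by simp
    then show "\<forall>\<^sub>F N in sequentially. norm (d (- int N - 1)) \<le> K / real (Suc N)" by simp
    show "(\<lambda>N. K / real (Suc N)) \<longlonglongrightarrow> 0"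
      by (rule LIMSEQ_Suc[OF lim_const_over_n])
  qed
  have lim2: "(\<lambda>N. d (int N)) \<longlonglongrightarrow> 0"
  proof (rule Lim_null_comparison)
    show "\<forall>\<^sub>F N in sequentially. norm (d (int N)) \<le> K / real N"
      using eventually_gt_at_top[of 0]
    proof eventually_elim
      case (elim N)
      then show ?case using K[of "int N"] by simp
    qed
  qed (rule lim_const_over_n)
  have "(\<lambda>N. d (- int N - 1) - d (int N) + F 0) \<longlonglongrightarrow> 0 - 0 + F 0"
    by (intro tendsto_intros lim1 lim2)
  then have "(\<lambda>N. \<Sum>k = - int N..int N. c k) \<longlonglongrightarrow> F 0"
    by (simp add: sumc)
  then show ?thesis by (simp add: c_def e_def)
qed

section \<open>The one-variable theta series and Poisson summation\<close>

definition jtheta :: "complex \<Rightarrow> complex \<Rightarrow> complex"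
  where "jtheta x \<tau> = (\<Sum>\<^sub>\<infinity>n::int. exp (pi * \<i> * (of_int n ^ 2 * \<tau> + 2 * of_int n * x)))"

lemma jtheta_majorant:
  assumes "Im \<tau> > 0"
  shows "Re (pi * \<i> * (of_int n ^ 2 * \<tau> + 2 * of_int n * x)) + d * \<bar>real_of_int n\<bar>
    \<le> - (pi * Im \<tau>) * (real_of_int n)^2 + (2 * pi * \<bar>Im x\<bar> + d) * \<bar>real_of_int n\<bar>"
proof -
  have "Re (pi * \<i> * (of_int n ^ 2 * \<tau> + 2 * of_int n * x))
     = - pi * ((real_of_int n)^2 * Im \<tau> + 2 * real_of_int n * Im x)"
    by (simp add: power2_eq_square algebra_simps)
  moreover have "- (real_of_int n * Im x) \<le> \<bar>real_of_int n\<bar> * \<bar>Im x\<bar>"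
    by (metis abs_ge_minus_self abs_mult)
  then have "2 * pi * (- (real_of_int n * Im x)) \<le> 2 * pi * (\<bar>real_of_int n\<bar> * \<bar>Im x\<bar>)"
    by (intro mult_left_mono) auto
  ultimately show ?thesis by (simp add: algebra_simps)
qed

text \<open>Gaussian decay absorbs any linear term; \<open>d * \<bar>n\<bar>\<close> is the slack
  consumed by differentiation in \<open>x\<close>.\<close>

lemma jtheta_norm_summable:
  assumes "Im \<tau> > 0"
  shows "(\<lambda>n::int. exp (Re (pi * \<i> * (of_int n ^ 2 * \<tau> + 2 * of_int n * x)) + d * \<bar>real_of_int n\<bar>)) summable_on UNIV"
proof -
  have "(\<lambda>n::int. norm (exp (Re (pi * \<i> * (of_int n ^ 2 * \<tau> + 2 * of_int n * x)) + d * \<bar>real_of_int n\<bar>))) summable_on UNIV"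
    by (rule Infinite_Sum.abs_summable_on_comparison_test'[OF summable_on_gaussian_int[of "pi * Im \<tau>" "2 * pi * \<bar>Im x\<bar> + d"]])
       (use assms jtheta_majorant[OF assms] in \<open>auto simp only: real_norm_def abs_exp_cancel exp_le_cancel_iff pi_gt_zero zero_less_mult_iff\<close>)
  then show ?thesis by simp
qed

lemma jtheta_summable:
  assumes "Im \<tau> > 0"
  shows "(\<lambda>n::int. exp (pi * \<i> * (of_int n ^ 2 * \<tau> + 2 * of_int n * x))) summable_on UNIV"
  by (rule exp_series_summable) (use jtheta_norm_summable[OF assms, of x 0] in simp)

lemma jtheta_holomorphic_left:
  assumes "Im \<tau> > 0"
  shows "(\<lambda>x. jtheta x \<tau>) holomorphic_on S"
proof -
  have eq: "(\<lambda>x. jtheta x \<tau>) = (\<lambda>x. \<Sum>\<^sub>\<infinity>n::int. exp (pi * \<i> * of_int n ^ 2 * \<tau> + (2 * pi * \<i> * of_int n) * x))"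
    unfolding jtheta_def by (simp add: algebra_simps)
  have "(\<lambda>x. jtheta x \<tau>) field_differentiable (at z)" for z
    unfolding eq
  proof (rule exp_series_field_differentiable[where d = 1])
    have "norm (2 * pi * \<i> * of_int n :: complex) = 2 * pi * \<bar>real_of_int n\<bar>" for n
      by (simp add: norm_mult)
    then show "(\<lambda>n::int. exp (Re (pi * \<i> * of_int n ^ 2 * \<tau> + (2 * pi * \<i> * of_int n) * z)
        + 1 * norm (2 * pi * \<i> * of_int n :: complex))) summable_on UNIV"
      using jtheta_norm_summable[OF assms, of z "2 * pi"] by (simp add: algebra_simps)
  qed simp
  then show ?thesis
    by (simp add: holomorphic_on_def field_differentiable_at_within)
qed

text \<open>Completing the square exhibits the theta series as the periodization of a Gaussian, the
  form to which Poisson summation applies.\<close>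

lemma jtheta_shifted_series:
  "exp (pi * \<i> * \<tau> * x^2) * jtheta (\<tau> * x) \<tau> = (\<Sum>\<^sub>\<infinity>n::int. exp (pi * \<i> * \<tau> * (x + of_int n)^2))"
  unfolding jtheta_def infsum_cmult_right'[symmetric] exp_add[symmetric]
  by (simp add: power2_eq_square algebra_simps)

text \<open>Dominated convergence. Each of these intervals is the union of \<open>2 * N + 1\<close>
  translates of \<open>{-1/2..1/2}\<close>, as it arises when a periodized integrand is
  unfolded.\<close>

lemma tendsto_integral_symmetric_interval:
  fixes f :: "real \<Rightarrow> complex"
  assumes "integrable lborel f"
  shows "(\<lambda>N::nat. integral {- real N - 1/2..real N + 1/2} f) \<longlonglongrightarrow> (LINT x|lborel. f x)"
proof -
  have si: "set_integrable lborel S f" if "S \<in> sets lborel" for S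
    unfolding set_integrable_def using assms that integrable_mult_indicator by blast
  have "(\<lambda>N::nat. LINT x|lborel. indicator {- real N - 1/2..real N + 1/2} x *\<^sub>R f x) \<longlonglongrightarrow> (LINT x|lborel. f x)"
  proof (rule integral_dominated_convergence[where w = "\<lambda>x. norm (f x)"])
    show "AE x in lborel. (\<lambda>N. indicator {- real N - 1/2..real N + 1/2} x *\<^sub>R f x) \<longlonglongrightarrow> f x"
    proof (rule AE_I2)
      fix x :: real
      obtain N0 :: nat where N0: "\<bar>x\<bar> \<le> real N0" using real_arch_simple by blast
      have "\<forall>\<^sub>F N in sequentially. indicator {- real N - 1/2..real N + 1/2} x *\<^sub>R f x = f x"
        using eventually_ge_at_top[of N0]
      proof eventually_elim
        case (elim N)
        then have "real N0 \<le> real N" by simp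
        then show ?case using N0 by (simp add: indicator_def) linarith
      qed
      then show "(\<lambda>N. indicator {- real N - 1/2..real N + 1/2} x *\<^sub>R f x) \<longlonglongrightarrow> f x"
        by (rule tendsto_eventually)
    qed
  qed (use assms in \<open>auto intro!: AE_I2 simp: indicator_def\<close>)
  moreover have "(LINT x|lborel. indicator S x *\<^sub>R f x) = integral S f" if "S \<in> sets lborel" for S
    using set_borel_integral_eq_integral(2)[OF si[OF that]] by (simp add: set_lebesgue_integral_def)
  ultimately show ?thesis by simp
qed

lemma gaussian_fourier_transform:
  fixes t a :: real and k :: real
  assumes "t > 0"
  defines "f \<equiv> \<lambda>x::real. exp (- (pi * t * (x + a)^2) - 2 * pi * \<i> * k * x)"
  shows "integrable lborel f"
    and "(LINT x|lborel. f x) = exp (2 * pi * \<i> * k * a - pi * k^2 / t) / sqrt t"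
proof -
  \<comment> \<open>With this standard deviation \<open>pi * t * (x + a)^2\<close> is the exponent
    of a normal density centred at \<open>- a\<close>; an affine substitution then leads to the
    characteristic function of the standard normal law.\<close>
  define \<sigma> where "\<sigma> = 1 / sqrt (2 * pi * t)"
  have \<sigma>: "\<sigma> > 0" "\<sigma>^2 = 1 / (2 * pi * t)" using assms(1) by (simp_all add: \<sigma>_def power_divide)
  have nd: "normal_density (-a) \<sigma> x = 1 / sqrt (2 * pi * \<sigma>^2) * exp (- (pi * t * (x + a)^2))" for x
    unfolding normal_density_def \<sigma>(2) using assms(1) by (simp add: field_simps)
  have "integrable lborel (\<lambda>x. sqrt (2 * pi * \<sigma>^2) * normal_density (-a) \<sigma> x)"
    using \<sigma>(1) by (intro integrable_mult_right integrable_normal_density) auto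
  then have i: "integrable lborel (\<lambda>x. exp (- (pi * t * (x + a)^2)))"
    unfolding nd using \<sigma>(1) by simp
  have f_eq: "f x = of_real (exp (- (pi * t * (x + a)^2))) * exp (- (2 * pi * \<i> * k * x))" for x
    unfolding f_def exp_of_real[symmetric] exp_add[symmetric] by simp
  show "integrable lborel f"
    by (rule Bochner_Integration.integrable_bound[OF i]) (auto simp: f_def f_eq norm_mult)
  define s where "s = - (2 * pi * k * \<sigma>)"
  have "(LINT x|lborel. f x) = \<bar>\<sigma>\<bar> *\<^sub>R (LINT x|lborel. f (-a + \<sigma> * x))"
    using \<sigma>(1) by (intro lborel_integral_real_affine) simp
  also have "(\<lambda>x. f (-a + \<sigma> * x)) = (\<lambda>x. (exp (2 * pi * \<i> * k * a) * sqrt (2 * pi)) * (std_normal_density x *\<^sub>R iexp (s * x)))"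
  proof
    fix x :: real
    have q: "pi * t * (\<sigma> * x)^2 = x^2 / 2" using assms(1) by (simp add: power_mult_distrib \<sigma>(2))
    have "f (-a + \<sigma> * x) = exp (of_real (- (pi * t * (\<sigma> * x)^2)) - 2 * pi * \<i> * k * (-a + \<sigma> * x))"
      unfolding f_def by simp
    then have "f (-a + \<sigma> * x) = exp (of_real (- (x^2 / 2)) - 2 * pi * \<i> * k * (-a + \<sigma> * x))"
      by (simp only: q)
    also have "\<dots> = exp (of_real (- (x^2 / 2))) * exp (2 * pi * \<i> * k * a) * iexp (s * x)"
      unfolding exp_add[symmetric] by (simp add: s_def algebra_simps)
    also have "\<dots> = (exp (2 * pi * \<i> * k * a) * sqrt (2 * pi)) * (std_normal_density x *\<^sub>R iexp (s * x))"
      unfolding std_normal_density_def by (simp add: scaleR_conv_of_real exp_of_real[symmetric])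
    finally show "f (-a + \<sigma> * x) = (exp (2 * pi * \<i> * k * a) * sqrt (2 * pi)) * (std_normal_density x *\<^sub>R iexp (s * x))" .
  qed
  also have "(LINT x|lborel. (exp (2 * pi * \<i> * k * a) * sqrt (2 * pi)) * (std_normal_density x *\<^sub>R iexp (s * x)))
     = (exp (2 * pi * \<i> * k * a) * sqrt (2 * pi)) * char std_normal_distribution s"
  proof -
    have "char std_normal_distribution s = (LINT x|lborel. std_normal_density x *\<^sub>R iexp (s * x))"
      unfolding char_def by (subst integral_density) auto
    then show ?thesis by (simp only: integral_mult_right_zero)
  qed
  also have "char std_normal_distribution s = exp (- (pi * k^2 / t))"
  proof -
    have "s^2 / 2 = pi * k^2 / t" using assms(1)
      by (simp add: s_def power_mult_distrib \<sigma>(2) power2_eq_square[of pi] field_simps)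
    then show ?thesis unfolding char_std_normal_distribution by simp
  qed
  also have "\<bar>\<sigma>\<bar> *\<^sub>R (exp (2 * pi * \<i> * k * a) * sqrt (2 * pi) * exp (- (pi * k^2 / t))) =
     (\<sigma> * sqrt (2 * pi)) * (exp (2 * pi * \<i> * k * a) * exp (- (pi * k^2 / t)))"
    using \<sigma>(1) by (simp add: scaleR_conv_of_real)
  also have "\<sigma> * sqrt (2 * pi) = 1 / sqrt t" using assms(1) by (simp add: \<sigma>_def real_sqrt_mult)
  finally show "(LINT x|lborel. f x) = exp (2 * pi * \<i> * k * a - pi * k^2 / t) / sqrt t"
    unfolding exp_diff by (simp add: exp_minus exp_of_real[symmetric] divide_simps mult_ac)
qed

text \<open>Lets an unordered sum be evaluated along symmetric partial sums, the only ones that the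
  Fourier argument controls.\<close>

lemma filterlim_symmetric_Icc_int:
  "filterlim (\<lambda>N::nat. {- int N..int N}) (finite_subsets_at_top UNIV) sequentially"
  unfolding filterlim_finite_subsets_at_top
proof (intro allI impI)
  fix X :: "int set" assume X: "finite X \<and> X \<subseteq> UNIV"
  define N0 where "N0 = Max (insert 0 ((\<lambda>k. nat \<bar>k\<bar>) ` X))"
  have N0: "nat \<bar>k\<bar> \<le> N0" if "k \<in> X" for k
    unfolding N0_def using X that by (intro Max_ge) auto
  show "\<forall>\<^sub>F N in sequentially. finite {- int N..int N} \<and> X \<subseteq> {- int N..int N} \<and> {- int N..int N} \<subseteq> UNIV"
    using eventually_ge_at_top[of N0]
  proof eventually_elim
    case (elim N)
    have "k \<in> {- int N..int N}" if "k \<in> X" for k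
      using N0[OF that] elim by auto
    then show ?case by auto
  qed
qed

text \<open>Poisson summation at 0. The factor next to \<open>sqrt t\<close> on the right is
  \<open>F 0\<close> for the periodized Gaussian \<open>F\<close>, and the Fourier coefficients of
  \<open>F\<close> are, up to \<open>sqrt t\<close>, the terms of the series on the left.\<close>

lemma jtheta_inversion_imaginary:
  fixes t a :: real
  assumes t: "t > 0"
  shows "jtheta a (\<i> / t) = sqrt t * (exp (pi * \<i> * (\<i> * t) * a^2) * jtheta (\<i> * t * a) (\<i> * t))"
proof -
  define \<phi> where "\<phi> = (\<lambda>z::complex. exp (- (pi * t * (z + a)^2)))"
  define e where "e = (\<lambda>(k::int) (z::complex). exp (- (2 * pi * \<i> * of_int k * z)))"
  define F where "F = (\<lambda>z::complex. \<Sum>\<^sub>\<infinity>n::int. \<phi> (z + of_int n))"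
  have tau: "Im (\<i> * t) > 0" using t by simp
  have Feq: "F z = exp (pi * \<i> * (\<i> * t) * (z + a)^2) * jtheta (\<i> * t * (z + a)) (\<i> * t)" for z :: complex
  proof -
    have "- (pi * t * (z + of_int n + a)^2) = pi * \<i> * (\<i> * t) * (z + a + of_int n)^2" for n :: int
      by (simp add: algebra_simps)
    then show ?thesis
      unfolding F_def \<phi>_def jtheta_shifted_series[of "\<i> * t" "z + a"] by simp
  qed
  have Fhol: "F holomorphic_on UNIV"
  proof -
    have "((\<lambda>x. jtheta x (\<i> * t)) \<circ> (\<lambda>z. \<i> * t * (z + a))) holomorphic_on UNIV"
      by (rule holomorphic_on_compose[OF _ jtheta_holomorphic_left[OF tau]]) (intro holomorphic_intros)
    then have "(\<lambda>z. jtheta (\<i> * t * (z + a)) (\<i> * t)) holomorphic_on UNIV" by (simp add: o_def)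
    then show ?thesis unfolding Feq[abs_def] by (intro holomorphic_intros)
  qed
  have Fper: "F (z + 1) = F z" for z
  proof -
    have "F (z + 1) = (\<Sum>\<^sub>\<infinity>n::int. \<phi> (z + of_int (n + 1)))"
      unfolding F_def by (simp add: add_ac)
    also have "\<dots> = F z"
      unfolding F_def by (rule infsum_reindex_bij_betw) (rule bij_betw_byWitness[where f' = "\<lambda>n. n - 1"], auto)
    finally show ?thesis .
  qed
  have Fsum: "(\<lambda>n::int. \<phi> (z + of_int n)) summable_on UNIV" for z :: complex
  proof -
    have "(\<lambda>n::int. exp (pi * \<i> * (\<i> * t) * (z + a)^2) * exp (pi * \<i> * (of_int n ^ 2 * (\<i> * t) + 2 * of_int n * (\<i> * t * (z + a))))) summable_on UNIV"
      by (intro summable_on_cmult_right jtheta_summable tau)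
    then show ?thesis unfolding \<phi>_def exp_add[symmetric]
      by (simp add: power2_eq_square algebra_simps)
  qed
  define \<psi> where "\<psi> = (\<lambda>(k::int) (x::real). \<phi> x * e k x)"
  have \<psi>_eq: "\<psi> k = (\<lambda>x::real. exp (- (pi * t * (x + a)^2) - 2 * pi * \<i> * real_of_int k * x))" for k
    unfolding \<psi>_def \<phi>_def e_def exp_add[symmetric]
    by (intro ext arg_cong[where f = exp]) (simp add: algebra_simps)
  have cont\<psi>: "continuous_on S (\<psi> k)" for S k
    unfolding \<psi>_def \<phi>_def e_def by (intro continuous_intros)
  \<comment> \<open>Unfolding: since \<open>e k\<close> has period 1, integrating the periodization
    over one period amounts to integrating a single Gaussian over the line. Uniform convergence
    justifies the interchange of sum and integral.\<close>
  have coef: "integral {-1/2..1/2} (\<lambda>x::real. F x * e k x)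
      = exp (2 * pi * \<i> * of_int k * a - pi * of_int k^2 / t) / sqrt t" for k
  proof -
    \<comment> \<open>On the period interval
      \<open>\<bar>x + a\<bar> \<le> \<bar>a\<bar> + 1\<close>; expanding
      \<open>(x + a + n)^2\<close> and discarding \<open>(x + a)^2\<close> yields this
      majorant.\<close>
    define M where "M = (\<lambda>n::int. exp (- (pi * t) * (real_of_int n)^2 + 2 * pi * t * (\<bar>a\<bar> + 1) * \<bar>real_of_int n\<bar>))"
    define f where "f = (\<lambda>(n::int) (x::real). \<phi> (x + of_int n) * e k x)"
    have ul: "uniform_limit {-1/2..1/2} (\<lambda>X x. \<Sum>n\<in>X. f n x) (\<lambda>x. F x * e k x) (finite_subsets_at_top UNIV)"
    proof (rule Weierstrass_m_test_general'[where M = M])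
      fix n :: int and x :: real assume x: "x \<in> {-1/2..1/2}"
      have "(x + a + n)^2 \<ge> n^2 - 2 * (\<bar>a\<bar> + 1) * \<bar>real_of_int n\<bar>"
      proof -
        have "\<bar>(x + a) * n\<bar> \<le> (\<bar>a\<bar> + 1) * \<bar>real_of_int n\<bar>"
          unfolding abs_mult using x by (intro mult_right_mono) auto
        then have "- ((x + a) * n) \<le> (\<bar>a\<bar> + 1) * \<bar>real_of_int n\<bar>" by linarith
        moreover have "(x + a + n)^2 = n^2 + 2 * ((x + a) * n) + (x + a)^2"
          by (simp add: power2_eq_square algebra_simps)
        moreover have "(x + a)^2 \<ge> 0" by simp
        ultimately show ?thesis by linarith
      qed
      then have "pi * t * (x + a + n)^2 \<ge> pi * t * (n^2 - 2 * (\<bar>a\<bar> + 1) * \<bar>real_of_int n\<bar>)"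
        using t by (intro mult_left_mono) auto
      moreover have "norm (f n x) = exp (- (pi * t * (x + a + n)^2))"
      proof -
        have "f n x = of_real (exp (- (pi * t * (x + a + n)^2))) * exp (\<i> * of_real (- (2 * pi * k * x)))"
          unfolding f_def \<phi>_def e_def exp_of_real[symmetric] by (simp add: algebra_simps)
        then show ?thesis
          by (simp only: norm_mult norm_exp_i_times norm_of_real abs_exp_cancel mult_1_right)
      qed
      ultimately show "norm (f n x) \<le> M n" by (simp add: M_def algebra_simps)
    next
      show "((\<lambda>n. f n x) has_sum F x * e k x) UNIV" for x
        unfolding f_def F_def by (intro has_sum_cmult_left has_sum_infsum Fsum)
      show "M summable_on UNIV" unfolding M_def using t by (intro summable_on_gaussian_int) simp
    qed
    have ul': "uniform_limit {-1/2..1/2} (\<lambda>N x. \<Sum>n = - int N..int N. f n x) (\<lambda>x. F x * e k x) sequentially"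
      using filterlim_compose[OF ul filterlim_symmetric_Icc_int] by (simp add: o_def)
    have contf: "continuous_on S (f n)" for S n
      unfolding f_def \<phi>_def e_def by (intro continuous_intros)
    have csum: "continuous_on {-1/2..1/2} (\<lambda>x. \<Sum>n = - int N..int N. f n x)" for N
      by (rule continuous_on_sum) (rule contf)
    have "\<exists>I J. (\<forall>N. ((\<lambda>x. \<Sum>n = - int N..int N. f n x) has_integral I N) {-1/2..1/2}) \<and>
        ((\<lambda>x. F (of_real x) * e k (of_real x)) has_integral J) {-1/2..1/2} \<and> I \<longlonglongrightarrow> J"
      by (rule uniform_limit_integral[OF ul' csum sequentially_bot]) (intro exI conjI allI)
    then obtain I J where I: "\<And>N. ((\<lambda>x. \<Sum>n = - int N..int N. f n x) has_integral I N) {-1/2..1/2}"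
      and J: "((\<lambda>x. F (of_real x) * e k (of_real x)) has_integral J) {-1/2..1/2}" and IJ: "I \<longlonglongrightarrow> J"
      by auto
    have fshift: "integral {-1/2..1/2} (f n) = integral {n - 1/2..n + 1/2} (\<psi> k)" for n
    proof -
      have "integral {n - 1/2..n + 1/2} (\<psi> k) = integral {(n - 1/2) - n..(n + 1/2) - n} (\<lambda>x. \<psi> k (x + n))"
        by (rule integral_shift_real_ivl[symmetric])
      also have "(\<lambda>x::real. \<psi> k (x + n)) = f n"
      proof (rule ext)
        fix x :: real
        have "e k (x + n) = e k x * exp (2 * of_real pi * \<i> * of_int (- (k * n)))"
          unfolding e_def exp_add[symmetric] by (simp add: algebra_simps)
        then have "e k (x + n) = e k x" by (simp only: exp_int_two_pi_i mult_1_right)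
        then show "\<psi> k (x + n) = f n x" by (simp add: \<psi>_def f_def)
      qed
      finally show ?thesis by simp
    qed
    have Isum: "I N = (\<Sum>n = - int N..int N. integral {n - 1/2..n + 1/2} (\<psi> k))" for N
    proof -
      have "((\<lambda>x. \<Sum>n = - int N..int N. f n x) has_integral (\<Sum>n = - int N..int N. integral {-1/2..1/2} (f n))) {-1/2..1/2}"
        by (intro has_integral_sum) (auto intro!: integrable_integral integrable_continuous_real contf)
      from has_integral_unique[OF I this] show ?thesis unfolding fshift .
    qed
    have int\<psi>: "\<psi> k integrable_on {u..v}" for u v :: real
      by (intro integrable_continuous_real cont\<psi>)
    have "(\<Sum>n = - int N..int N. integral {n - 1/2..n + 1/2} (\<psi> k)) = integral {- real N - 1/2..real N + 1/2} (\<psi> k)" for N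
    proof (induction N)
      case 0 then show ?case by simp
    next
      case (Suc N)
      have eq: "(\<Sum>n = - int (Suc N)..int (Suc N). integral {n - 1/2..n + 1/2} (\<psi> k)) =
          integral {- int (Suc N) - 1/2..- int (Suc N) + 1/2} (\<psi> k) + (integral {int (Suc N) - 1/2..int (Suc N) + 1/2} (\<psi> k)
           + (\<Sum>n = - int N..int N. integral {n - 1/2..n + 1/2} (\<psi> k)))"
        unfolding int_Icc_Suc by simp
      have c1: "integral {- real N - 1/2 - 1..- real N - 1/2} (\<psi> k) + integral {- real N - 1/2..real N + 1/2} (\<psi> k)
         = integral {- real N - 1/2 - 1..real N + 1/2} (\<psi> k)"
        by (rule Henstock_Kurzweil_Integration.integral_combine) (auto intro: int\<psi>)
      have c2: "integral {- real N - 1/2 - 1..real N + 1/2} (\<psi> k) + integral {real N + 1/2..real N + 1/2 + 1} (\<psi> k)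
         = integral {- real N - 1/2 - 1..real N + 1/2 + 1} (\<psi> k)"
        by (rule Henstock_Kurzweil_Integration.integral_combine) (auto intro: int\<psi>)
      have r: "- real_of_int (int (Suc N)) - 1/2 = - real N - 1/2 - 1" "real_of_int (- int (Suc N)) - 1/2 = - real N - 1/2 - 1" "real_of_int (- int (Suc N)) + 1/2 = - real N - 1/2"
        "real_of_int (int (Suc N)) - 1/2 = real N + 1/2" "real_of_int (int (Suc N)) + 1/2 = real N + 1/2 + 1"
        "- real (Suc N) - 1/2 = - real N - 1/2 - 1" "real (Suc N) + 1/2 = real N + 1/2 + 1"
        by (simp_all add: field_simps)
      show ?case unfolding eq Suc.IH r c2[symmetric] c1[symmetric] by (simp only: add_ac)
    qed
    then have "I = (\<lambda>N. integral {- real N - 1/2..real N + 1/2} (\<psi> k))"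
      by (simp add: Isum fun_eq_iff)
    moreover have "(\<lambda>N. integral {- real N - 1/2..real N + 1/2} (\<psi> k)) \<longlonglongrightarrow> (LINT x|lborel. \<psi> k x)"
      by (rule tendsto_integral_symmetric_interval) (unfold \<psi>_eq, rule gaussian_fourier_transform(1)[OF t])
    ultimately have "J = (LINT x|lborel. \<psi> k x)"
      using IJ LIMSEQ_unique by blast
    also have "\<dots> = exp (2 * pi * \<i> * of_int k * a - pi * of_int k^2 / t) / sqrt t"
      unfolding \<psi>_eq using gaussian_fourier_transform(2)[OF t, of a "real_of_int k"] by simp
    finally show ?thesis using J by (simp add: integral_unique)
  qed
  have tau': "Im (\<i> / t) > 0" using t by simp
  have coef': "exp (2 * pi * \<i> * of_int k * a - pi * of_int k^2 / t) / sqrt t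
      = exp (pi * \<i> * (of_int k ^ 2 * (\<i> / t) + 2 * of_int k * of_real a)) * (1 / sqrt t)" for k
  proof -
    have "2 * pi * \<i> * of_int k * a - pi * of_int k^2 / t = pi * \<i> * (of_int k ^ 2 * (\<i> / t) + 2 * of_int k * a)"
      by (simp add: algebra_simps)
    then show ?thesis by simp
  qed
  have "(\<lambda>N::nat. \<Sum>k = - int N..int N. integral {-1/2..1/2} (\<lambda>x::real. F x * e k x)) \<longlonglongrightarrow> F 0"
    unfolding e_def by (rule fourier_partial_sums_tendsto[OF Fhol Fper])
  then have l1: "(\<lambda>N::nat. \<Sum>k = - int N..int N. exp (pi * \<i> * (of_int k ^ 2 * (\<i> / t) + 2 * of_int k * of_real a)) * (1 / sqrt t)) \<longlonglongrightarrow> F 0"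
    unfolding coef coef' .
  have "((\<lambda>k::int. exp (pi * \<i> * (of_int k ^ 2 * (\<i> / t) + 2 * of_int k * of_real a)) * (1 / sqrt t)) has_sum jtheta a (\<i> / t) * (1 / sqrt t)) UNIV"
    unfolding jtheta_def by (intro has_sum_cmult_left has_sum_infsum jtheta_summable tau')
  then have l2: "(\<lambda>N::nat. \<Sum>k = - int N..int N. exp (pi * \<i> * (of_int k ^ 2 * (\<i> / t) + 2 * of_int k * of_real a)) * (1 / sqrt t)) \<longlonglongrightarrow> jtheta a (\<i> / t) * (1 / sqrt t)"
    unfolding has_sum_def by (rule filterlim_compose[OF _ filterlim_symmetric_Icc_int])
  have "jtheta a (\<i> / t) * (1 / sqrt t) = F 0" by (rule LIMSEQ_unique[OF l2 l1])
  then have "jtheta a (\<i> / t) = sqrt t * F 0"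
    using t by (simp add: field_simps)
  then show ?thesis unfolding Feq by simp
qed

text \<open>Lowering \<open>Im \<tau>\<close> by half multiplies the size of the term of index
  \<open>n\<close> by \<open>exp (pi * n^2 * Im \<tau> / 2)\<close>, which is exactly the slack
  required for \<open>d = Im \<tau> / 2\<close>.\<close>

lemma jtheta_holomorphic_right:
  "(\<lambda>\<tau>. jtheta x \<tau>) holomorphic_on {\<tau>. Im \<tau> > 0}"
proof -
  have eq: "(\<lambda>\<tau>. jtheta x \<tau>) = (\<lambda>\<tau>. \<Sum>\<^sub>\<infinity>n::int. exp (2 * pi * \<i> * of_int n * x + (pi * \<i> * of_int n ^ 2) * \<tau>))"
    unfolding jtheta_def by (simp add: algebra_simps)
  have "(\<lambda>\<tau>. jtheta x \<tau>) field_differentiable (at \<tau>)" if \<tau>: "Im \<tau> > 0" for \<tau>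
    unfolding eq
  proof (rule exp_series_field_differentiable[where d = "Im \<tau> / 2"])
    have "Im (\<tau> - \<i> * (Im \<tau> / 2)) > 0" using \<tau> by simp
    from jtheta_norm_summable[OF this, of x 0]
    have "(\<lambda>n::int. exp (Re (pi * \<i> * (of_int n ^ 2 * (\<tau> - \<i> * (Im \<tau> / 2)) + 2 * of_int n * x)))) summable_on UNIV"
      by simp
    also have "(\<lambda>n::int. Re (pi * \<i> * (of_int n ^ 2 * (\<tau> - \<i> * (Im \<tau> / 2)) + 2 * of_int n * x)))
       = (\<lambda>n. Re (2 * pi * \<i> * of_int n * x + (pi * \<i> * of_int n ^ 2) * \<tau>) + Im \<tau> / 2 * norm (pi * \<i> * of_int n ^ 2 :: complex))"
      by (intro ext) (simp add: norm_mult norm_power power2_eq_square algebra_simps)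
    finally show "(\<lambda>n::int. exp (Re (2 * pi * \<i> * of_int n * x + (pi * \<i> * of_int n ^ 2) * \<tau>)
        + Im \<tau> / 2 * norm (pi * \<i> * of_int n ^ 2 :: complex))) summable_on UNIV" .
  qed (use \<tau> in simp)
  then show ?thesis
    by (simp add: holomorphic_on_def field_differentiable_at_within)
qed

text \<open>Supplies the limit point for the identity theorem: on the ray through 1 for the
  argument, on the ray through \<open>\<i>\<close> for the period.\<close>

lemma islimpt_real_ray:
  fixes c :: complex
  assumes "c \<noteq> 0"
  shows "c islimpt ((\<lambda>t. c * of_real t) ` {0<..})"
  unfolding islimpt_approachable
proof (intro allI impI)
  fix e :: real assume e: "e > 0"
  define t where "t = 1 + e / (2 * norm c)"
  have t: "t > 0" "t \<noteq> 1" using e assms by (auto simp: t_def add_pos_nonneg)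
  have "dist (c * of_real t) c = norm (c * of_real (e / (2 * norm c)))"
    unfolding dist_norm t_def by (simp add: algebra_simps)
  also have "\<dots> = e / 2" unfolding norm_mult norm_of_real using e assms by simp
  finally show "\<exists>x'\<in>(\<lambda>t. c * of_real t) ` {0<..}. x' \<noteq> c \<and> dist x' c < e"
    using e t assms by (intro bexI[of _ "c * of_real t"]) auto
qed

text \<open>Both sides are entire in \<open>x\<close> and agree on the positive reals.\<close>

lemma jtheta_inversion_imaginary':
  fixes t :: real
  assumes t: "t > 0"
  shows "jtheta x (\<i> / t) = sqrt t * (exp (pi * \<i> * (\<i> * t) * x^2) * jtheta (\<i> * t * x) (\<i> * t))"
proof -
  define f where "f = (\<lambda>x. jtheta x (\<i> / t) - sqrt t * (exp (pi * \<i> * (\<i> * t) * x^2) * jtheta (\<i> * t * x) (\<i> * t)))"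
  have "f x = 0"
  proof (rule analytic_continuation[of f UNIV "(\<lambda>t. 1 * of_real t) ` {0<..}" 1 x])
    have tau: "Im (\<i> * t) > 0" "Im (\<i> / t) > 0" using t by simp_all
    have "((\<lambda>x. jtheta x (\<i> * t)) \<circ> (\<lambda>x. \<i> * t * x)) holomorphic_on UNIV"
      by (rule holomorphic_on_compose[OF _ jtheta_holomorphic_left[OF tau(1)]]) (intro holomorphic_intros)
    then have "(\<lambda>x. jtheta (\<i> * t * x) (\<i> * t)) holomorphic_on UNIV" by (simp add: o_def)
    then show "f holomorphic_on UNIV"
      unfolding f_def by (intro holomorphic_intros jtheta_holomorphic_left tau)
    show "1 islimpt (\<lambda>t. 1 * complex_of_real t) ` {0<..}" by (rule islimpt_real_ray) simp
    show "f z = 0" if "z \<in> (\<lambda>t. 1 * of_real t) ` {0<..}" for z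
      using that jtheta_inversion_imaginary[OF t] by (auto simp: f_def)
  qed auto
  then show ?thesis by (simp add: f_def)
qed

text \<open>Identity theorem in \<open>\<tau>\<close>, starting from the imaginary axis. In
  \<open>\<Phi>\<close> both arguments of \<open>jtheta\<close> move with \<open>\<tau>\<close>,
  while holomorphy was shown in each argument separately; so \<open>\<Phi>\<close> is differentiated
  as a series of exponentials that are linear in \<open>\<tau>\<close>.\<close>

theorem jtheta_inversion:
  assumes "Im \<tau> > 0"
  shows "jtheta x (- 1 / \<tau>) = csqrt (- \<i> * \<tau>) * (exp (pi * \<i> * \<tau> * x^2) * jtheta (\<tau> * x) \<tau>)"
proof -
  let ?S = "{\<tau>. Im \<tau> > 0}"
  define \<Phi> where "\<Phi> = (\<lambda>\<tau>. exp (pi * \<i> * \<tau> * x^2) * jtheta (\<tau> * x) \<tau>)"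
  define f where "f = (\<lambda>\<tau>. jtheta x (- 1 / \<tau>) - csqrt (- \<i> * \<tau>) * \<Phi> \<tau>)"
  have \<Phi>_eq: "\<Phi> = (\<lambda>\<tau>. \<Sum>\<^sub>\<infinity>n::int. exp (0 + (pi * \<i> * (x + of_int n)^2) * \<tau>))"
    unfolding \<Phi>_def jtheta_shifted_series by (simp add: mult_ac)
  have \<Phi>_hol: "\<Phi> holomorphic_on ?S"
  proof -
    have "\<Phi> field_differentiable (at \<tau>)" if \<tau>: "Im \<tau> > 0" for \<tau>
      unfolding \<Phi>_eq
    proof (rule exp_series_field_differentiable[where d = "Im \<tau> / 4"])
      \<comment> \<open>As \<open>norm (x + n)^2 \<le> 2 * norm x ^ 2 + 2 * n^2\<close>, the slack
        with \<open>d = Im \<tau> / 4\<close> costs a constant, collected in \<open>K\<close>, and a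
        multiple of \<open>n^2\<close> that equals the effect of halving
        \<open>Im \<tau>\<close>.\<close>
      define \<tau>' where "\<tau>' = \<tau> - \<i> * (Im \<tau> / 2)"
      have tau': "Im \<tau>' > 0" using \<tau> by (simp add: \<tau>'_def)
      define K where "K = Re (pi * \<i> * \<tau> * x^2) + Im \<tau> / 2 * pi * norm x ^ 2"
      from jtheta_norm_summable[OF tau', of "\<tau> * x" 0]
      have s: "(\<lambda>n::int. exp K * exp (Re (pi * \<i> * (of_int n ^ 2 * \<tau>' + 2 * of_int n * (\<tau> * x))))) summable_on UNIV"
        by (intro summable_on_cmult_right) simp
      have le: "Re (0 + (pi * \<i> * (x + of_int n)^2) * \<tau>) + Im \<tau> / 4 * norm (pi * \<i> * (x + of_int n)^2 :: complex)
          \<le> K + Re (pi * \<i> * (of_int n ^ 2 * \<tau>' + 2 * of_int n * (\<tau> * x)))" for n :: int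
      proof -
        have "norm (x + of_int n) ^ 2 \<le> (norm x + \<bar>real_of_int n\<bar>) ^ 2"
          using norm_triangle_ineq[of x "of_int n"] by (intro power_mono) auto
        also have "\<dots> \<le> 2 * norm x ^ 2 + 2 * real_of_int n ^ 2"
          using sum_squares_bound[of "norm x" "\<bar>real_of_int n\<bar>"] by (simp add: power2_sum)
        finally have "Im \<tau> / 4 * pi * norm (x + of_int n) ^ 2 \<le> Im \<tau> / 4 * pi * (2 * norm x ^ 2 + 2 * real_of_int n ^ 2)"
          using \<tau> by (intro mult_left_mono) auto
        moreover have "norm (pi * \<i> * (x + of_int n)^2 :: complex) = pi * norm (x + of_int n) ^ 2"
          by (simp add: norm_mult norm_power)
        moreover have "pi * \<i> * (x + of_int n)^2 * \<tau> = pi * \<i> * \<tau> * x^2 + pi * \<i> * (of_int n ^ 2 * \<tau>' + 2 * of_int n * (\<tau> * x))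
            - of_real (pi * Im \<tau> / 2 * real_of_int n ^ 2)"
          unfolding \<tau>'_def by (simp add: power2_eq_square algebra_simps)
        then have "Re (pi * \<i> * (x + of_int n)^2 * \<tau>) = Re (pi * \<i> * \<tau> * x^2) + Re (pi * \<i> * (of_int n ^ 2 * \<tau>' + 2 * of_int n * (\<tau> * x)))
            - pi * Im \<tau> / 2 * real_of_int n ^ 2"
          by (simp only: minus_complex.sel plus_complex.sel Re_complex_of_real)
        ultimately show ?thesis unfolding K_def by (simp add: algebra_simps)
      qed
      have "(\<lambda>n::int. norm (exp (Re (0 + (pi * \<i> * (x + of_int n)^2) * \<tau>) + Im \<tau> / 4 * norm (pi * \<i> * (x + of_int n)^2 :: complex)))) summable_on UNIV"
        by (rule Infinite_Sum.abs_summable_on_comparison_test'[OF s], unfold exp_add[symmetric] real_norm_def abs_exp_cancel exp_le_cancel_iff)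
           (rule le)
      then show "(\<lambda>n::int. exp (Re (0 + (pi * \<i> * (x + of_int n)^2) * \<tau>) + Im \<tau> / 4 * norm (pi * \<i> * (x + of_int n)^2 :: complex))) summable_on UNIV"
        by simp
    qed (use \<tau> in simp)
    then show ?thesis
      by (simp add: holomorphic_on_def field_differentiable_at_within)
  qed
  have inv_up: "Im (- 1 / z) > 0" if "Im z > 0" for z :: complex
    using that by (simp add: Im_divide sum_power2_gt_zero_iff)
  have "f \<tau> = 0"
  proof (rule analytic_continuation[of f ?S "(\<lambda>t. \<i> * of_real t) ` {0<..}" \<i> \<tau>])
    have "((\<lambda>\<tau>. jtheta x \<tau>) \<circ> (\<lambda>\<tau>. - 1 / \<tau>)) holomorphic_on ?S"
      by (rule holomorphic_on_compose_gen[OF _ jtheta_holomorphic_right])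
         (use inv_up in \<open>auto intro!: holomorphic_intros\<close>)
    then have "(\<lambda>\<tau>. jtheta x (- 1 / \<tau>)) holomorphic_on ?S" by (simp add: o_def)
    \<comment> \<open>On the upper half-plane \<open>- \<i> * \<tau>\<close> has positive real part,
      so it avoids the branch cut.\<close>
    moreover have "(\<lambda>\<tau>. csqrt (- \<i> * \<tau>)) holomorphic_on ?S"
      by (intro holomorphic_intros) (auto simp: complex_nonpos_Reals_iff)
    ultimately show "f holomorphic_on ?S"
      unfolding f_def by (intro holomorphic_on_diff holomorphic_on_mult \<Phi>_hol)
    show "open ?S" by (rule open_halfspace_Im_gt)
    show "connected ?S" by (rule connected_halfspace_Im_gt)
    show "\<i> islimpt (\<lambda>t. \<i> * complex_of_real t) ` {0<..}" by (rule islimpt_real_ray) simp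
    show "f z = 0" if "z \<in> (\<lambda>t. \<i> * of_real t) ` {0<..}" for z
    proof -
      from that obtain t :: real where t: "t > 0" "z = \<i> * t" by auto
      have "- 1 / z = \<i> / t" "csqrt (- \<i> * z) = sqrt t" using t by (auto simp: field_simps csqrt_of_real_nonneg)
      then show ?thesis using jtheta_inversion_imaginary'[OF t(1), of x] t(2) by (simp add: f_def \<Phi>_def)
    qed
  qed (use assms in auto)
  then show ?thesis by (simp add: f_def \<Phi>_def)
qed

section \<open>Theta series in two variables\<close>

lemma infsum_product_pairs:
  fixes f g :: "'i \<Rightarrow> complex"
  assumes "(\<lambda>(m, n). f m * g n) summable_on UNIV"
  shows "(\<Sum>\<^sub>\<infinity>(m, n). f m * g n) = infsum f UNIV * infsum g UNIV"
proof -
  have "(\<Sum>\<^sub>\<infinity>(m, n)\<in>UNIV \<times> UNIV. f m * g n) = (\<Sum>\<^sub>\<infinity>m. \<Sum>\<^sub>\<infinity>n. f m * g n)"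
    using infsum_Sigma_banach[of "\<lambda>(m, n). f m * g n" UNIV "\<lambda>_. UNIV"] assms by simp
  then show ?thesis by (simp add: infsum_cmult_right' infsum_cmult_left')
qed

abbreviation half_shift :: "int \<Rightarrow> int \<Rightarrow> complex"
  where "half_shift m a \<equiv> of_int m + of_int a / 2"

abbreviation theta_form :: "complex \<Rightarrow> complex \<Rightarrow> complex \<Rightarrow> complex \<Rightarrow> complex \<Rightarrow> int \<Rightarrow> int \<Rightarrow> complex"
  where "theta_form x y p z q d e \<equiv> x^2 * p + 2 * x * y * z + y^2 * q + x * of_int d + y * of_int e"

text \<open>The argument \<open>w\<close> is there for the inner sum of a two-variable series, where
  it becomes a multiple of the off-diagonal period. Integer characteristics let the transformation
  formulas hold exactly, before any reduction modulo 2.\<close>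

definition ctheta :: "int \<Rightarrow> int \<Rightarrow> complex \<Rightarrow> complex \<Rightarrow> complex"
  where "ctheta a d w \<sigma> = (\<Sum>\<^sub>\<infinity>m::int. exp (pi * \<i> *
    ((half_shift m a)^2 * \<sigma> + 2 * (half_shift m a) * w + (half_shift m a) * of_int d)))"

lemma ctheta_jtheta:
  "ctheta a d w \<sigma> = exp (pi * \<i> * (of_int a ^ 2 * \<sigma> / 4 + of_int a * w + of_int a * of_int d / 2))
     * jtheta (w + of_int d / 2 + of_int a * \<sigma> / 2) \<sigma>"
  unfolding ctheta_def jtheta_def infsum_cmult_right'[symmetric] exp_add[symmetric]
  by (intro infsum_cong arg_cong[where f = exp]) (simp add: power2_eq_square field_simps)

text \<open>Inversion exchanges the shift of the summation index with the shift of the argument,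
  hence the two rows of the characteristic, with one sign. The Gaussian factor of
  \<open>jtheta_inversion\<close> combines with the prefactors of
  \<open>ctheta_jtheta\<close>.\<close>

lemma ctheta_inversion:
  assumes "Im p > 0"
  shows "ctheta a d (w / p) (- 1 / p)
    = exp (pi * \<i> * (of_int a * of_int d / 2)) * csqrt (- \<i> * p) * exp (pi * \<i> * (w^2 / p)) * ctheta d (- a) w p"
proof -
  define X where "X = w / p + of_int d / 2 + of_int a * (- 1 / p) / 2"
  have p: "p \<noteq> 0" using assms by auto
  have pX: "p * X = w + of_int (- a) / 2 + of_int d * p / 2"
    using p by (simp add: X_def field_simps)
  have e: "of_int a ^ 2 * (- 1 / p) / 4 + of_int a * (w / p) + of_int a * of_int d / 2 + p * X^2
     = of_int a * of_int d / 2 + w^2 / p + (of_int d ^ 2 * p / 4 + of_int d * w + of_int d * of_int (- a) / 2)"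
    using p by (simp add: X_def field_simps power2_eq_square)
  have "ctheta a d (w / p) (- 1 / p) = exp (pi * \<i> * (of_int a ^ 2 * (- 1 / p) / 4 + of_int a * (w / p) + of_int a * of_int d / 2))
     * jtheta X (- 1 / p)"
    unfolding ctheta_jtheta X_def ..
  also have "\<dots> = csqrt (- \<i> * p) * exp (pi * \<i> * (of_int a ^ 2 * (- 1 / p) / 4 + of_int a * (w / p) + of_int a * of_int d / 2 + p * X^2))
     * jtheta (p * X) p"
    unfolding jtheta_inversion[OF assms, of X] by (simp add: distrib_left exp_add mult_ac)
  also have "\<dots> = exp (pi * \<i> * (of_int a * of_int d / 2)) * csqrt (- \<i> * p) * exp (pi * \<i> * (w^2 / p)) * ctheta d (- a) w p"
    unfolding e ctheta_jtheta[of d "- a"] pX by (simp only: distrib_left exp_add mult_ac)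
  finally show ?thesis .
qed

definition th2 :: "int \<Rightarrow> int \<Rightarrow> int \<Rightarrow> int \<Rightarrow> complex \<Rightarrow> complex \<Rightarrow> complex \<Rightarrow> complex"
  where "th2 a b d e p z q = (\<Sum>\<^sub>\<infinity>(m::int, n::int).
    exp (pi * \<i> * theta_form (half_shift m a) (half_shift n b) p z q d e))"

definition upper2 :: "complex \<Rightarrow> complex \<Rightarrow> complex \<Rightarrow> bool"
  where "upper2 p z q \<longleftrightarrow> Im p > 0 \<and> Im p * Im q > (Im z)^2"

lemma upper2_Im_pos:
  assumes "upper2 p z q"
  shows "Im p > 0" "Im q > 0"
proof -
  have "Im p * Im q > 0" using assms unfolding upper2_def by (smt (verit) zero_le_power2)
  then show "Im p > 0" "Im q > 0" using assms unfolding upper2_def by (auto simp: zero_less_mult_iff)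
qed

text \<open>The constant below is the determinant of the form divided by its trace, a lower bound for
  its smaller eigenvalue.\<close>

lemma upper2_coercive:
  assumes "upper2 p z q"
  obtains y where "y > 0"
    "\<And>u v. Im p * u^2 + 2 * Im z * u * v + Im q * v^2 \<ge> y * (u^2 + v^2)"
proof
  define y where "y = (Im p * Im q - (Im z)^2) / (Im p + Im q)"
  have pos: "Im p > 0" "Im q > 0" "Im p * Im q - (Im z)^2 > 0"
    using upper2_Im_pos[OF assms] assms by (auto simp: upper2_def)
  show "y > 0" using pos by (simp add: y_def)
  have py: "Im p - y > 0"
  proof -
    have "(Im p - y) * (Im p + Im q) = (Im p)^2 + (Im z)^2"
      using pos unfolding y_def by (simp add: field_simps power2_eq_square)
    moreover have "(Im p)^2 + (Im z)^2 > 0" using pos by (simp add: sum_power2_gt_zero_iff)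
    ultimately show ?thesis using pos by (smt (verit) zero_less_mult_pos2)
  qed
  \<comment> \<open>\<open>y\<close> times the trace is the determinant, so subtracting
    \<open>y\<close> from both diagonal entries leaves the determinant \<open>y^2\<close>, which is
    nonnegative.\<close>
  have dy: "(Im p - y) * (Im q - y) - (Im z)^2 = y^2"
  proof -
    have "y * (Im p + Im q) = Im p * Im q - (Im z)^2" using pos by (simp add: y_def)
    then show ?thesis by (simp add: algebra_simps power2_eq_square)
  qed
  fix u v :: real
  have "(Im p - y) * ((Im p - y) * u^2 + 2 * Im z * u * v + (Im q - y) * v^2)
     = ((Im p - y) * u + Im z * v)^2 + ((Im p - y) * (Im q - y) - (Im z)^2) * v^2"
    by (simp add: power2_eq_square algebra_simps)
  also have "\<dots> \<ge> 0" unfolding dy by simp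
  finally have "(Im p - y) * u^2 + 2 * Im z * u * v + (Im q - y) * v^2 \<ge> 0"
    using py by (simp add: zero_le_mult_iff)
  then show "Im p * u^2 + 2 * Im z * u * v + Im q * v^2 \<ge> y * (u^2 + v^2)"
    by (simp add: algebra_simps)
qed

lemma summable_on_shifted_gaussian2:
  fixes s t :: real
  assumes "c > 0"
  shows "(\<lambda>(m::int, n::int). exp (- c * ((real_of_int m + s)^2 + (real_of_int n + t)^2))) summable_on UNIV"
proof -
  define b where "b = 2 * c * (\<bar>s\<bar> + \<bar>t\<bar>)"
  have "(\<lambda>x::int\<times>int. norm (case x of (m, n) \<Rightarrow> exp (- c * ((real_of_int m + s)^2 + (real_of_int n + t)^2)))) summable_on UNIV"
  proof (rule Infinite_Sum.abs_summable_on_comparison_test'[OF summable_on_gaussian_int2[OF assms, of b]])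
    fix x :: "int \<times> int"
    obtain m n where x: "x = (m, n)" by (cases x)
    have q: "(real_of_int k + r)^2 \<ge> (real_of_int k)^2 - 2 * (\<bar>s\<bar> + \<bar>t\<bar>) * \<bar>real_of_int k\<bar>"
      if "\<bar>r\<bar> \<le> \<bar>s\<bar> + \<bar>t\<bar>" for k r
    proof -
      have "\<bar>real_of_int k * r\<bar> \<le> \<bar>real_of_int k\<bar> * (\<bar>s\<bar> + \<bar>t\<bar>)"
        unfolding abs_mult using that by (intro mult_left_mono) auto
      then have "- (real_of_int k * r) \<le> \<bar>real_of_int k\<bar> * (\<bar>s\<bar> + \<bar>t\<bar>)" by linarith
      moreover have "(real_of_int k + r)^2 = (real_of_int k)^2 + 2 * (real_of_int k * r) + r^2"
        by (simp add: power2_eq_square algebra_simps)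
      moreover have "r^2 \<ge> 0" by simp
      ultimately show ?thesis by (simp only: mult_ac)
    qed
    have "(real_of_int m + s)^2 + (real_of_int n + t)^2 \<ge> ((real_of_int m)^2 - 2 * (\<bar>s\<bar> + \<bar>t\<bar>) * \<bar>real_of_int m\<bar>)
       + ((real_of_int n)^2 - 2 * (\<bar>s\<bar> + \<bar>t\<bar>) * \<bar>real_of_int n\<bar>)"
      by (intro add_mono q) auto
    then have "c * ((real_of_int m + s)^2 + (real_of_int n + t)^2) \<ge> c * (((real_of_int m)^2 - 2 * (\<bar>s\<bar> + \<bar>t\<bar>) * \<bar>real_of_int m\<bar>)
       + ((real_of_int n)^2 - 2 * (\<bar>s\<bar> + \<bar>t\<bar>) * \<bar>real_of_int n\<bar>))"
      using assms by (intro mult_left_mono) auto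
    then show "norm (case x of (m, n) \<Rightarrow> exp (- c * ((real_of_int m + s)^2 + (real_of_int n + t)^2)))
       \<le> (case x of (m, n) \<Rightarrow> exp (- c * ((real_of_int m)^2 + (real_of_int n)^2) + b * (\<bar>real_of_int m\<bar> + \<bar>real_of_int n\<bar>)))"
      by (simp add: x b_def algebra_simps)
  qed
  then show ?thesis by (rule abs_summable_summable)
qed

text \<open>By coercivity the terms decay like \<open>exp (- 2 * r * \<dots>)\<close>. Half of this
  decay is kept for convergence, the other half is given away as the slack that differentiation in
  the matrix entries consumes.\<close>

lemma th2_norm_summable:
  assumes "upper2 p z q"
  shows "\<exists>r>0. (\<lambda>(m::int, n::int).
    exp (Re (pi * \<i> * theta_form (half_shift m a) (half_shift n b) p z q d e)
         + r * ((real_of_int m + of_int a / 2)^2 + (real_of_int n + of_int b / 2)^2))) summable_on UNIV"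
proof -
  obtain c where c: "c > 0" "\<And>u v. Im p * u^2 + 2 * Im z * u * v + Im q * v^2 \<ge> c * (u^2 + v^2)"
    using upper2_coercive[OF assms] by metis
  define r where "r = pi * c / 2"
  have r: "r > 0" using c by (simp add: r_def)
  have "(\<lambda>x::int\<times>int. norm (case x of (m, n) \<Rightarrow>
    exp (Re (pi * \<i> * theta_form (half_shift m a) (half_shift n b) p z q d e)
         + r * ((real_of_int m + of_int a / 2)^2 + (real_of_int n + of_int b / 2)^2)))) summable_on UNIV"
  proof (rule Infinite_Sum.abs_summable_on_comparison_test'[OF summable_on_shifted_gaussian2[OF r]])
    fix x :: "int \<times> int"
    obtain m n where x: "x = (m, n)" by (cases x)
    define u v where "u = real_of_int m + of_int a / 2" and "v = real_of_int n + of_int b / 2"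
    have uv: "of_int m + of_int a / 2 = complex_of_real u" "of_int n + of_int b / 2 = complex_of_real v"
      by (simp_all add: u_def v_def)
    have "Re (pi * \<i> * ((complex_of_real u)^2 * p + 2 * complex_of_real u * complex_of_real v * z + (complex_of_real v)^2 * q
         + complex_of_real u * of_int d + complex_of_real v * of_int e))
       = - pi * (Im p * u^2 + 2 * Im z * u * v + Im q * v^2)"
      by (simp add: power2_eq_square algebra_simps)
    also have "\<dots> \<le> - pi * (c * (u^2 + v^2))"
      using mult_left_mono[OF c(2)[of u v], of pi] by simp
    also have "\<dots> = - 2 * r * (u^2 + v^2)" by (simp add: r_def)
    finally show "norm (case x of (m, n) \<Rightarrow>
      exp (Re (pi * \<i> * theta_form (half_shift m a) (half_shift n b) p z q d e)
         + r * ((real_of_int m + of_int a / 2)^2 + (real_of_int n + of_int b / 2)^2)))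
      \<le> (case x of (m, n) \<Rightarrow> exp (- r * ((real_of_int m + of_int a / 2)^2 + (real_of_int n + of_int b / 2)^2)))"
      unfolding x prod.case uv u_def[symmetric] v_def[symmetric] real_norm_def abs_exp_cancel exp_le_cancel_iff
      by (simp add: algebra_simps)
  qed
  then have "(\<lambda>(m::int, n::int).
    exp (Re (pi * \<i> * theta_form (half_shift m a) (half_shift n b) p z q d e)
         + r * ((real_of_int m + of_int a / 2)^2 + (real_of_int n + of_int b / 2)^2))) summable_on UNIV"
    by (rule abs_summable_summable)
  with r show ?thesis by (intro exI[of _ r] conjI)
qed

lemma th2_summable:
  assumes "upper2 p z q"
  shows "(\<lambda>(m::int, n::int).
    exp (pi * \<i> * theta_form (half_shift m a) (half_shift n b) p z q d e)) summable_on UNIV"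
proof -
  obtain r where r: "r > 0" "(\<lambda>(m::int, n::int).
    exp (Re (pi * \<i> * theta_form (half_shift m a) (half_shift n b) p z q d e)
         + r * ((real_of_int m + of_int a / 2)^2 + (real_of_int n + of_int b / 2)^2))) summable_on UNIV"
    using th2_norm_summable[OF assms, of a b d e] by blast
  have le: "norm (exp w) \<le> exp (Re w + r * (u^2 + v^2))" for w :: complex and u v :: real
    using r(1) by simp
  show ?thesis
    by (rule abs_summable_summable, rule Infinite_Sum.abs_summable_on_comparison_test'[OF r(2)],
        unfold case_prod_unfold) (rule le)
qed

section \<open>Transformation of the two-variable series\<close>

lemma th2_shift_upper: "th2 (a + 2 * k) (b + 2 * l) d e p z q = th2 a b d e p z q"
proof -
  have "bij_betw (\<lambda>(m, n). (m + k, n + l)) (UNIV :: (int \<times> int) set) UNIV"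
    by (rule bij_betw_byWitness[where f' = "\<lambda>(m, n). (m - k, n - l)"]) auto
  note re = infsum_reindex_bij_betw[OF this, of "\<lambda>(m, n). exp (pi * \<i> * theta_form (half_shift m a) (half_shift n b) p z q d e)", symmetric]
  have s: "complex_of_int i + of_int (c + 2 * j) / 2 = of_int (i + j) + of_int c / 2" for i j c
    by (simp add: field_simps)
  show ?thesis
    unfolding th2_def re unfolding case_prod_unfold fst_conv snd_conv s ..
qed

lemma exp_pi_i_int_even: "exp (pi * \<i> * (2 * of_int k)) = (1 :: complex)"
  using exp_int_two_pi_i[of k] by (simp add: mult_ac)

lemma exp_pi_i_cong:
  assumes "w - w' = 2 * of_int k"
  shows "exp (pi * \<i> * w) = exp (pi * \<i> * w' :: complex)"
proof -
  have "pi * \<i> * w = pi * \<i> * w' + pi * \<i> * (2 * of_int k)" using assms by (simp add: algebra_simps)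
  then show ?thesis by (simp only: exp_add exp_pi_i_int_even mult_1_right)
qed

lemma exp_power4: "exp w ^ 4 = exp (4 * w :: complex)"
  using exp_of_nat_mult[of 4 w] by simp

lemma exp_pi_i_power4:
  assumes "4 * w = 2 * of_int k"
  shows "exp (pi * \<i> * w) ^ 4 = (1 :: complex)"
proof -
  have "exp (pi * \<i> * w) ^ 4 = exp (pi * \<i> * (4 * w))"
    by (simp add: exp_power4 mult_ac)
  then show ?thesis unfolding assms exp_pi_i_int_even .
qed

text \<open>\<open>exp (2 * pi * \<i> * (m + a / 2) * k)\<close> does not depend on the integer
  \<open>m\<close>.\<close>

lemma th2_shift_lower:
  "th2 a b (d + 2 * k) (e + 2 * l) p z q = exp (pi * \<i> * of_int (a * k + b * l)) * th2 a b d e p z q"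
  unfolding th2_def infsum_cmult_right'[symmetric]
  by (rule infsum_cong, unfold case_prod_unfold exp_add[symmetric] distrib_left[symmetric],
      rule_tac k = "fst x * k + snd x * l" in exp_pi_i_cong) (simp add: algebra_simps)

text \<open>Another integer lift of the characteristic changes the series by a sign at most, which
  the fourth power removes.\<close>

lemma th2_power4_cong:
  assumes "even (a - a')" "even (b - b')" "even (d - d')" "even (e - e')"
  shows "th2 a b d e p z q ^ 4 = th2 a' b' d' e' p z q ^ 4"
proof -
  have ex: "\<exists>k. x = y + 2 * k" if "even (x - y)" for x y :: int
  proof -
    from that obtain k where "x - y = 2 * k" by (elim evenE)
    then have "x = y + 2 * k" by simp
    then show ?thesis ..
  qed
  obtain k l k' l' where eq: "a = a' + 2 * k" "b = b' + 2 * l" "d = d' + 2 * k'" "e = e' + 2 * l'"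
    using ex[OF assms(1)] ex[OF assms(2)] ex[OF assms(3)] ex[OF assms(4)] by (elim exE)
  show ?thesis
    unfolding eq th2_shift_upper th2_shift_lower power_mult_distrib
    by (subst exp_pi_i_power4[where k = "2 * ((a' + 2 * k) * k' + (b' + 2 * l) * l')"]) auto
qed

text \<open>Modulo 2 the integer \<open>m^2 * r\<close> equals \<open>m * r\<close>, so the
  quadratic term that the translation adds becomes linear in the index and moves into the lower
  characteristic. The constant is what remains after rewriting it in the shifted indices.\<close>

lemma th2_translation:
  "th2 a b d e (p + of_int r) (z + of_int s) (q + of_int t)
    = exp (pi * \<i> * (- of_int (2 * a * r + a^2 * r + 2 * b * t + b^2 * t + 2 * a * b * s) / 4))
      * th2 a b (d + r + r * a + s * b) (e + t + t * b + s * a) p z q"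
  unfolding th2_def infsum_cmult_right'[symmetric]
proof (rule infsum_cong, unfold case_prod_unfold exp_add[symmetric] distrib_left[symmetric])
  fix x :: "int \<times> int"
  obtain m n where x: "x = (m, n)" by (cases x)
  have "even (m * (m - 1) * r + n * (n - 1) * t)" by simp
  then obtain k where k: "m * (m - 1) * r + n * (n - 1) * t = 2 * k" by (elim evenE)
  have k': "complex_of_int k = (of_int m * (of_int m - 1) * of_int r + of_int n * (of_int n - 1) * of_int t) / 2"
    using arg_cong[OF k, of complex_of_int] by simp
  show "exp (pi * \<i> * theta_form (half_shift (fst x) a) (half_shift (snd x) b) (p + of_int r) (z + of_int s) (q + of_int t) d e)
     = exp (pi * \<i> * (- of_int (2 * a * r + a^2 * r + 2 * b * t + b^2 * t + 2 * a * b * s) / 4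
      + (theta_form (half_shift (fst x) a) (half_shift (snd x) b) p z q (d + r + r * a + s * b) (e + t + t * b + s * a))))"
  proof (rule exp_pi_i_cong[where k = "k + m * n * s"])
    show "theta_form (half_shift (fst x) a) (half_shift (snd x) b) (p + of_int r) (z + of_int s) (q + of_int t) d e
     - (- of_int (2 * a * r + a^2 * r + 2 * b * t + b^2 * t + 2 * a * b * s) / 4
      + (theta_form (half_shift (fst x) a) (half_shift (snd x) b) p z q (d + r + r * a + s * b) (e + t + t * b + s * a))) = 2 * of_int (k + m * n * s)"
      unfolding x fst_conv snd_conv by (simp add: k' power2_eq_square field_simps)
  qed
qed

text \<open>The eighth root of unity becomes a sign; as \<open>a^2\<close> is \<open>a\<close>
  modulo 2, this sign is a character of the upper row.\<close>

lemma th2_translation_power4: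
  "th2 a b d e (p + of_int r) (z + of_int s) (q + of_int t) ^ 4
    = exp (pi * \<i> * of_int (a * r + b * t)) * th2 a b (d + r + r * a + s * b) (e + t + t * b + s * a) p z q ^ 4"
proof -
  have "exp (pi * \<i> * (- of_int (2 * a * r + a^2 * r + 2 * b * t + b^2 * t + 2 * a * b * s) / 4)) ^ 4
     = exp (pi * \<i> * (- of_int (2 * a * r + a^2 * r + 2 * b * t + b^2 * t + 2 * a * b * s)))"
    unfolding exp_power4 by (rule arg_cong[where f = exp]) simp
  also have "\<dots> = exp (pi * \<i> * of_int (a * r + b * t))"
  proof -
    have "even ((a * (a - 1) * r + b * (b - 1) * t) + 2 * (2 * a * r + 2 * b * t + a * b * s))" by simp
    then obtain k where k: "(a * (a - 1) * r + b * (b - 1) * t) + 2 * (2 * a * r + 2 * b * t + a * b * s) = 2 * k"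
      by (elim evenE)
    show ?thesis
    proof (rule exp_pi_i_cong[where k = "- k"])
      have "- (2 * a * r + a^2 * r + 2 * b * t + b^2 * t + 2 * a * b * s) - (a * r + b * t) = 2 * (- k)"
        using k by (simp add: power2_eq_square algebra_simps)
      from arg_cong[OF this, of complex_of_int]
      show "- complex_of_int (2 * a * r + a^2 * r + 2 * b * t + b^2 * t + 2 * a * b * s) - of_int (a * r + b * t) = 2 * of_int (- k)"
        by simp
    qed
  qed
  finally show ?thesis unfolding th2_translation power_mult_distrib by simp
qed

text \<open>With \<open>U\<close> the matrix with rows \<open>(u\<^sub>1, u\<^sub>2)\<close>, \<open>(u\<^sub>3, u\<^sub>4)\<close> and inverse \<open>V\<close>, the period matrix on the left
  is \<open>U \<tau> U\<^sup>t\<close>.\<close>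

lemma th2_base_change:
  assumes U: "u1 * v1 + u2 * v3 = 1" "u1 * v2 + u2 * v4 = 0" "u3 * v1 + u4 * v3 = 0" "u3 * v2 + u4 * v4 = 1"
    and V: "v1 * u1 + v2 * u3 = 1" "v1 * u2 + v2 * u4 = 0" "v3 * u1 + v4 * u3 = 0" "v3 * u2 + v4 * u4 = 1"
  shows "th2 a b d e
      (of_int u1^2 * p + 2 * of_int u1 * of_int u2 * z + of_int u2^2 * q)
      (of_int u1 * of_int u3 * p + (of_int u1 * of_int u4 + of_int u2 * of_int u3) * z + of_int u2 * of_int u4 * q)
      (of_int u3^2 * p + 2 * of_int u3 * of_int u4 * z + of_int u4^2 * q)
    = th2 (u1 * a + u3 * b) (u2 * a + u4 * b) (v1 * d + v2 * e) (v3 * d + v4 * e) p z q"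
proof -
  have "bij_betw (\<lambda>(m, n). (u1 * m + u3 * n, u2 * m + u4 * n)) (UNIV :: (int \<times> int) set) UNIV"
  proof (rule bij_betw_byWitness[where f' = "\<lambda>(m, n). (v1 * m + v3 * n, v2 * m + v4 * n)"])
    show "\<forall>x\<in>UNIV. (case (case x of (m, n) \<Rightarrow> (u1 * m + u3 * n, u2 * m + u4 * n)) of (m, n) \<Rightarrow> (v1 * m + v3 * n, v2 * m + v4 * n)) = x"
    proof clarify
      fix m n :: int
      have "v1 * (u1 * m + u3 * n) + v3 * (u2 * m + u4 * n) = (u1 * v1 + u2 * v3) * m + (u3 * v1 + u4 * v3) * n"
           "v2 * (u1 * m + u3 * n) + v4 * (u2 * m + u4 * n) = (u1 * v2 + u2 * v4) * m + (u3 * v2 + u4 * v4) * n"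
        by (simp_all add: algebra_simps)
      then show "v1 * (u1 * m + u3 * n) + v3 * (u2 * m + u4 * n) = m \<and> v2 * (u1 * m + u3 * n) + v4 * (u2 * m + u4 * n) = n"
        using U by simp
    qed
    show "\<forall>x\<in>UNIV. (case (case x of (m, n) \<Rightarrow> (v1 * m + v3 * n, v2 * m + v4 * n)) of (m, n) \<Rightarrow> (u1 * m + u3 * n, u2 * m + u4 * n)) = x"
    proof clarify
      fix m n :: int
      have "u1 * (v1 * m + v3 * n) + u3 * (v2 * m + v4 * n) = (v1 * u1 + v2 * u3) * m + (v3 * u1 + v4 * u3) * n"
           "u2 * (v1 * m + v3 * n) + u4 * (v2 * m + v4 * n) = (v1 * u2 + v2 * u4) * m + (v3 * u2 + v4 * u4) * n"
        by (simp_all add: algebra_simps)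
      then show "u1 * (v1 * m + v3 * n) + u3 * (v2 * m + v4 * n) = m \<and> u2 * (v1 * m + v3 * n) + u4 * (v2 * m + v4 * n) = n"
        using V by simp
    qed
  qed auto
  note re = infsum_reindex_bij_betw[OF this, of "\<lambda>(m, n). exp (pi * \<i> * theta_form (half_shift m (u1 * a + u3 * b)) (half_shift n (u2 * a + u4 * b)) p z q (v1 * d + v2 * e) (v3 * d + v4 * e))", symmetric]
  have C: "of_int u1 * of_int v1 + of_int u2 * of_int v3 = (1::complex)" "of_int u1 * of_int v2 + of_int u2 * of_int v4 = (0::complex)"
    "of_int u3 * of_int v1 + of_int u4 * of_int v3 = (0::complex)" "of_int u3 * of_int v2 + of_int u4 * of_int v4 = (1::complex)"
    using arg_cong[OF U(1), of complex_of_int] arg_cong[OF U(2), of complex_of_int]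
      arg_cong[OF U(3), of complex_of_int] arg_cong[OF U(4), of complex_of_int] by simp_all
  show ?thesis
    unfolding th2_def re
  proof (rule infsum_cong, unfold case_prod_unfold fst_conv snd_conv, rule arg_cong[where f = exp], rule arg_cong[where f = "\<lambda>w. pi * \<i> * w"])
    fix x :: "int \<times> int"
    define X Y where "X = complex_of_int (fst x) + of_int a / 2" and "Y = complex_of_int (snd x) + of_int b / 2"
    have X': "complex_of_int (u1 * fst x + u3 * snd x) + of_int (u1 * a + u3 * b) / 2 = of_int u1 * X + of_int u3 * Y"
      "complex_of_int (u2 * fst x + u4 * snd x) + of_int (u2 * a + u4 * b) / 2 = of_int u2 * X + of_int u4 * Y"
      by (simp_all add: X_def Y_def field_simps)
    have "(of_int u1 * X + of_int u3 * Y) * of_int (v1 * d + v2 * e) + (of_int u2 * X + of_int u4 * Y) * of_int (v3 * d + v4 * e)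
      = X * ((of_int u1 * of_int v1 + of_int u2 * of_int v3) * of_int d + (of_int u1 * of_int v2 + of_int u2 * of_int v4) * of_int e)
       + Y * ((of_int u3 * of_int v1 + of_int u4 * of_int v3) * of_int d + (of_int u3 * of_int v2 + of_int u4 * of_int v4) * of_int e)"
      by (simp add: algebra_simps)
    then have l: "(of_int u1 * X + of_int u3 * Y) * of_int (v1 * d + v2 * e) + (of_int u2 * X + of_int u4 * Y) * of_int (v3 * d + v4 * e)
      = X * of_int d + Y * of_int e" unfolding C by simp
    show "(complex_of_int (fst x) + of_int a / 2)^2 * (of_int u1^2 * p + 2 * of_int u1 * of_int u2 * z + of_int u2^2 * q)
      + 2 * (half_shift (fst x) a) * (half_shift (snd x) b)
        * (of_int u1 * of_int u3 * p + (of_int u1 * of_int u4 + of_int u2 * of_int u3) * z + of_int u2 * of_int u4 * q)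
      + (half_shift (snd x) b)^2 * (of_int u3^2 * p + 2 * of_int u3 * of_int u4 * z + of_int u4^2 * q)
      + (half_shift (fst x) a) * of_int d + (half_shift (snd x) b) * of_int e
      = theta_form (half_shift (u1 * fst x + u3 * snd x) (u1 * a + u3 * b)) (half_shift (u2 * fst x + u4 * snd x) (u2 * a + u4 * b)) p z q (v1 * d + v2 * e) (v3 * d + v4 * e)"
      unfolding X' X_def[symmetric] Y_def[symmetric] add.assoc l
      by (simp add: power2_eq_square algebra_simps)
  qed
qed

text \<open>For a fixed second index the remaining sum is a one-variable theta series with argument
  \<open>(n + b / 2) * z\<close>, within reach of \<open>ctheta_inversion\<close>.\<close>

lemma th2_iterated:
  assumes "upper2 p z q"
  shows "th2 a b d e p z q = (\<Sum>\<^sub>\<infinity>n::int. exp (pi * \<i> * ((half_shift n b)^2 * q + (half_shift n b) * of_int e))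
     * ctheta a d ((half_shift n b) * z) p)"
proof -
  let ?f = "\<lambda>(m::int) (n::int). exp (pi * \<i> * theta_form (half_shift m a) (half_shift n b) p z q d e) :: complex"
  have s: "(\<lambda>(m, n). ?f m n) summable_on UNIV \<times> UNIV"
    using th2_summable[OF assms, of a b d e] by simp
  have "th2 a b d e p z q = (\<Sum>\<^sub>\<infinity>(m, n)\<in>UNIV \<times> UNIV. ?f m n)"
    unfolding th2_def by simp
  also have "\<dots> = (\<Sum>\<^sub>\<infinity>m. \<Sum>\<^sub>\<infinity>n. ?f m n)"
    using infsum_Sigma_banach[OF s] by simp
  also have "\<dots> = (\<Sum>\<^sub>\<infinity>n. \<Sum>\<^sub>\<infinity>m. ?f m n)"
    by (rule infsum_swap_banach[OF s])
  also have "\<dots> = (\<Sum>\<^sub>\<infinity>n::int. exp (pi * \<i> * ((half_shift n b)^2 * q + (half_shift n b) * of_int e))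
     * ctheta a d ((half_shift n b) * z) p)"
    unfolding ctheta_def infsum_cmult_right'[symmetric] exp_add[symmetric] distrib_left[symmetric]
    by (intro infsum_cong arg_cong[where f = exp] arg_cong[where f = "\<lambda>w. pi * \<i> * w"]) (simp add: algebra_simps)
  finally show ?thesis .
qed

text \<open>Partial inversion divides the determinant of the imaginary part by \<open>N\<close>, the
  squared absolute value of \<open>p\<close>.\<close>

lemma upper2_partial_inversion:
  assumes "upper2 p z q"
  shows "upper2 (- 1 / p) (z / p) (q - z^2 / p)"
proof -
  obtain p1 p2 z1 z2 q1 q2 where eq: "p = Complex p1 p2" "z = Complex z1 z2" "q = Complex q1 q2"
    by (metis complex.exhaust)
  define N where "N = p1^2 + p2^2"
  have p2: "p2 > 0" and D: "p2 * q2 - z2^2 > 0" using assms by (simp_all add: upper2_def eq)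
  have N: "N > 0" using p2 by (simp add: N_def sum_power2_gt_zero_iff)
  have i1: "Im (- 1 / p) = p2 / N" by (simp add: eq Im_divide N_def)
  have i2: "Im (z / p) = (z2 * p1 - z1 * p2) / N" by (simp add: eq Im_divide N_def)
  have i3: "Im (q - z^2 / p) = q2 - (2 * z1 * z2 * p1 - (z1^2 - z2^2) * p2) / N"
    by (simp add: eq Im_divide N_def power2_eq_square)
  have "(p2 / N) * (q2 - (2 * z1 * z2 * p1 - (z1^2 - z2^2) * p2) / N) - ((z2 * p1 - z1 * p2) / N)^2
     = (p2 * q2 * N - p2 * (2 * z1 * z2 * p1 - (z1^2 - z2^2) * p2) - (z2 * p1 - z1 * p2)^2) / N^2"
    using N by (simp add: field_simps power2_eq_square)
  also have "p2 * q2 * N - p2 * (2 * z1 * z2 * p1 - (z1^2 - z2^2) * p2) - (z2 * p1 - z1 * p2)^2 = (p2 * q2 - z2^2) * N"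
    by (simp add: N_def power2_eq_square algebra_simps)
  also have "(p2 * q2 - z2^2) * N / N^2 > 0" using D N by simp
  finally show ?thesis unfolding upper2_def i1 i2 i3 using p2 N by simp
qed

text \<open>For each second index, with \<open>w = (n + b / 2) * z\<close>, the Gaussian factor
  \<open>exp (pi * \<i> * w^2 / p)\<close> of the inversion cancels the correction
  \<open>- z^2 / p\<close> in the last entry. The factor that remains is the same for all
  indices.\<close>

lemma th2_partial_inversion:
  assumes up: "upper2 p z q"
  shows "th2 a b d e (- 1 / p) (z / p) (q - z^2 / p)
    = exp (pi * \<i> * (of_int a * of_int d / 2)) * csqrt (- \<i> * p) * th2 d b (- a) e p z q"
proof -
  have p: "Im p > 0" using up by (simp add: upper2_def)
  have "exp (pi * \<i> * ((half_shift n b)^2 * (q - z^2 / p) + (half_shift n b) * of_int e))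
     * ctheta a d ((half_shift n b) * (z / p)) (- 1 / p)
    = (exp (pi * \<i> * (of_int a * of_int d / 2)) * csqrt (- \<i> * p)) * (exp (pi * \<i> * ((half_shift n b)^2 * q + (half_shift n b) * of_int e))
     * ctheta d (- a) ((half_shift n b) * z) p)" for n :: int
  proof -
    define y where "y = complex_of_int n + of_int b / 2"
    have "exp (pi * \<i> * (y^2 * (q - z^2 / p) + y * of_int e)) * exp (pi * \<i> * ((y * z)^2 / p)) = exp (pi * \<i> * (y^2 * q + y * of_int e))"
      unfolding exp_add[symmetric] by (rule arg_cong[where f = exp]) (simp add: power_mult_distrib algebra_simps)
    then show ?thesis
      using ctheta_inversion[OF p, of a d "y * z"] unfolding y_def[symmetric] by (simp add: mult_ac)
  qed
  then show ?thesis
    unfolding th2_iterated[OF up] th2_iterated[OF upper2_partial_inversion[OF up]]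
    by (simp add: infsum_cmult_right')
qed

text \<open>The fourth power makes the square root single-valued:
  \<open>csqrt (- \<i> * p) ^ 4\<close> is \<open>- (p^2)\<close>, and \<open>p\<close> is the
  determinant of the automorphy matrix of this generator.\<close>

lemma th2_partial_inversion_power4:
  assumes up: "upper2 p z q"
  shows "th2 a b d e (- 1 / p) (z / p) (q - z^2 / p) ^ 4 = - (p^2) * th2 d b a e p z q ^ 4"
proof -
  have "csqrt (- \<i> * p) ^ (2 * 2) = (csqrt (- \<i> * p) ^ 2) ^ 2" by (rule power_mult)
  also have "\<dots> = - (p^2)" unfolding power2_csqrt by (simp add: power_mult_distrib)
  finally have "csqrt (- \<i> * p) ^ 4 = - (p^2)" by simp
  moreover have "exp (pi * \<i> * (of_int a * of_int d / 2)) ^ 4 = (1::complex)"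
    by (rule exp_pi_i_power4[where k = "a * d"]) simp
  moreover have "th2 d b (- a) e p z q ^ 4 = th2 d b a e p z q ^ 4"
    by (rule th2_power4_cong) auto
  ultimately show ?thesis unfolding th2_partial_inversion[OF up] power_mult_distrib by simp
qed

section \<open>Generators of the symplectic group\<close>

lemma forall_2_plus: "(\<forall>k::2+2. P k) \<longleftrightarrow> P (Inl 1) \<and> P (Inl 2) \<and> P (Inr 1) \<and> P (Inr 2)"
  by (simp add: split_sum_all forall_2 conj_assoc)

lemma sum_plus_UNIV:
  fixes f :: "'a::finite + 'b::finite \<Rightarrow> 'c::comm_monoid_add"
  shows "(\<Sum>k\<in>UNIV. f k) = (\<Sum>i\<in>UNIV. f (Inl i)) + (\<Sum>i\<in>UNIV. f (Inr i))"
  unfolding UNIV_Plus_UNIV[symmetric] by (subst sum.Plus) auto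

definition blk :: "'a^'g^'g \<Rightarrow> 'a^'g^'g \<Rightarrow> 'a^'g^'g \<Rightarrow> 'a^'g^'g \<Rightarrow> 'a^('g + 'g)^('g + 'g)"
  where "blk A B C D = (\<chi> i j. case i of
      Inl a \<Rightarrow> (case j of Inl b \<Rightarrow> A $ a $ b | Inr b \<Rightarrow> B $ a $ b)
    | Inr a \<Rightarrow> (case j of Inl b \<Rightarrow> C $ a $ b | Inr b \<Rightarrow> D $ a $ b))"

lemma blk_nth [simp]:
  "blk A B C D $ Inl a $ Inl b = A $ a $ b" "blk A B C D $ Inl a $ Inr b = B $ a $ b"
  "blk A B C D $ Inr a $ Inl b = C $ a $ b" "blk A B C D $ Inr a $ Inr b = D $ a $ b"
  by (simp_all add: blk_def)

lemma blk_sel [simp]: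
  "blkA (blk A B C D) = A" "blkB (blk A B C D) = B" "blkC (blk A B C D) = C" "blkD (blk A B C D) = D"
  by (simp_all add: blkA_def blkB_def blkC_def blkD_def vec_eq_iff)

lemma blk_eqI:
  assumes "\<And>a b. M $ Inl a $ Inl b = N $ Inl a $ Inl b" "\<And>a b. M $ Inl a $ Inr b = N $ Inl a $ Inr b"
    "\<And>a b. M $ Inr a $ Inl b = N $ Inr a $ Inl b" "\<And>a b. M $ Inr a $ Inr b = N $ Inr a $ Inr b"
  shows "M = (N :: 'a^('g::finite + 'g)^('g + 'g))"
  unfolding vec_eq_iff split_sum_all using assms by blast

lemma blk_blocks: "blk (blkA \<gamma>) (blkB \<gamma>) (blkC \<gamma>) (blkD \<gamma>) = \<gamma>"
  by (rule blk_eqI) (simp_all add: blkA_def blkB_def blkC_def blkD_def)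

lemma blk_inject: "blk A B C D = blk A' B' C' D' \<longleftrightarrow> A = A' \<and> B = B' \<and> C = C' \<and> D = D'"
  by (metis blk_sel)

lemma blk_mult:
  fixes A :: "'a::semiring_1^'g::finite^'g"
  shows "blk A B C D ** blk A' B' C' D' = blk (A ** A' + B ** C') (A ** B' + B ** D') (C ** A' + D ** C') (C ** B' + D ** D')"
  by (rule blk_eqI) (simp_all add: matrix_matrix_mult_def sum_plus_UNIV)

lemma transpose_blk: "transpose (blk A B C D) = blk (transpose A) (transpose C) (transpose B) (transpose D)"
  by (rule blk_eqI) (simp_all add: transpose_def)

lemma one_blk: "(mat 1 :: 'a::semiring_1^('g::finite+'g)^('g+'g)) = blk (mat 1) 0 0 (mat 1)"
  by (rule blk_eqI) (simp_all add: mat_def)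

lemma transpose_zero_matrix [simp]: "transpose (0 :: 'a::zero^'n^'m) = 0"
  by (simp add: transpose_def vec_eq_iff)

lemma sympl_J_blk: "sympl_J = blk 0 (mat 1) (- mat 1) 0"
  by (rule blk_eqI) (simp_all add: sympl_J_def mat_def)

lemma neg_one_matrix_mult [simp]:
  fixes M :: "int^'g::finite^'g"
  shows "M ** (- mat 1) = - M" "(- mat 1) ** M = - M"
  by (simp_all add: matrix_matrix_mult_def mat_def vec_eq_iff if_distrib if_distribR sum_negf cong: if_cong)

lemma zero_matrix_mult [simp]:
  fixes M :: "'a::semiring_1^'g::finite^'g"
  shows "M ** 0 = 0" "0 ** M = 0"
  by (simp_all add: matrix_matrix_mult_def vec_eq_iff)

lemma neg_matrix_mult [simp]:
  fixes M :: "int^'g::finite^'g"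
  shows "(- M) ** N = - (M ** N)" "M ** (- N) = - (M ** N)"
  by (simp_all add: matrix_matrix_mult_def vec_eq_iff sum_negf)

text \<open>Of the four block equations the lower left one is the negative transpose of the upper
  right one.\<close>

lemma blk_in_Sp_Z:
  "blk A B C D \<in> Sp_Z \<longleftrightarrow> transpose A ** C = transpose C ** A \<and>
     transpose A ** D - transpose C ** B = mat 1 \<and> transpose B ** D = transpose D ** B"
proof -
  have t: "transpose (transpose A ** D - transpose C ** B) = - (transpose B ** C - transpose D ** A)"
    unfolding transpose_def matrix_matrix_mult_def by (simp add: vec_eq_iff mult.commute)
  have m: "transpose (mat 1 :: int^'a^'a) = mat 1" by simp
  have "transpose (blk A B C D) ** sympl_J ** blk A B C D
     = blk (transpose A ** C - transpose C ** A) (transpose A ** D - transpose C ** B)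
         (transpose B ** C - transpose D ** A) (transpose B ** D - transpose D ** B)"
    unfolding sympl_J_blk transpose_blk blk_mult by (simp add: algebra_simps)
  then have "blk A B C D \<in> Sp_Z \<longleftrightarrow> transpose A ** C = transpose C ** A \<and>
     transpose A ** D - transpose C ** B = mat 1 \<and> transpose B ** C - transpose D ** A = - mat 1
     \<and> transpose B ** D = transpose D ** B"
    unfolding Sp_Z_def mem_Collect_eq by (simp only: sympl_J_blk blk_inject right_minus_eq)
  then show ?thesis using t m by (metis minus_minus)
qed

lemma Sp_Z_mult:
  assumes "\<gamma>\<^sub>1 \<in> Sp_Z" "\<gamma>\<^sub>2 \<in> Sp_Z"
  shows "\<gamma>\<^sub>1 ** \<gamma>\<^sub>2 \<in> Sp_Z"
proof -
  have "transpose (\<gamma>\<^sub>1 ** \<gamma>\<^sub>2) ** sympl_J ** (\<gamma>\<^sub>1 ** \<gamma>\<^sub>2) = transpose \<gamma>\<^sub>2 ** (transpose \<gamma>\<^sub>1 ** sympl_J ** \<gamma>\<^sub>1) ** \<gamma>\<^sub>2"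
    by (simp add: matrix_transpose_mul matrix_mul_assoc)
  then show ?thesis using assms by (simp add: Sp_Z_def)
qed

definition mat2 :: "'a \<Rightarrow> 'a \<Rightarrow> 'a \<Rightarrow> 'a \<Rightarrow> 'a^2^2"
  where "mat2 a b c d = (\<chi> i j. if i = 1 then (if j = 1 then a else b) else (if j = 1 then c else d))"

lemma mat2_nth [simp]:
  "mat2 a b c d $ 1 $ 1 = a" "mat2 a b c d $ 1 $ 2 = b" "mat2 a b c d $ 2 $ 1 = c" "mat2 a b c d $ 2 $ 2 = d"
  by (simp_all add: mat2_def)

lemma mat2_eq_iff: "M = N \<longleftrightarrow> M $ 1 $ 1 = N $ 1 $ 1 \<and> M $ 1 $ 2 = N $ 1 $ 2 \<and> M $ 2 $ 1 = N $ 2 $ 1 \<and> M $ 2 $ 2 = N $ 2 $ 2"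
  for M N :: "'a^2^2"
  by (simp only: vec_eq_iff forall_2 conj_assoc)

lemma mat2_entries: "mat2 (M $ 1 $ 1) (M $ 1 $ 2) (M $ 2 $ 1) (M $ 2 $ 2) = M"
  by (simp add: mat2_eq_iff)

lemma mat2_inject [simp]: "mat2 a b c d = mat2 a' b' c' d' \<longleftrightarrow> a = a' \<and> b = b' \<and> c = c' \<and> d = d'"
  by (simp add: mat2_eq_iff)

lemma mat2_mult [simp]:
  fixes a :: "'a::semiring_1"
  shows "mat2 a b c d ** mat2 a' b' c' d' = mat2 (a * a' + b * c') (a * b' + b * d') (c * a' + d * c') (c * b' + d * d')"
  by (simp add: mat2_eq_iff matrix_matrix_mult_def sum_2)

lemma mat2_add [simp]: "mat2 a b c d + mat2 a' b' c' d' = mat2 (a + a') (b + b') (c + c') (d + d')"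
  by (simp add: mat2_eq_iff)

lemma mat2_diff [simp]: "mat2 a b c d - mat2 a' b' c' d' = mat2 (a - a') (b - b') (c - c') (d - d')"
  for a :: "'a::group_add"
  by (simp add: mat2_eq_iff)

lemma transpose_mat2 [simp]: "transpose (mat2 a b c d) = mat2 a c b d"
  by (simp add: mat2_eq_iff transpose_def)

lemma mat2_one: "(mat 1 :: 'a::semiring_1^2^2) = mat2 1 0 0 1"
  by (simp add: mat2_eq_iff mat_def)

lemma mat2_zero: "(0 :: 'a::zero^2^2) = mat2 0 0 0 0"
  by (simp add: mat2_eq_iff)

lemma det_mat2: "det (mat2 a b c d) = a * d - b * c"
  by (simp add: det_2)

text \<open>A copy of \<open>SL(2)\<close> in \<open>Sp(4)\<close>: multiplied from the left it
  combines the first rows of the upper and the lower half, leaving the second rows alone. This is a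
  row operation of the elimination below.\<close>

definition sl2_first :: "int \<Rightarrow> int \<Rightarrow> int \<Rightarrow> int \<Rightarrow> int^(2+2)^(2+2)"
  where "sl2_first a b c d = blk (mat2 a 0 0 1) (mat2 b 0 0 0) (mat2 c 0 0 0) (mat2 d 0 0 1)"

definition sl2_second :: "int \<Rightarrow> int \<Rightarrow> int \<Rightarrow> int \<Rightarrow> int^(2+2)^(2+2)"
  where "sl2_second a b c d = blk (mat2 1 0 0 a) (mat2 0 0 0 b) (mat2 0 0 0 c) (mat2 1 0 0 d)"

text \<open>Closed under products only; an inverse that occurs is shown to lie in the set itself and
  is cancelled by \<open>gen_cancel\<close>.\<close>

inductive_set Sp4_gen :: "(int^(2+2)^(2+2)) set" where
  translation: "transpose S = S \<Longrightarrow> blk (mat 1) S 0 (mat 1) \<in> Sp4_gen"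
| base_change: "U ** V = mat 1 \<Longrightarrow> V ** U = mat 1 \<Longrightarrow> blk U 0 0 (transpose V) \<in> Sp4_gen"
| inversion: "sl2_first 0 (-1) 1 0 \<in> Sp4_gen"
| mult: "\<gamma>\<^sub>1 \<in> Sp4_gen \<Longrightarrow> \<gamma>\<^sub>2 \<in> Sp4_gen \<Longrightarrow> \<gamma>\<^sub>1 ** \<gamma>\<^sub>2 \<in> Sp4_gen"

lemma Sp4_gen_in_Sp_Z: "\<gamma> \<in> Sp4_gen \<Longrightarrow> \<gamma> \<in> Sp_Z"
proof (induction rule: Sp4_gen.induct)
  case (translation S)
  then show ?case by (simp add: blk_in_Sp_Z)
next
  case (base_change U V)
  then show ?case
    by (simp add: blk_in_Sp_Z matrix_transpose_mul[symmetric])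
next
  case inversion
  then show ?case by (simp add: sl2_first_def blk_in_Sp_Z mat2_one)
next
  case (mult \<gamma>\<^sub>1 \<gamma>\<^sub>2)
  then show ?case by (simp add: Sp_Z_mult)
qed

section \<open>Generation of the symplectic group by row elimination\<close>

lemma sl2_first_mult:
  "sl2_first a b c d ** sl2_first a' b' c' d' = sl2_first (a * a' + b * c') (a * b' + b * d') (c * a' + d * c') (c * b' + d * d')"
  by (simp add: sl2_first_def blk_mult)

lemma sl2_second_mult:
  "sl2_second a b c d ** sl2_second a' b' c' d' = sl2_second (a * a' + b * c') (a * b' + b * d') (c * a' + d * c') (c * b' + d * d')"
  by (simp add: sl2_second_def blk_mult)

lemma sl2_first_translation: "sl2_first 1 b 0 1 \<in> Sp4_gen"
  using Sp4_gen.translation[of "mat2 b 0 0 0"] by (simp add: sl2_first_def mat2_one mat2_zero)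

text \<open>Euclidean algorithm on the first column, by descent on the absolute value of the lower
  left entry.\<close>

lemma sl2_first_in_gen: "a * d - b * c = 1 \<Longrightarrow> sl2_first a b c d \<in> Sp4_gen"
proof (induction "nat \<bar>c\<bar>" arbitrary: a b c d rule: less_induct)
  case less
  show ?case
  proof (cases "c = 0")
    case True
    then have "a * d = 1" using less.prems by simp
    then consider "a = 1" "d = 1" | "a = -1" "d = -1" using zmult_eq_1_iff by blast
    then show ?thesis
    proof cases
      case 1 then show ?thesis using sl2_first_translation True by simp
    next
      case 2
      \<comment> \<open>The square of the inversion is minus the identity on this plane, which
        accounts for the diagonal entries -1.\<close>
      have "sl2_first 0 (-1) 1 0 ** sl2_first 0 (-1) 1 0 ** sl2_first 1 (- b) 0 1 \<in> Sp4_gen"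
        by (intro Sp4_gen.mult Sp4_gen.inversion sl2_first_translation)
      then show ?thesis using 2 True by (simp add: sl2_first_mult)
    qed
  next
    case False
    \<comment> \<open>Subtracting \<open>q\<close> times the lower row from the upper one and
      undoing an inversion puts the negated remainder \<open>a mod c\<close> into the lower left
      corner.\<close>
    define q where "q = a div c"
    have r: "a - q * c = a mod c" by (simp add: q_def minus_div_mult_eq_mod)
    have "\<bar>a mod c\<bar> < \<bar>c\<bar>" using False by (rule abs_mod_less)
    then have lt: "nat \<bar>- (a - q * c)\<bar> < nat \<bar>c\<bar>" unfolding r using False by simp
    have dt: "c * (- (b - q * d)) - d * (- (a - q * c)) = 1"
      using less.prems by (simp add: algebra_simps)
    have "sl2_first 1 q 0 1 ** (sl2_first 0 (-1) 1 0 ** sl2_first c d (- (a - q * c)) (- (b - q * d))) \<in> Sp4_gen"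
      by (intro Sp4_gen.mult Sp4_gen.inversion sl2_first_translation less.hyps[OF lt dt])
    then show ?thesis by (simp add: sl2_first_mult)
  qed
qed

text \<open>Conjugation by the base change that swaps the two coordinates.\<close>

lemma sl2_second_in_gen:
  assumes "a * d - b * c = 1"
  shows "sl2_second a b c d \<in> Sp4_gen"
proof -
  have W: "blk (mat2 0 1 1 0) 0 0 (mat2 0 1 1 0) \<in> Sp4_gen"
    using Sp4_gen.base_change[of "mat2 0 1 1 0" "mat2 0 1 1 0"] by (simp add: mat2_one)
  have "blk (mat2 0 1 1 0) 0 0 (mat2 0 1 1 0) ** sl2_first a b c d ** blk (mat2 0 1 1 0) 0 0 (mat2 0 1 1 0) \<in> Sp4_gen"
    by (intro Sp4_gen.mult W sl2_first_in_gen assms)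
  then show ?thesis by (simp add: sl2_first_def sl2_second_def blk_mult)
qed

text \<open>The second row is \<open>(- y, x)\<close> divided by the gcd, the first row consists of
  Bezout coefficients. It is the row operation that clears one of two entries of a column.\<close>

lemma unimodular_annihilator:
  fixes x y :: int
  obtains a b c d where "a * d - b * c = 1" "c * x + d * y = 0"
proof (cases "x = 0 \<and> y = 0")
  case True
  then show thesis using that[of 1 1 0 0] by simp
next
  case False
  define g where "g = gcd x y"
  have g: "g \<noteq> 0" using False by (simp add: g_def)
  obtain u v where uv: "u * x + v * y = g" using bezout_int unfolding g_def by blast
  have "g dvd x" "g dvd y" by (simp_all add: g_def)
  then obtain x' y' where xy: "x = g * x'" "y = g * y'" by (elim dvdE)
  have "g * (u * x' + v * y') = g * 1"
    using uv unfolding xy by (simp add: algebra_simps)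
  then have "u * x' + v * y' = 1" using g by (simp only: mult_cancel_left) simp
  moreover have "- y' * x + x' * y = 0" by (simp add: xy)
  ultimately show thesis by (intro that[of u x' v "- y'"]) auto
qed

lemma gen_cancel:
  assumes "h' \<in> Sp4_gen" "h' ** h = mat 1" "h ** \<gamma> \<in> Sp4_gen"
  shows "\<gamma> \<in> Sp4_gen"
proof -
  have "h' ** (h ** \<gamma>) \<in> Sp4_gen" by (intro Sp4_gen.mult assms)
  then show ?thesis by (simp add: matrix_mul_assoc assms(2))
qed

lemma sl2_first_inverse: "a * d - b * c = 1 \<Longrightarrow> sl2_first d (- b) (- c) a ** sl2_first a b c d = mat 1"
  unfolding sl2_first_mult by (simp add: sl2_first_def one_blk mat2_one mat2_zero algebra_simps)

lemma sl2_second_inverse: "a * d - b * c = 1 \<Longrightarrow> sl2_second d (- b) (- c) a ** sl2_second a b c d = mat 1"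
  unfolding sl2_second_mult by (simp add: sl2_second_def one_blk mat2_one mat2_zero algebra_simps)

lemma base_change_in_gen:
  assumes "a * d - b * c = 1"
  shows "blk (mat2 a b c d) 0 0 (mat2 d (- c) (- b) a) \<in> Sp4_gen"
  using Sp4_gen.base_change[of "mat2 a b c d" "mat2 d (- b) (- c) a"] assms
  by (simp add: mat2_one algebra_simps)

text \<open>The matrix is the translation by \<open>B ** transpose A\<close> times the base change
  with blocks \<open>A\<close> and \<open>D\<close>. The symmetry of \<open>B ** transpose A\<close>
  is the relation between \<open>B\<close> and \<open>D\<close> conjugated by
  \<open>A\<close>.\<close>

lemma gen_if_lower_left_zero:
  assumes "blk A B 0 D \<in> Sp_Z" "A ** transpose D = mat 1"
  shows "blk A B 0 D \<in> Sp4_gen"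
proof -
  have AD: "transpose A ** D = mat 1" and BD: "transpose B ** D = transpose D ** B"
    using assms(1) by (simp_all add: blk_in_Sp_Z)
  have DA: "transpose D ** A = mat 1"
    using arg_cong[OF AD, of transpose] by (simp add: matrix_transpose_mul)
  have DA': "D ** transpose A = mat 1"
    using arg_cong[OF assms(2), of transpose] by (simp add: matrix_transpose_mul)
  have "A ** (transpose B ** D) ** transpose A = A ** (transpose D ** B) ** transpose A"
    unfolding BD ..
  then have "A ** transpose B ** (D ** transpose A) = (A ** transpose D) ** B ** transpose A"
    by (simp add: matrix_mul_assoc)
  then have "transpose (B ** transpose A) = B ** transpose A"
    by (simp add: DA' assms(2) matrix_transpose_mul)
  then have "blk (mat 1) (B ** transpose A) 0 (mat 1) ** blk A 0 0 D \<in> Sp4_gen"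
    using Sp4_gen.base_change[of A "transpose D"] assms(2) DA
    by (intro Sp4_gen.mult Sp4_gen.translation) auto
  then show ?thesis by (simp add: blk_mult matrix_mul_assoc[symmetric] AD)
qed

theorem Sp_Z_subset_gen:
  assumes "\<gamma> \<in> Sp_Z"
  shows "\<gamma> \<in> Sp4_gen"
proof -
  text \<open>Clear the lower left block one entry at a time, multiplying by generators on the left.\<close>
  have step4: "\<gamma> \<in> Sp4_gen" if sp: "\<gamma> \<in> Sp_Z" and \<gamma>: "\<gamma> = blk (mat2 a1 a2 0 a4) B (mat2 0 0 0 0) D" for \<gamma> a1 a2 a4 B D
  proof -
    have "transpose (mat2 a1 a2 0 a4) ** D = mat 1"
      using sp unfolding \<gamma> mat2_zero[symmetric] by (simp add: blk_in_Sp_Z)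
    moreover obtain d1 d2 d3 d4 where D: "D = mat2 d1 d2 d3 d4" by (metis mat2_entries)
    ultimately have e: "a1 * d1 = 1" "a1 * d2 = 0" "a2 * d1 + a4 * d3 = 0" "a2 * d2 + a4 * d4 = 1"
      by (simp_all add: mat2_one)
    then have z: "d2 = 0" by auto
    then have e4: "a4 * d4 = 1" using e by simp
    have "(a1 * d4) * (a2 * d1 + a4 * d3) = a2 * d4 * (a1 * d1) + a1 * d3 * (a4 * d4)"
      by (simp add: algebra_simps)
    then have "a1 * d3 + a2 * d4 = 0" using e(1,3) e4 by simp
    then have "mat2 a1 a2 0 a4 ** transpose D = mat 1"
      using e e4 z by (simp add: D mat2_one)
    then show ?thesis using sp unfolding \<gamma> mat2_zero[symmetric] by (intro gen_if_lower_left_zero)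
  qed
  have step3: "\<gamma> \<in> Sp4_gen" if sp: "\<gamma> \<in> Sp_Z" and \<gamma>: "\<gamma> = blk (mat2 a1 a2 0 a4) B (mat2 0 c2 0 c4) D" for \<gamma> a1 a2 a4 B c2 c4 D
  proof -
    have AC: "transpose (mat2 a1 a2 0 a4) ** mat2 0 c2 0 c4 = transpose (mat2 0 c2 0 c4) ** mat2 a1 a2 0 a4"
      and AD: "transpose (mat2 a1 a2 0 a4) ** D - transpose (mat2 0 c2 0 c4) ** B = mat 1"
      using sp unfolding \<gamma> blk_in_Sp_Z by blast+
    obtain d1 d2 d3 d4 where D: "D = mat2 d1 d2 d3 d4" by (metis mat2_entries)
    obtain b1 b2 b3 b4 where B: "B = mat2 b1 b2 b3 b4" by (metis mat2_entries)
    have "a1 * d1 = 1" using AD by (simp add: B D mat2_one)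
    \<comment> \<open>The first column of the whole matrix is now \<open>(a1, 0, 0, 0)\<close>, so
      \<open>a1\<close> is a unit, and symmetry of \<open>A^t C\<close> reads
      \<open>a1 * c2 = 0\<close>. This entry vanishes without a further row operation.\<close>
    then have "c2 = 0" using AC by auto
    obtain a b c d where abcd: "a * d - b * c = 1" "c * a4 + d * c4 = 0"
      using unimodular_annihilator[of a4 c4] by metis
    have "sl2_second a b c d ** \<gamma> = blk (mat2 a1 a2 0 (a * a4 + b * c4)) (mat2 1 0 0 a ** B + mat2 0 0 0 b ** D)
        (mat2 0 0 0 0) (mat2 0 0 0 c ** B + mat2 1 0 0 d ** D)"
      using abcd \<open>c2 = 0\<close> unfolding \<gamma> sl2_second_def blk_mult by (simp add: algebra_simps)
    moreover have "sl2_second a b c d ** \<gamma> \<in> Sp_Z"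
      by (intro Sp_Z_mult sp Sp4_gen_in_Sp_Z sl2_second_in_gen abcd(1))
    ultimately have "sl2_second a b c d ** \<gamma> \<in> Sp4_gen" by (intro step4)
    moreover have "sl2_second d (- b) (- c) a \<in> Sp4_gen"
      using abcd(1) by (intro sl2_second_in_gen) (simp add: algebra_simps)
    ultimately show ?thesis using gen_cancel sl2_second_inverse[OF abcd(1)] by blast
  qed
  have step2: "\<gamma> \<in> Sp4_gen" if sp: "\<gamma> \<in> Sp_Z" and \<gamma>: "\<gamma> = blk (mat2 a1 a2 a3 a4) B (mat2 0 c2 0 c4) D" for \<gamma> a1 a2 a3 a4 B c2 c4 D
  proof -
    obtain a b c d where abcd: "a * d - b * c = 1" "c * a1 + d * a3 = 0"
      using unimodular_annihilator[of a1 a3] by metis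
    \<comment> \<open>A base change multiplies the lower blocks by the contragredient matrix, so the
      first column of the lower left block stays zero while \<open>a3\<close> is cleared.\<close>
    let ?h = "blk (mat2 a b c d) 0 0 (mat2 d (- c) (- b) a)"
    have h: "?h \<in> Sp4_gen" by (rule base_change_in_gen[OF abcd(1)])
    have h': "blk (mat2 d (- b) (- c) a) 0 0 (mat2 a c b d) \<in> Sp4_gen"
      using base_change_in_gen[of d a "- b" "- c"] abcd(1) by (simp add: algebra_simps)
    have inv: "blk (mat2 d (- b) (- c) a) 0 0 (mat2 a c b d) ** ?h = mat 1"
      using abcd(1) by (simp add: blk_mult one_blk mat2_one mat2_zero algebra_simps)
    have "?h ** \<gamma> = blk (mat2 (a * a1 + b * a3) (a * a2 + b * a4) 0 (c * a2 + d * a4)) (mat2 a b c d ** B)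
        (mat2 0 (d * c2 - c * c4) 0 (a * c4 - b * c2)) (mat2 d (- c) (- b) a ** D)"
      using abcd unfolding \<gamma> blk_mult by simp
    moreover have "?h ** \<gamma> \<in> Sp_Z" by (intro Sp_Z_mult sp Sp4_gen_in_Sp_Z h)
    ultimately have "?h ** \<gamma> \<in> Sp4_gen" by (intro step3)
    with h' inv show ?thesis by (rule gen_cancel)
  qed
  have step1: "\<gamma> \<in> Sp4_gen" if sp: "\<gamma> \<in> Sp_Z" and \<gamma>: "\<gamma> = blk (mat2 a1 a2 a3 a4) B (mat2 0 c2 c3 c4) D" for \<gamma> a1 a2 a3 a4 B c2 c3 c4 D
  proof -
    obtain a b c d where abcd: "a * d - b * c = 1" "c * a3 + d * c3 = 0"
      using unimodular_annihilator[of a3 c3] by metis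
    have "sl2_second a b c d ** \<gamma> = blk (mat2 a1 a2 (a * a3 + b * c3) (a * a4 + b * c4)) (mat2 1 0 0 a ** B + mat2 0 0 0 b ** D)
        (mat2 0 c2 0 (c * a4 + d * c4)) (mat2 0 0 0 c ** B + mat2 1 0 0 d ** D)"
      using abcd unfolding \<gamma> sl2_second_def blk_mult by simp
    moreover have "sl2_second a b c d ** \<gamma> \<in> Sp_Z"
      by (intro Sp_Z_mult sp Sp4_gen_in_Sp_Z sl2_second_in_gen abcd(1))
    ultimately have "sl2_second a b c d ** \<gamma> \<in> Sp4_gen" by (intro step2)
    moreover have "sl2_second d (- b) (- c) a \<in> Sp4_gen"
      using abcd(1) by (intro sl2_second_in_gen) (simp add: algebra_simps)
    ultimately show ?thesis using gen_cancel sl2_second_inverse[OF abcd(1)] by blast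
  qed
  define A B C D where ABCD: "A = blkA \<gamma>" "B = blkB \<gamma>" "C = blkC \<gamma>" "D = blkD \<gamma>"
  have \<gamma>: "\<gamma> = blk (mat2 (A $ 1 $ 1) (A $ 1 $ 2) (A $ 2 $ 1) (A $ 2 $ 2)) B (mat2 (C $ 1 $ 1) (C $ 1 $ 2) (C $ 2 $ 1) (C $ 2 $ 2)) D"
    unfolding mat2_entries ABCD blk_blocks ..
  obtain a b c d where abcd: "a * d - b * c = 1" "c * A $ 1 $ 1 + d * C $ 1 $ 1 = 0"
    using unimodular_annihilator[of "A $ 1 $ 1" "C $ 1 $ 1"] by metis
  have "sl2_first a b c d ** \<gamma> = blk (mat2 (a * A $ 1 $ 1 + b * C $ 1 $ 1) (a * A $ 1 $ 2 + b * C $ 1 $ 2) (A $ 2 $ 1) (A $ 2 $ 2))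
      (mat2 a 0 0 1 ** B + mat2 b 0 0 0 ** D)
      (mat2 0 (c * A $ 1 $ 2 + d * C $ 1 $ 2) (C $ 2 $ 1) (C $ 2 $ 2)) (mat2 c 0 0 0 ** B + mat2 d 0 0 1 ** D)"
    using abcd by (subst \<gamma>) (simp add: sl2_first_def blk_mult)
  moreover have "sl2_first a b c d ** \<gamma> \<in> Sp_Z"
    by (intro Sp_Z_mult assms Sp4_gen_in_Sp_Z sl2_first_in_gen abcd(1))
  ultimately have "sl2_first a b c d ** \<gamma> \<in> Sp4_gen" by (intro step1)
  moreover have "sl2_first d (- b) (- c) a \<in> Sp4_gen"
    using abcd(1) by (intro sl2_first_in_gen) (simp add: algebra_simps)
  ultimately show ?thesis using gen_cancel sl2_first_inverse[OF abcd(1)] by blast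
qed

section \<open>Sums over spaces of characteristics\<close>

lemma bit_UNIV: "(UNIV :: bit set) = {0, 1}"
  by (auto simp: bit_not_one_iff)

lemma bit_vec_add_self [simp]: "x + x = (0 :: bit^'n)"
  by (simp add: vec_eq_iff)

lemma bit_vec_add_self_left: "x + (x + y) = (y :: bit^'n)"
  by (simp add: add.assoc[symmetric])

lemma bit_vec_add_eq_0_iff: "x + y = 0 \<longleftrightarrow> x = (y :: bit^'n)"
  by (metis add.right_neutral add_left_cancel bit_vec_add_self add.commute)

lemma bit_vec_span_singleton: "vec.span {v} = {0, v :: bit^'n}"
  by (auto simp: vec.span_singleton bit_UNIV)

lemma bit_vec_span_pair: "vec.span {u, v} = {0, u, v, u + v :: bit^'n}"
proof -
  have "vec.span {u, v} = {x. \<exists>k. x - k *s u \<in> {0, v}}"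
    unfolding vec.span_insert[of u] bit_vec_span_singleton ..
  also have "\<dots> = {x. x \<in> {0, v} \<or> x - u \<in> {0, v}}"
  proof -
    have "(\<exists>k::bit. P k) \<longleftrightarrow> P 0 \<or> P 1" for P
      by (metis bit_not_one_iff)
    then show ?thesis by simp
  qed
  also have "\<dots> = {0, u, v, u + v}"
    by (auto simp: algebra_simps)
  finally show ?thesis .
qed

lemma bit_vec_dim_0_iff: "vec.subspace V \<and> vec.dim V = 0 \<longleftrightarrow> V = {0 :: bit^'n}"
proof
  assume V: "vec.subspace V \<and> vec.dim V = 0"
  obtain B where B: "B \<subseteq> V" "vec.independent B" "V \<subseteq> vec.span B" "card B = vec.dim V"
    by (metis vec.basis_exists)
  have "B = {}" using B(2,4) V vec.finiteI_independent by auto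
  then have "V \<subseteq> {0}" using B(3) by simp
  then show "V = {0}" using V vec.subspace_0 by blast
next
  assume V: "V = {0}"
  have "vec.dim (vec.span {} :: (bit^'n) set) = card ({} :: (bit^'n) set)"
    by (rule vec.dim_span_eq_card_independent) (rule vec.independent_empty)
  then show "vec.subspace V \<and> vec.dim V = 0"
    unfolding V by (simp add: vec.subspace_single_0)
qed

lemma bit_vec_dim_1_iff: "vec.subspace V \<and> vec.dim V = 1 \<longleftrightarrow> (\<exists>v. v \<noteq> 0 \<and> V = {0, v :: bit^'n})"
proof
  assume V: "vec.subspace V \<and> vec.dim V = 1"
  obtain B where B: "B \<subseteq> V" "vec.independent B" "V \<subseteq> vec.span B" "card B = vec.dim V"
    by (metis vec.basis_exists)
  then obtain v where v: "B = {v}" using V by (metis card_1_singletonE)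
  have "v \<noteq> 0" using B(2) vec.dependent_zero v by blast
  moreover have "V = vec.span B"
    using B V vec.span_minimal by blast
  ultimately show "\<exists>v. v \<noteq> 0 \<and> V = {0, v}" unfolding v bit_vec_span_singleton by blast
next
  assume "\<exists>v. v \<noteq> 0 \<and> V = {0, v}"
  then obtain v where v: "v \<noteq> 0" "V = vec.span {v}" unfolding bit_vec_span_singleton by blast
  have "vec.independent {v}" using v(1) by simp
  then show "vec.subspace V \<and> vec.dim V = 1"
    unfolding v(2) using vec.dim_span_eq_card_independent[of "{v}"] by (simp add: vec.subspace_span)
qed

lemma bit_vec_dim_2_iff:
  "vec.subspace V \<and> vec.dim V = 2 \<longleftrightarrow> (\<exists>u v. u \<noteq> 0 \<and> v \<noteq> 0 \<and> u \<noteq> v \<and> V = {0, u, v, u + v :: bit^'n})"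
proof
  assume V: "vec.subspace V \<and> vec.dim V = 2"
  obtain B where B: "B \<subseteq> V" "vec.independent B" "V \<subseteq> vec.span B" "card B = vec.dim V"
    by (metis vec.basis_exists)
  then have "card B = 2" using V by simp
  then obtain u v where uv: "B = {u, v}" "u \<noteq> v" unfolding card_2_iff by blast
  have "u \<noteq> 0" "v \<noteq> 0" using B(2) vec.dependent_zero uv(1) by blast+
  moreover have "V = vec.span B"
    using B V vec.span_minimal by blast
  ultimately show "\<exists>u v. u \<noteq> 0 \<and> v \<noteq> 0 \<and> u \<noteq> v \<and> V = {0, u, v, u + v}"
    using uv(2) unfolding uv(1) bit_vec_span_pair by blast
next
  assume "\<exists>u v. u \<noteq> 0 \<and> v \<noteq> 0 \<and> u \<noteq> v \<and> V = {0, u, v, u + v}"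
  then obtain u v where uv: "u \<noteq> 0" "v \<noteq> 0" "u \<noteq> v" "V = vec.span {u, v}" unfolding bit_vec_span_pair by blast
  have "u \<notin> vec.span {v}" using uv by (simp add: bit_vec_span_singleton)
  then have "vec.independent {u, v}" using uv(2,3) by (simp add: vec.independent_insert)
  then show "vec.subspace V \<and> vec.dim V = 2"
    unfolding uv(4) using vec.dim_span_eq_card_independent[of "{u, v}"] uv(3) by (simp add: vec.subspace_span)
qed

text \<open>Over the field with two elements distinct nonzero vectors are independent, so these are
  the ordered bases of planes.\<close>

definition proper_pairs :: "((bit^'n) \<times> (bit^'n)) set"
  where "proper_pairs = {(u, v). u \<noteq> 0 \<and> v \<noteq> 0 \<and> u \<noteq> v}"

lemma sum_dim_1_subspaces:
  fixes F :: "(bit^'n) set \<Rightarrow> complex"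
  shows "(\<Sum>V | vec.subspace V \<and> vec.dim V = 1. F V) = (\<Sum>v | v \<noteq> 0. F {0, v})"
proof -
  have "{V :: (bit^'n) set. vec.subspace V \<and> vec.dim V = 1} = (\<lambda>v. {0, v}) ` {v. v \<noteq> 0}"
    unfolding bit_vec_dim_1_iff by blast
  moreover have "inj_on (\<lambda>v. {0, v :: bit^'n}) {v. v \<noteq> 0}"
    by (rule inj_onI) (metis doubleton_eq_iff)
  ultimately show ?thesis by (simp add: sum.reindex)
qed

text \<open>A plane has three nonzero vectors, any two of which form a basis: six ordered
  bases.\<close>

lemma sum_dim_2_subspaces:
  fixes F :: "(bit^'n) set \<Rightarrow> complex"
  shows "6 * (\<Sum>V | vec.subspace V \<and> vec.dim V = 2. F V) = (\<Sum>(u, v)\<in>proper_pairs. F {0, u, v, u + v})"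
proof -
  let ?S = "{V :: (bit^'n) set. vec.subspace V \<and> vec.dim V = 2}"
  let ?g = "\<lambda>(u, v). {0, u, v, u + v :: bit^'n}"
  have img: "?g ` proper_pairs = ?S"
    unfolding bit_vec_dim_2_iff proper_pairs_def by (auto simp: image_iff)
  have fib: "card {x \<in> proper_pairs. ?g x = V} = 6" if "V \<in> ?S" for V
  proof -
    from that obtain a b where ab: "a \<noteq> 0" "b \<noteq> 0" "a \<noteq> b" "V = {0, a, b, a + b}"
      unfolding bit_vec_dim_2_iff mem_Collect_eq by blast
    define W where "W = {a, b, a + b}"
    have n: "a + b \<noteq> 0" "a + b \<noteq> a" "a + b \<noteq> b" using ab by (simp_all add: bit_vec_add_eq_0_iff)
    have W: "card W = 3" "finite W" using ab n unfolding W_def by auto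
    have cl: "{0, u, v, u + v} = V" if "u \<in> W" "v \<in> W" "u \<noteq> v" for u v
    proof -
      have s: "a + (a + b) = b" "b + (a + b) = a" "a + b + a = b" "a + b + b = a" "b + a = a + b"
        by (simp_all only: add_ac bit_vec_add_self bit_vec_add_self_left add_0_left add_0_right)
      show ?thesis using that unfolding W_def ab(4) by (auto simp: s)
    qed
    have "{x \<in> proper_pairs. ?g x = V} = W \<times> W - (\<lambda>w. (w, w)) ` W"
    proof (intro equalityI subsetI)
      fix x assume x: "x \<in> {x \<in> proper_pairs. ?g x = V}"
      obtain u v where uv: "x = (u, v)" by (cases x)
      then have "u \<in> V" "v \<in> V" "u \<noteq> 0" "v \<noteq> 0" "u \<noteq> v" using x by (auto simp: proper_pairs_def)
      then show "x \<in> W \<times> W - (\<lambda>w. (w, w)) ` W" unfolding uv ab(4) W_def by auto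
    next
      fix x assume x: "x \<in> W \<times> W - (\<lambda>w. (w, w)) ` W"
      obtain u v where uv: "x = (u, v)" by (cases x)
      then have w: "u \<in> W" "v \<in> W" "u \<noteq> v" using x by auto
      then have "u \<noteq> 0" "v \<noteq> 0" using ab n unfolding W_def by auto
      then show "x \<in> {x \<in> proper_pairs. ?g x = V}" using w cl[OF w] by (simp add: uv proper_pairs_def)
    qed
    moreover have "card (W \<times> W - (\<lambda>w. (w, w)) ` W) = 6"
    proof -
      have "card ((\<lambda>w. (w, w)) ` W) = 3" using W by (simp add: card_image inj_on_def)
      moreover have "card (W \<times> W) = 9" using W by (simp add: card_cartesian_product)
      moreover have "(\<lambda>w. (w, w)) ` W \<subseteq> W \<times> W" by auto
      ultimately show ?thesis using W by (simp add: card_Diff_subset)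
    qed
    ultimately show ?thesis by simp
  qed
  have "(\<Sum>x\<in>proper_pairs. F (?g x)) = (\<Sum>V\<in>?g ` proper_pairs. \<Sum>x | x \<in> proper_pairs \<and> ?g x = V. F (?g x))"
    by (rule sum.image_gen) simp
  also have "\<dots> = (\<Sum>V\<in>?S. 6 * F V)"
    unfolding img
  proof (rule sum.cong[OF refl])
    fix V assume V: "V \<in> ?S"
    have "(\<Sum>x | x \<in> proper_pairs \<and> ?g x = V. F (?g x)) = (\<Sum>x | x \<in> proper_pairs \<and> ?g x = V. F V)"
      by (rule sum.cong) auto
    then show "(\<Sum>x | x \<in> proper_pairs \<and> ?g x = V. F (?g x)) = 6 * F V"
      using fib[OF V] by simp
  qed
  finally show ?thesis by (simp add: sum_distrib_left case_prod_unfold)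
qed

text \<open>The form attached to an arbitrary characteristic \<open>c\<close> in place of 0: the full symplectic group
  permutes these forms. The sum over all pairs contains each plane \<open>c + V\<close> six times, and the
  remaining terms correct for the degenerate pairs.\<close>

definition Xi_at :: "(bit^'n \<Rightarrow> complex) \<Rightarrow> bit^'n \<Rightarrow> complex"
  where "Xi_at t c = ((\<Sum>x\<in>UNIV. \<Sum>y\<in>UNIV. t c * t x * t y * t (x + y + c)) + 8 * t c ^ 4
    - 6 * t c ^ 2 * (\<Sum>x\<in>UNIV. t x ^ 2)) / 12"

text \<open>The dependent pairs are \<open>(0, 0)\<close> and, for each nonzero \<open>v\<close>,
  the three pairs spanning the line of \<open>v\<close>.\<close>

lemma sum_all_pairs:
  fixes f :: "bit^'n \<Rightarrow> bit^'n \<Rightarrow> complex"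
  shows "(\<Sum>x\<in>UNIV. \<Sum>y\<in>UNIV. f x y) = f 0 0 + (\<Sum>v | v \<noteq> 0. f 0 v + f v 0 + f v v) + (\<Sum>(u, v)\<in>proper_pairs. f u v)"
proof -
  have U: "(UNIV :: (bit^'n) set) = insert 0 {v. v \<noteq> 0}" by auto
  have s: "(\<Sum>x\<in>UNIV. g x) = g 0 + (\<Sum>v | v \<noteq> 0. g v)" for g :: "bit^'n \<Rightarrow> complex"
    by (subst U) simp
  have r: "(\<Sum>y | y \<noteq> 0. f x y) = f x x + (\<Sum>y | y \<noteq> 0 \<and> x \<noteq> y. f x y)" if "x \<noteq> 0" for x
  proof -
    have "{y. y \<noteq> 0} = insert x {y. y \<noteq> 0 \<and> x \<noteq> y}" using that by auto
    then show ?thesis by simp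
  qed
  have "(\<Sum>x\<in>UNIV. \<Sum>y\<in>UNIV. f x y) = f 0 0 + (\<Sum>v | v \<noteq> 0. f 0 v) + (\<Sum>x | x \<noteq> 0. f x 0 + (\<Sum>y | y \<noteq> 0. f x y))"
    unfolding s ..
  also have "(\<Sum>x | x \<noteq> 0. f x 0 + (\<Sum>y | y \<noteq> 0. f x y)) = (\<Sum>x | x \<noteq> 0. f x 0 + (f x x + (\<Sum>y | y \<noteq> 0 \<and> x \<noteq> y. f x y)))"
    by (rule sum.cong) (auto simp: r)
  also have "\<dots> = (\<Sum>x | x \<noteq> 0. f x 0) + (\<Sum>x | x \<noteq> 0. f x x) + (\<Sum>x | x \<noteq> 0. \<Sum>y | y \<noteq> 0 \<and> x \<noteq> y. f x y)"
    by (simp add: sum.distrib add.assoc)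
  also have "(\<Sum>x | x \<noteq> 0. \<Sum>y | y \<noteq> 0 \<and> x \<noteq> y. f x y) = (\<Sum>(u, v)\<in>Sigma {x. x \<noteq> 0} (\<lambda>x. {y. y \<noteq> 0 \<and> x \<noteq> y}). f u v)"
    by (rule sum.Sigma) auto
  also have "Sigma {x. x \<noteq> 0} (\<lambda>x. {y. y \<noteq> 0 \<and> x \<noteq> y}) = (proper_pairs :: ((bit^'n) \<times> (bit^'n)) set)"
    by (auto simp: proper_pairs_def)
  finally show ?thesis by (simp add: sum.distrib)
qed

lemma G_form_0: "G_form 0 \<tau> = (theta 0 \<tau> ^ 4) ^ 4"
  unfolding G_form_def bit_vec_dim_0_iff by (simp add: theta_prod_def power_mult[symmetric])

lemma G_form_1: "G_form 1 \<tau> = (\<Sum>v | v \<noteq> 0. (theta 0 \<tau> ^ 4)^2 * (theta v \<tau> ^ 4)^2)"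
  unfolding G_form_def sum_dim_1_subspaces
  by (rule sum.cong) (auto simp: theta_prod_def power_mult_distrib power_mult[symmetric])

lemma G_form_2: "6 * G_form 2 \<tau> = (\<Sum>(u, v)\<in>proper_pairs. theta 0 \<tau> ^ 4 * theta u \<tau> ^ 4 * theta v \<tau> ^ 4 * theta (u + v) \<tau> ^ 4)"
  unfolding G_form_def sum_dim_2_subspaces
proof (rule sum.cong[OF refl], clarify)
  fix u v :: "bit^('a + 'a)" assume "(u, v) \<in> proper_pairs"
  then have "u \<noteq> 0" "v \<noteq> 0" "u \<noteq> v" by (auto simp: proper_pairs_def)
  moreover have "u + v \<noteq> 0" "u + v \<noteq> u" "u + v \<noteq> v" using calculation by (simp_all add: bit_vec_add_eq_0_iff)
  moreover note calculation[symmetric]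
  ultimately have "theta_prod {0, u, v, u + v} \<tau> = theta 0 \<tau> * theta u \<tau> * theta v \<tau> * theta (u + v) \<tau>"
    unfolding theta_prod_def by (simp add: mult_ac)
  then show "theta_prod {0, u, v, u + v} \<tau> ^ 2 ^ (4 - 2) = theta 0 \<tau> ^ 4 * theta u \<tau> ^ 4 * theta v \<tau> ^ 4 * theta (u + v) \<tau> ^ 4"
    by (simp add: power_mult_distrib)
qed

text \<open>Origin of the constants: the dependent pairs contribute
  \<open>t 0 ^ 4 + 3 * t 0 ^ 2 * S\<close> to the double sum, so adding
  \<open>8 * t 0 ^ 4 - 6 * t 0 ^ 2 * (t 0 ^ 2 + S)\<close> leaves
  \<open>3 * G_0 - 3 * G_1 + 6 * G_2\<close>, which is 12 times the form.\<close>

lemma Xi2_eq_Xi_at: "Xi2 \<tau> = Xi_at (\<lambda>v. theta v \<tau> ^ 4) 0"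
proof -
  define t where "t = (\<lambda>v. theta v \<tau> ^ 4)"
  define P where "P = (\<Sum>(u, v)\<in>proper_pairs. t 0 * t u * t v * t (u + v))"
  define S where "S = (\<Sum>v | v \<noteq> 0. t v ^ 2)"
  have U: "(UNIV :: (bit^(2+2)) set) = insert 0 {v. v \<noteq> 0}" by auto
  have S': "(\<Sum>x\<in>UNIV. t x ^ 2) = t 0 ^ 2 + S"
    unfolding S_def by (subst U) simp
  have "(\<Sum>x\<in>UNIV. \<Sum>y\<in>UNIV. t 0 * t x * t y * t (x + y + 0)) = t 0 ^ 4 + 3 * t 0 ^ 2 * S + P"
    unfolding sum_all_pairs P_def S_def
    by (simp add: sum_distrib_left power2_eq_square power4_eq_xxxx algebra_simps)
  moreover have "G_form 0 \<tau> = t 0 ^ 4" "G_form 1 \<tau> = t 0 ^ 2 * S" "6 * G_form 2 \<tau> = P"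
    unfolding G_form_0 G_form_1 G_form_2 t_def S_def P_def by (simp_all add: sum_distrib_left)
  ultimately show ?thesis
    unfolding Xi2_def Xi_at_def t_def[symmetric] S' by (simp add: field_simps power2_eq_square power4_eq_xxxx)
qed

text \<open>All monomials have degree 4, hence the common \<open>\<kappa> ^ 4\<close>. Over the
  field with two elements \<open>x + y + c\<close> is an affine combination, so the ternary
  condition on \<open>\<sigma>\<close> is affinity and no linear part has to be split off.\<close>

lemma Xi_at_transform:
  fixes t t' :: "bit^'n \<Rightarrow> complex" and s :: "bit^'n \<Rightarrow> complex"
  assumes t': "\<And>v. t' v = \<kappa> * (s v * t (\<sigma> v))"
    and sq: "\<And>v. s v ^ 2 = 1"
    and s4: "\<And>x y c. s c * s x * s y * s (x + y + c) = 1"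
    and bij: "bij \<sigma>"
    and aff: "\<And>x y c. \<sigma> (x + y + c) = \<sigma> x + \<sigma> y + \<sigma> c"
  shows "Xi_at t' c = \<kappa> ^ 4 * Xi_at t (\<sigma> c)"
proof -
  have re: "(\<Sum>x\<in>UNIV. g (\<sigma> x)) = (\<Sum>x\<in>UNIV. g x)" for g :: "bit^'n \<Rightarrow> complex"
    using bij by (rule sum.reindex_bij_betw)
  have "t' c * t' x * t' y * t' (x + y + c) = \<kappa> ^ 4 * (t (\<sigma> c) * t (\<sigma> x) * t (\<sigma> y) * t (\<sigma> x + \<sigma> y + \<sigma> c))" for x y
  proof -
    have "t' c * t' x * t' y * t' (x + y + c) = \<kappa> ^ 4 * (s c * s x * s y * s (x + y + c)) *
       (t (\<sigma> c) * t (\<sigma> x) * t (\<sigma> y) * t (\<sigma> x + \<sigma> y + \<sigma> c))"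
      unfolding t' aff by (simp add: power4_eq_xxxx mult_ac)
    then show ?thesis unfolding s4 by simp
  qed
  then have "(\<Sum>x\<in>UNIV. \<Sum>y\<in>UNIV. t' c * t' x * t' y * t' (x + y + c))
      = \<kappa> ^ 4 * (\<Sum>x\<in>UNIV. \<Sum>y\<in>UNIV. t (\<sigma> c) * t (\<sigma> x) * t (\<sigma> y) * t (\<sigma> x + \<sigma> y + \<sigma> c))"
    by (simp add: sum_distrib_left)
  also have "\<dots> = \<kappa> ^ 4 * (\<Sum>x\<in>UNIV. \<Sum>y\<in>UNIV. t (\<sigma> c) * t x * t y * t (x + y + \<sigma> c))"
    unfolding re[of "\<lambda>y. t (\<sigma> c) * t (\<sigma> _) * t y * t (\<sigma> _ + y + \<sigma> c)"]
      re[of "\<lambda>x. \<Sum>y\<in>UNIV. t (\<sigma> c) * t x * t y * t (x + y + \<sigma> c)"] ..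
  finally have 1: "(\<Sum>x\<in>UNIV. \<Sum>y\<in>UNIV. t' c * t' x * t' y * t' (x + y + c))
      = \<kappa> ^ 4 * (\<Sum>x\<in>UNIV. \<Sum>y\<in>UNIV. t (\<sigma> c) * t x * t y * t (x + y + \<sigma> c))" .
  have 2: "t' v ^ 2 = \<kappa> ^ 2 * t (\<sigma> v) ^ 2" for v
    unfolding t' power_mult_distrib sq by simp
  have 3: "t' c ^ 4 = \<kappa> ^ 4 * t (\<sigma> c) ^ 4"
  proof -
    have "t' c ^ 4 = (t' c ^ 2)^2" by (simp add: power_mult[symmetric])
    then show ?thesis unfolding 2 by (simp add: power_mult_distrib power_mult[symmetric])
  qed
  have "(\<Sum>x\<in>UNIV. t' x ^ 2) = \<kappa> ^ 2 * (\<Sum>x\<in>UNIV. t x ^ 2)"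
    unfolding 2 sum_distrib_left[symmetric] re[of "\<lambda>x. t x ^ 2"] ..
  then show ?thesis
    unfolding Xi_at_def 1 3 2 by (simp add: field_simps power2_eq_square power4_eq_xxxx)
qed

text \<open>A characteristic encoded as a quadratic form whose polarization is the symplectic form.\<close>

definition quad :: "bit^('g::finite + 'g) \<Rightarrow> bit^('g + 'g) \<Rightarrow> bit"
  where "quad c x = (\<Sum>i\<in>UNIV. x $ Inl i * x $ Inr i) + (\<Sum>k\<in>UNIV. c $ k * x $ k)"

definition swap_halves :: "'a^('g::finite + 'g) \<Rightarrow> 'a^('g + 'g)"
  where "swap_halves x = (\<chi> k. case k of Inl i \<Rightarrow> x $ Inr i | Inr i \<Rightarrow> x $ Inl i)"

lemma swap_halves_nth [simp]: "swap_halves x $ Inl i = x $ Inr i" "swap_halves x $ Inr i = x $ Inl i"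
  by (simp_all add: swap_halves_def)

lemma swap_halves_swap_halves [simp]: "swap_halves (swap_halves x) = x"
  by (simp add: vec_eq_iff split_sum_all)

text \<open>The reduction modulo 2 of the action of \<open>\<gamma>\<^sup>-\<^sup>1 = - J \<gamma>\<^sup>t J\<close>; modulo 2 the matrix \<open>J\<close> swaps the two halves.\<close>

definition adj2 :: "int^('g::finite + 'g)^('g + 'g) \<Rightarrow> bit^('g + 'g) \<Rightarrow> bit^('g + 'g)"
  where "adj2 \<gamma> x = swap_halves (transpose (map_matrix of_int \<gamma>) *v swap_halves x)"

lemma map_matrix_of_int_mult:
  "map_matrix of_int (A ** B) = (map_matrix of_int A ** map_matrix of_int B :: 'a::ring_1^'n^'m)"
  for A :: "int^'k^'m" and B :: "int^'n^'k"
  by (simp add: vec_eq_iff matrix_matrix_mult_def map_matrix_def)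

text \<open>The reversed order is that of substitution: a quadratic form is first composed with the
  map of \<open>\<gamma>\<^sub>2\<close>, then with that of \<open>\<gamma>\<^sub>1\<close>.\<close>

lemma adj2_mult: "adj2 (\<gamma>\<^sub>1 ** \<gamma>\<^sub>2) x = adj2 \<gamma>\<^sub>2 (adj2 \<gamma>\<^sub>1 x)"
  by (simp only: adj2_def map_matrix_of_int_mult matrix_transpose_mul matrix_vector_mul_assoc swap_halves_swap_halves)

text \<open>The forms differ only in their linear part, which is determined by its values on unit
  vectors.\<close>

lemma quad_inject:
  assumes "\<And>x. quad c x = quad 0 x"
  shows "c = 0"
proof -
  have "c $ k = 0" for k
  proof -
    have "(\<Sum>j\<in>UNIV. c $ j * axis k 1 $ j) = c $ k"
      by (simp add: axis_def if_distrib cong: if_cong)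
    moreover have "(\<Sum>j\<in>UNIV. c $ j * axis k 1 $ j) = (\<Sum>j\<in>UNIV. (0 :: bit^('a + 'a)) $ j * axis k 1 $ j)"
      using assms[of "axis k 1"] by (simp only: quad_def add_left_cancel)
    moreover have "(\<Sum>j\<in>UNIV. (0 :: bit^('a + 'a)) $ j * axis k 1 $ j) = 0"
      by (rule sum.neutral) simp
    ultimately show ?thesis by metis
  qed
  then show ?thesis by (simp add: vec_eq_iff)
qed

lemma bit_matrix_right_inverse:
  fixes A B :: "bit^'n^'n"
  assumes "A ** B = mat 1"
  shows "B ** A = mat 1"
  using assms matrix_left_right_inverse[of B A] by simp

text \<open>Off-diagonal terms occur twice and cancel in characteristic 2; on the diagonal a square
  equals its root.\<close>

lemma sum_bit_symmetric_form:
  fixes M :: "bit^'g::finite^'g"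
  assumes sym: "\<And>i j. M $ i $ j = M $ j $ i"
  shows "(\<Sum>i\<in>UNIV. \<Sum>j\<in>UNIV. x $ i * M $ i $ j * x $ j) = (\<Sum>i\<in>UNIV. M $ i $ i * x $ i)"
proof -
  have "(\<Sum>i\<in>A. \<Sum>j\<in>A. x $ i * M $ i $ j * x $ j) = (\<Sum>i\<in>A. M $ i $ i * x $ i)" if "finite A" for A
    using that
  proof (induction A rule: finite_induct)
    case empty
    then show ?case by simp
  next
    case (insert a A)
    have sq: "x $ a * M $ a $ a * x $ a = M $ a $ a * x $ a"
      by (cases "x $ a") auto
    have cross: "(\<Sum>j\<in>A. x $ a * M $ a $ j * x $ j) = (\<Sum>i\<in>A. x $ i * M $ i $ a * x $ a)"
      by (rule sum.cong) (auto simp: sym[of a] mult_ac)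
    have "(\<Sum>i\<in>insert a A. \<Sum>j\<in>insert a A. x $ i * M $ i $ j * x $ j)
      = x $ a * M $ a $ a * x $ a + ((\<Sum>j\<in>A. x $ a * M $ a $ j * x $ j) + (\<Sum>i\<in>A. x $ i * M $ i $ a * x $ a))
        + (\<Sum>i\<in>A. \<Sum>j\<in>A. x $ i * M $ i $ j * x $ j)"
      using insert(1,2) by (simp only: sum.insert[OF insert(1,2)] sum.distrib add_ac)
    then show ?case
      using insert unfolding sq cross by (simp only: sum.insert[OF insert(1,2)]) simp
  qed
  from this[OF finite] show ?thesis .
qed

text \<open>With the halves \<open>u\<close>, \<open>v\<close> of the vector, substitution turns the
  form into \<open>u^t A B^t u + v^t C D^t v\<close> plus a mixed term. The first two reduce to
  diagonals, which are even in this group; the matrix of the mixed term is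
  \<open>A D^t + B C^t\<close>, the identity modulo 2.\<close>

lemma quad_adj2_Gamma12:
  fixes \<gamma> :: "int^('g::finite + 'g)^('g + 'g)"
  assumes "\<gamma> \<in> Gamma12"
  shows "quad 0 (adj2 \<gamma> x) = quad 0 x"
proof -
  define r where "r = (map_matrix of_int :: int^'g^'g \<Rightarrow> bit^'g^'g)"
  define A B C D where "A = r (blkA \<gamma>)" and "B = r (blkB \<gamma>)" and "C = r (blkC \<gamma>)" and "D = r (blkD \<gamma>)"
  have M: "map_matrix of_int \<gamma> = blk A B C D"
    by (rule blk_eqI) (simp_all add: A_def B_def C_def D_def r_def map_matrix_def blkA_def blkB_def blkC_def blkD_def)
  have par: "(A ** transpose B) $ i $ i = 0" "(C ** transpose D) $ i $ i = 0" for i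
  proof -
    have h: "(r X ** transpose (r Y)) $ i $ i = of_int ((X ** transpose Y) $ i $ i)" for X Y
      by (simp add: r_def map_matrix_def matrix_matrix_mult_def transpose_def)
    have ev: "of_int k = (0 :: bit)" if "even k" for k
      using that by (elim evenE) simp
    have "even ((blkA \<gamma> ** transpose (blkB \<gamma>)) $ i $ i)" "even ((blkC \<gamma> ** transpose (blkD \<gamma>)) $ i $ i)"
      using assms by (auto simp: Gamma12_def)
    then show "(A ** transpose B) $ i $ i = 0" "(C ** transpose D) $ i $ i = 0"
      unfolding A_def B_def C_def D_def h by (auto intro: ev)
  qed
  have "blk (blkA \<gamma>) (blkB \<gamma>) (blkC \<gamma>) (blkD \<gamma>) \<in> Sp_Z"
    using assms by (simp add: Gamma12_def blk_blocks)
  then have sp: "transpose (blkA \<gamma>) ** blkC \<gamma> = transpose (blkC \<gamma>) ** blkA \<gamma>"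
    "transpose (blkA \<gamma>) ** blkD \<gamma> - transpose (blkC \<gamma>) ** blkB \<gamma> = mat 1"
    "transpose (blkB \<gamma>) ** blkD \<gamma> = transpose (blkD \<gamma>) ** blkB \<gamma>"
    unfolding blk_in_Sp_Z by blast+
  have rt: "r (transpose X ** Y) = transpose (r X) ** r Y" for X Y
    unfolding r_def map_matrix_of_int_mult by (simp add: map_matrix_def transpose_def)
  have rd: "r (X - Y) = r X + r Y" for X Y
    by (simp add: r_def map_matrix_def vec_eq_iff)
  have r1: "r (mat 1) = mat 1" by (simp add: r_def map_matrix_def mat_def vec_eq_iff)
  have b: "transpose A ** C = transpose C ** A" "transpose A ** D + transpose C ** B = mat 1" "transpose B ** D = transpose D ** B"
    using sp[THEN arg_cong[where f = r]] by (simp_all only: rt rd r1 A_def B_def C_def D_def)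
  have tadd: "transpose (X + Y) = transpose X + transpose Y" for X Y :: "bit^'g^'g"
    by (simp add: transpose_def vec_eq_iff)
  have b2: "transpose D ** A + transpose B ** C = mat 1"
    using arg_cong[OF b(2), of transpose] by (simp only: tadd matrix_transpose_mul transpose_transpose transpose_mat)
  have c0: "X + X = 0" for X :: "bit^'g^'g" by (simp add: vec_eq_iff)
  \<comment> \<open>The relations for \<open>Sp_Z\<close> concern products such as
    \<open>A^t C\<close>, the congruence conditions products such as \<open>A B^t\<close>. Turning a
    left inverse into a right inverse passes from one kind to the other.\<close>
  have "blk (transpose D) (transpose B) (transpose C) (transpose A) ** blk A B C D = mat 1"
    unfolding blk_mult one_blk b2 b(1,3) using b(2) by (simp add: c0 add.commute)
  then have "blk A B C D ** blk (transpose D) (transpose B) (transpose C) (transpose A) = mat 1"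
    by (rule bit_matrix_right_inverse)
  then have e: "A ** transpose D + B ** transpose C = mat 1" "A ** transpose B + B ** transpose A = 0"
    "C ** transpose D + D ** transpose C = 0"
    unfolding blk_mult one_blk blk_inject by simp_all
  have sy: "X $ i $ j = X $ j $ i" if "X + transpose X = 0" for X :: "bit^'g^'g" and i j
  proof -
    have "X $ i $ j + X $ j $ i = 0" using arg_cong[OF that, of "\<lambda>M. M $ i $ j"] by (simp add: transpose_def)
    then show ?thesis by (cases "X $ i $ j"; cases "X $ j $ i") auto
  qed
  have sAB: "(A ** transpose B) $ i $ j = (A ** transpose B) $ j $ i" for i j
    by (rule sy) (use e(2) in \<open>simp add: matrix_transpose_mul\<close>)
  have sCD: "(C ** transpose D) $ i $ j = (C ** transpose D) $ j $ i" for i j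
    by (rule sy) (use e(3) in \<open>simp add: matrix_transpose_mul\<close>)
  \<comment> \<open>\<open>u\<close> is the lower half, because \<open>adj2\<close> swaps the halves
    before the matrix is applied.\<close>
  define u v where "u = (\<chi> i. x $ Inr i)" and "v = (\<chi> i. x $ Inl i)"
  have dot: "(\<Sum>k\<in>UNIV. (transpose P *v a) $ k * (transpose Q *v c) $ k)
      = (\<Sum>i\<in>UNIV. \<Sum>j\<in>UNIV. a $ i * (P ** transpose Q) $ i $ j * c $ j)" for P Q :: "bit^'g^'g" and a c
  proof -
    have "(\<Sum>k\<in>UNIV. (transpose P *v a) $ k * (transpose Q *v c) $ k)
       = (\<Sum>k\<in>UNIV. \<Sum>i\<in>UNIV. \<Sum>j\<in>UNIV. (P $ i $ k * a $ i) * (Q $ j $ k * c $ j))"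
      by (simp only: matrix_vector_mult_def transpose_def vec_lambda_beta sum_product)
    also have "\<dots> = (\<Sum>i\<in>UNIV. \<Sum>j\<in>UNIV. \<Sum>k\<in>UNIV. (P $ i $ k * a $ i) * (Q $ j $ k * c $ j))"
      by (subst sum.swap) (intro sum.cong refl sum.swap)
    also have "\<dots> = (\<Sum>i\<in>UNIV. \<Sum>j\<in>UNIV. a $ i * (P ** transpose Q) $ i $ j * c $ j)"
      by (simp only: matrix_matrix_mult_def transpose_def vec_lambda_beta sum_distrib_left sum_distrib_right mult_ac)
    finally show ?thesis .
  qed
  have adjL: "adj2 \<gamma> x $ Inl i = (transpose B *v u) $ i + (transpose D *v v) $ i" for i
    unfolding adj2_def M transpose_blk by (simp only: swap_halves_nth matrix_vector_mult_def vec_lambda_beta sum_plus_UNIV blk_nth u_def v_def)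
  have adjR: "adj2 \<gamma> x $ Inr i = (transpose A *v u) $ i + (transpose C *v v) $ i" for i
    unfolding adj2_def M transpose_blk by (simp only: swap_halves_nth matrix_vector_mult_def vec_lambda_beta sum_plus_UNIV blk_nth u_def v_def)
  have q0: "quad 0 y = (\<Sum>i\<in>UNIV. y $ Inl i * y $ Inr i)" for y :: "bit^('g + 'g)"
  proof -
    have "(\<Sum>k\<in>UNIV. (0 :: bit^('g + 'g)) $ k * y $ k) = 0" by (rule sum.neutral) simp
    then show ?thesis by (simp only: quad_def add_0_right)
  qed
  have "quad 0 (adj2 \<gamma> x) = (\<Sum>i\<in>UNIV. (transpose A *v u) $ i * (transpose B *v u) $ i) + (\<Sum>i\<in>UNIV. (transpose A *v u) $ i * (transpose D *v v) $ i)
      + ((\<Sum>i\<in>UNIV. (transpose B *v u) $ i * (transpose C *v v) $ i) + (\<Sum>i\<in>UNIV. (transpose C *v v) $ i * (transpose D *v v) $ i))"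
    unfolding q0 adjL adjR by (simp only: distrib_left distrib_right sum.distrib mult_ac add_ac)
  also have "(\<Sum>i\<in>UNIV. (transpose A *v u) $ i * (transpose B *v u) $ i) = 0"
    unfolding dot sum_bit_symmetric_form[OF sAB] by (rule sum.neutral) (intro ballI, simp only: par mult_zero_left)
  also have "(\<Sum>i\<in>UNIV. (transpose C *v v) $ i * (transpose D *v v) $ i) = 0"
    unfolding dot sum_bit_symmetric_form[OF sCD] by (rule sum.neutral) (intro ballI, simp only: par mult_zero_left)
  also have "0 + (\<Sum>i\<in>UNIV. (transpose A *v u) $ i * (transpose D *v v) $ i)
      + ((\<Sum>i\<in>UNIV. (transpose B *v u) $ i * (transpose C *v v) $ i) + 0)
      = (\<Sum>i\<in>UNIV. \<Sum>j\<in>UNIV. u $ i * (A ** transpose D + B ** transpose C) $ i $ j * v $ j)"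
    unfolding dot by (simp only: vector_add_component distrib_left distrib_right sum.distrib add_0_left add_0_right)
  also have "\<dots> = (\<Sum>i\<in>UNIV. u $ i * v $ i)"
  proof (rule sum.cong[OF refl])
    fix i
    have "(\<Sum>j\<in>UNIV. u $ i * (mat 1 :: bit^'g^'g) $ i $ j * v $ j) = (\<Sum>j\<in>UNIV. if i = j then u $ i * v $ j else 0)"
      by (rule sum.cong) (auto simp: mat_def)
    also have "\<dots> = u $ i * v $ i" by (subst sum.delta') auto
    finally show "(\<Sum>j\<in>UNIV. u $ i * (A ** transpose D + B ** transpose C) $ i $ j * v $ j) = u $ i * v $ i"
      unfolding e(1) .
  qed
  also have "\<dots> = quad 0 x" unfolding q0 u_def v_def by (simp only: vec_lambda_beta mult.commute)
  finally show ?thesis .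
qed

section \<open>Theta constants of genus 2\<close>

lemma siegel2_iff:
  "\<tau> \<in> siegel \<longleftrightarrow> \<tau> $ 2 $ 1 = \<tau> $ 1 $ 2 \<and> upper2 (\<tau> $ 1 $ 1) (\<tau> $ 1 $ 2) (\<tau> $ 2 $ 2)"
  for \<tau> :: "complex^2^2"
proof (cases "\<tau> $ 2 $ 1 = \<tau> $ 1 $ 2")
  case False
  then have "transpose \<tau> \<noteq> \<tau>" unfolding mat2_eq_iff[of "transpose \<tau>"] by (auto simp: transpose_def)
  then show ?thesis using False by (simp add: siegel_def)
next
  case True
  then have tr: "transpose \<tau> = \<tau>" unfolding mat2_eq_iff[of "transpose \<tau>"] by (simp add: transpose_def)
  define p z q where "p = Im (\<tau> $ 1 $ 1)" and "z = Im (\<tau> $ 1 $ 2)" and "q = Im (\<tau> $ 2 $ 2)"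
  have form: "x \<bullet> (map_matrix Im \<tau> *v x) = p * (x $ 1)^2 + 2 * z * (x $ 1) * (x $ 2) + q * (x $ 2)^2" for x
    using True by (simp add: inner_vec_def sum_2 matrix_vector_mult_def map_matrix_def p_def z_def q_def power2_eq_square algebra_simps)
  have nz: "x \<noteq> 0 \<longleftrightarrow> (x $ 1)^2 + (x $ 2)^2 > 0" for x :: "real^2"
    by (simp add: sum_power2_gt_zero_iff vec_eq_iff forall_2)
  have "pos_def_matrix (map_matrix Im \<tau>) \<longleftrightarrow> upper2 (\<tau> $ 1 $ 1) (\<tau> $ 1 $ 2) (\<tau> $ 2 $ 2)"
  proof
    assume pd: "pos_def_matrix (map_matrix Im \<tau>)"
    have pd': "p * a^2 + 2 * z * a * b + q * b^2 > 0" if "a^2 + b^2 > 0" for a b :: real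
      using pd[unfolded pos_def_matrix_def form, rule_format, of "vector [a, b]"] that nz[of "vector [a, b]"]
      by simp
    have p: "p > 0" using pd'[of 1 0] by simp
    \<comment> \<open>At the vector \<open>(- z, p)\<close> the form takes the value
      \<open>p * (p * q - z^2)\<close>, which isolates the determinant.\<close>
    then have "(- z)^2 + p^2 > 0" by (simp add: add_nonneg_pos)
    from pd'[OF this] have "p * z^2 - 2 * z * z * p + q * p^2 > 0"
      by (simp add: mult_ac)
    then have "p * (p * q - z^2) > 0" by (simp add: power2_eq_square algebra_simps)
    then have "p * q - z^2 > 0" using p by (simp add: zero_less_mult_iff)
    then show "upper2 (\<tau> $ 1 $ 1) (\<tau> $ 1 $ 2) (\<tau> $ 2 $ 2)"
      using p by (simp add: upper2_def p_def q_def z_def)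
  next
    assume "upper2 (\<tau> $ 1 $ 1) (\<tau> $ 1 $ 2) (\<tau> $ 2 $ 2)"
    then obtain y where y: "y > 0" "\<And>u v. p * u^2 + 2 * z * u * v + q * v^2 \<ge> y * (u^2 + v^2)"
      using upper2_coercive unfolding p_def q_def z_def by metis
    show "pos_def_matrix (map_matrix Im \<tau>)"
      unfolding pos_def_matrix_def form
    proof (intro allI impI)
      fix x :: "real^2" assume "x \<noteq> 0"
      then have "y * ((x $ 1)^2 + (x $ 2)^2) > 0" using y(1) nz by simp
      then show "p * (x $ 1)^2 + 2 * z * x $ 1 * x $ 2 + q * (x $ 2)^2 > 0"
        using y(2)[of "x $ 1" "x $ 2"] by linarith
    qed
  qed
  then show ?thesis using True tr by (simp add: siegel_def)
qed

lemma bij_int_pairs: "bij (\<lambda>(m, n). (\<chi> i. if i = 1 then m else n) :: int^2)"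
  by (rule bij_betw_byWitness[where f' = "\<lambda>v. (v $ 1, v $ 2)"]) (auto simp: vec_eq_iff forall_2)

lemma of_bit_eq_of_int: "of_bit b = (of_int (of_bit b) :: complex)"
  by (cases b) auto

text \<open>The two off-diagonal entries are kept apart, so the exponent is affine in all four
  entries and can be differentiated on the whole matrix space.\<close>

definition theta_exponent :: "bit^(2+2) \<Rightarrow> complex^2^2 \<Rightarrow> int \<times> int \<Rightarrow> complex"
  where "theta_exponent v \<tau> = (\<lambda>(m, n).
    let x = half_shift m (of_bit (v $ Inl 1)); y = half_shift n (of_bit (v $ Inl 2))
    in pi * \<i> * (x * \<tau> $ 1 $ 1 * x + x * \<tau> $ 1 $ 2 * y + y * \<tau> $ 2 $ 1 * x + y * \<tau> $ 2 $ 2 * y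
         + x * of_int (of_bit (v $ Inr 1)) + y * of_int (of_bit (v $ Inr 2))))"

lemma theta_eq_infsum: "theta v \<tau> = (\<Sum>\<^sub>\<infinity>x. exp (theta_exponent v \<tau> x))"
  unfolding theta_def infsum_reindex_bij_betw[OF bij_int_pairs, symmetric] of_bit_eq_of_int
  by (intro infsum_cong) (simp add: theta_exponent_def case_prod_unfold Let_def sum_2 add.assoc)

lemma theta_eq_th2:
  fixes \<tau> :: "complex^2^2"
  assumes "\<tau> \<in> siegel"
  shows "theta v \<tau> = th2 (of_bit (v $ Inl 1)) (of_bit (v $ Inl 2)) (of_bit (v $ Inr 1)) (of_bit (v $ Inr 2))
    (\<tau> $ 1 $ 1) (\<tau> $ 1 $ 2) (\<tau> $ 2 $ 2)"
proof -
  have s: "\<tau> $ 2 $ 1 = \<tau> $ 1 $ 2" using assms by (simp add: siegel2_iff)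
  have e: "x * p * x + x * z * y + y * z * x + y * q * y = x^2 * p + 2 * x * y * z + y^2 * q" for x y p z q :: complex
    by (simp add: power2_eq_square algebra_simps)
  show ?thesis
    unfolding theta_eq_infsum th2_def theta_exponent_def s case_prod_unfold Let_def e ..
qed

lemma even_diff_iff_of_int_bit: "even (x - y) \<longleftrightarrow> of_int x = (of_int y :: bit)"
proof -
  have "of_int k = (if even k then 0 else 1 :: bit)" for k :: int
    by (auto elim!: evenE oddE)
  then show ?thesis by simp
qed

lemma of_int_of_bit [simp]: "of_int (of_bit b) = (b :: bit)"
  by (cases b) auto

text \<open>Transformed characteristics are arbitrary integers; this allows any lift, not only 0 and
  1.\<close>

lemma theta_power4_eq_th2:
  fixes \<tau> :: "complex^2^2"
  assumes "\<tau> \<in> siegel" "of_int a = v $ Inl 1" "of_int b = v $ Inl 2" "of_int d = v $ Inr 1" "of_int e = v $ Inr 2"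
  shows "theta v \<tau> ^ 4 = th2 a b d e (\<tau> $ 1 $ 1) (\<tau> $ 1 $ 2) (\<tau> $ 2 $ 2) ^ 4"
  unfolding theta_eq_th2[OF assms(1)]
  by (rule th2_power4_cong) (simp_all only: even_diff_iff_of_int_bit of_int_of_bit assms)

section \<open>Holomorphy\<close>

text \<open>The condition of \<open>siegel_holomorphic\<close> at a single point, isolated because
  it is closed under ring operations.\<close>

definition complex_differentiable_at :: "(complex^'g^'g \<Rightarrow> complex) \<Rightarrow> complex^'g^'g \<Rightarrow> bool"
  where "complex_differentiable_at f \<tau> \<longleftrightarrow> (\<exists>L. (f has_derivative L) (at \<tau> within siegel)
    \<and> (\<forall>c X. L (map_matrix (\<lambda>x. c * x) X) = c * L X))"

lemma complex_differentiable_const: "complex_differentiable_at (\<lambda>_. k) \<tau>"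
  unfolding complex_differentiable_at_def by (rule exI[of _ "\<lambda>_. 0"]) simp

lemma complex_differentiable_add:
  "complex_differentiable_at f \<tau> \<Longrightarrow> complex_differentiable_at g \<tau> \<Longrightarrow> complex_differentiable_at (\<lambda>x. f x + g x) \<tau>"
  unfolding complex_differentiable_at_def
  by (elim exE conjE, rule_tac x = "\<lambda>h. L h + La h" in exI) (auto intro: has_derivative_add simp: distrib_left)

lemma complex_differentiable_mult:
  "complex_differentiable_at f \<tau> \<Longrightarrow> complex_differentiable_at g \<tau> \<Longrightarrow> complex_differentiable_at (\<lambda>x. f x * g x) \<tau>"
  unfolding complex_differentiable_at_def
proof (elim exE conjE)
  fix L L'
  assume L: "(f has_derivative L) (at \<tau> within siegel)" "(g has_derivative L') (at \<tau> within siegel)"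
    and l: "\<forall>c X. L (map_matrix (\<lambda>x. c * x) X) = c * L X" "\<forall>c X. L' (map_matrix (\<lambda>x. c * x) X) = c * L' X"
  show "\<exists>L. ((\<lambda>x. f x * g x) has_derivative L) (at \<tau> within siegel) \<and> (\<forall>c X. L (map_matrix (\<lambda>x. c * x) X) = c * L X)"
    by (intro exI conjI, rule has_derivative_mult[OF L]) (simp add: l algebra_simps)
qed

lemma complex_differentiable_power:
  "complex_differentiable_at f \<tau> \<Longrightarrow> complex_differentiable_at (\<lambda>x. f x ^ n) \<tau>"
  by (induction n) (auto intro: complex_differentiable_const complex_differentiable_mult)

lemma complex_differentiable_sum:
  "(\<And>i. i \<in> A \<Longrightarrow> complex_differentiable_at (f i) \<tau>) \<Longrightarrow> complex_differentiable_at (\<lambda>x. \<Sum>i\<in>A. f i x) \<tau>"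
  by (induction A rule: infinite_finite_induct) (auto intro: complex_differentiable_const complex_differentiable_add)

text \<open>The series is differentiated in the full matrix space and the derivative is then
  restricted to \<open>siegel\<close>; it is complex-linear because every \<open>l x\<close>
  is.\<close>

lemma theta_complex_differentiable:
  fixes \<tau> :: "complex^2^2"
  assumes \<tau>: "\<tau> \<in> siegel"
  shows "complex_differentiable_at (theta v) \<tau>"
proof -
  define a b d e where "a = (of_bit (v $ Inl 1) :: int)" and "b = (of_bit (v $ Inl 2) :: int)"
    and "d = (of_bit (v $ Inr 1) :: int)" and "e = (of_bit (v $ Inr 2) :: int)"
  define X Y :: "int \<times> int \<Rightarrow> real" where "X = (\<lambda>x. of_int (fst x) + of_int a / 2)" and "Y = (\<lambda>x. of_int (snd x) + of_int b / 2)"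
  define c where "c = (\<lambda>x. pi * \<i> * (X x * of_int d + Y x * of_int e) :: complex)"
  define l where "l = (\<lambda>x (H :: complex^2^2). pi * \<i> * (of_real (X x ^ 2) * H $ 1 $ 1 + of_real (X x * Y x) * H $ 1 $ 2
     + of_real (X x * Y x) * H $ 2 $ 1 + of_real (Y x ^ 2) * H $ 2 $ 2))"
  have XY: "of_int (fst x) + of_int a / 2 = complex_of_real (X x)" "of_int (snd x) + of_int b / 2 = complex_of_real (Y x)" for x
    by (simp_all add: X_def Y_def)
  have te: "theta_exponent v = (\<lambda>\<tau> x. c x + l x \<tau>)"
    unfolding theta_exponent_def c_def l_def case_prod_unfold Let_def
      a_def[symmetric] b_def[symmetric] d_def[symmetric] e_def[symmetric] XY
    by (intro ext) (simp add: power2_eq_square algebra_simps)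
  have up: "upper2 (\<tau> $ 1 $ 1) (\<tau> $ 1 $ 2) (\<tau> $ 2 $ 2)" and sym: "\<tau> $ 2 $ 1 = \<tau> $ 1 $ 2"
    using \<tau> by (simp_all add: siegel2_iff)
  obtain r where r: "r > 0" "(\<lambda>(m::int, n::int).
    exp (Re (pi * \<i> * theta_form (half_shift m a) (half_shift n b) (\<tau> $ 1 $ 1) (\<tau> $ 1 $ 2) (\<tau> $ 2 $ 2) d e)
         + r * ((real_of_int m + of_int a / 2)^2 + (real_of_int n + of_int b / 2)^2))) summable_on UNIV"
    using th2_norm_summable[OF up, of a b d e] by blast
  have sc: "(k *\<^sub>R H) $ i $ j = of_real k * H $ i $ j" for k and H :: "complex^2^2" and i j
    unfolding vector_scaleR_component by (rule scaleR_conv_of_real)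
  have sc': "k *\<^sub>R w = of_real k * w" for k and w :: complex
    by (rule scaleR_conv_of_real)
  have lin: "linear (l x)" for x
    unfolding l_def by (rule linearI) (simp_all only: sc sc' vector_add_component algebra_simps)
  have bnd: "norm (l x H) \<le> 2 * pi * (X x ^ 2 + Y x ^ 2) * norm H" for x H
  proof -
    have H: "norm (H $ i $ j) \<le> norm H" for i j
      using Finite_Cartesian_Product.norm_nth_le[of "H $ i" j] Finite_Cartesian_Product.norm_nth_le[of H i] by linarith
    have n: "norm (of_real s * H $ i $ j) \<le> \<bar>s\<bar> * norm H" for s i j
      unfolding norm_mult norm_of_real by (intro mult_left_mono H) simp
    have "norm (of_real (X x ^ 2) * H $ 1 $ 1 + of_real (X x * Y x) * H $ 1 $ 2
       + of_real (X x * Y x) * H $ 2 $ 1 + of_real (Y x ^ 2) * H $ 2 $ 2)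
       \<le> \<bar>X x ^ 2\<bar> * norm H + \<bar>X x * Y x\<bar> * norm H + \<bar>X x * Y x\<bar> * norm H + \<bar>Y x ^ 2\<bar> * norm H"
      by (intro norm_triangle_le add_mono n)
    also have "\<dots> = (X x ^ 2 + 2 * (\<bar>X x\<bar> * \<bar>Y x\<bar>) + Y x ^ 2) * norm H"
      by (simp add: abs_mult algebra_simps)
    also have "\<dots> \<le> (2 * (X x ^ 2 + Y x ^ 2)) * norm H"
      using sum_squares_bound[of "\<bar>X x\<bar>" "\<bar>Y x\<bar>"] by (intro mult_right_mono) auto
    finally have "pi * norm (of_real (X x ^ 2) * H $ 1 $ 1 + of_real (X x * Y x) * H $ 1 $ 2
       + of_real (X x * Y x) * H $ 2 $ 1 + of_real (Y x ^ 2) * H $ 2 $ 2) \<le> pi * ((2 * (X x ^ 2 + Y x ^ 2)) * norm H)"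
      by (intro mult_left_mono) auto
    then show ?thesis unfolding l_def norm_mult by (simp add: mult_ac)
  qed
  \<comment> \<open>The bound for \<open>l\<close> is \<open>2 * pi\<close> times the quadratic
    weight, so \<open>d = r / (2 * pi)\<close> restores the slack \<open>r\<close> of
    \<open>th2_norm_summable\<close>.\<close>
  have sm: "(\<lambda>x. exp (Re (c x + l x \<tau>) + r / (2 * pi) * (2 * pi * (X x ^ 2 + Y x ^ 2)))) summable_on UNIV"
  proof -
    have "pi * \<i> * theta_form (half_shift (fst x) a) (half_shift (snd x) b) (\<tau> $ 1 $ 1) (\<tau> $ 1 $ 2) (\<tau> $ 2 $ 2) d e
       = c x + l x \<tau>" for x :: "int \<times> int"
      unfolding XY c_def l_def sym by (simp add: power2_eq_square algebra_simps)
    then show ?thesis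
      using r(1) r(2) unfolding case_prod_unfold by (simp add: X_def Y_def)
  qed
  have "((\<lambda>\<tau>. \<Sum>\<^sub>\<infinity>x. exp (c x + l x \<tau>)) has_derivative (\<lambda>h. \<Sum>\<^sub>\<infinity>x. l x h * exp (c x + l x \<tau>))) (at \<tau>)"
    by (rule exp_series_has_derivative[where B = "\<lambda>x. 2 * pi * (X x ^ 2 + Y x ^ 2)" and d = "r / (2 * pi)"])
       (use lin bnd sm r(1) in auto)
  moreover have "(\<lambda>\<tau>. \<Sum>\<^sub>\<infinity>x. exp (c x + l x \<tau>)) = theta v"
    by (intro ext) (simp add: theta_eq_infsum te)
  ultimately have "(theta v has_derivative (\<lambda>h. \<Sum>\<^sub>\<infinity>x. l x h * exp (c x + l x \<tau>))) (at \<tau> within siegel)"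
    by (simp add: has_derivative_at_withinI)
  moreover have "(\<Sum>\<^sub>\<infinity>x. l x (map_matrix (\<lambda>x. k * x) H) * exp (c x + l x \<tau>)) = k * (\<Sum>\<^sub>\<infinity>x. l x H * exp (c x + l x \<tau>))" for k H
    unfolding infsum_cmult_right'[symmetric]
    by (intro infsum_cong) (simp add: l_def map_matrix_def algebra_simps)
  ultimately show ?thesis unfolding complex_differentiable_at_def by blast
qed

lemma Xi2_holomorphic: "siegel_holomorphic Xi2"
proof -
  have "complex_differentiable_at (\<lambda>\<tau>. (\<Sum>x\<in>UNIV. \<Sum>y\<in>UNIV. theta 0 \<tau> ^ 4 * theta x \<tau> ^ 4 * theta y \<tau> ^ 4 * theta (x + y + 0) \<tau> ^ 4) * (1 / 12)
      + 8 / 12 * (theta 0 \<tau> ^ 4) ^ 4 + (- 6 / 12) * ((theta 0 \<tau> ^ 4) ^ 2 * (\<Sum>x\<in>UNIV. (theta x \<tau> ^ 4) ^ 2))) \<tau>"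
    if "\<tau> \<in> siegel" for \<tau> :: "complex^2^2"
    by (intro complex_differentiable_add complex_differentiable_mult complex_differentiable_sum complex_differentiable_power
         complex_differentiable_const theta_complex_differentiable that)
  moreover have "(\<lambda>\<tau>. (\<Sum>x\<in>UNIV. \<Sum>y\<in>UNIV. theta 0 \<tau> ^ 4 * theta x \<tau> ^ 4 * theta y \<tau> ^ 4 * theta (x + y + 0) \<tau> ^ 4) * (1 / 12)
      + 8 / 12 * (theta 0 \<tau> ^ 4) ^ 4 + (- 6 / 12) * ((theta 0 \<tau> ^ 4) ^ 2 * (\<Sum>x\<in>UNIV. (theta x \<tau> ^ 4) ^ 2))) = Xi2"
    unfolding Xi2_eq_Xi_at[abs_def] Xi_at_def by (intro ext) (simp add: field_simps)
  ultimately show ?thesis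
    unfolding siegel_holomorphic_def complex_differentiable_at_def by simp
qed

section \<open>Modularity\<close>

lemma matrix_add_rdistrib: "(A + B) ** C = A ** C + B ** (C :: 'a::semiring_1^'n^'k::finite)"
  by (simp add: matrix_matrix_mult_def vec_eq_iff distrib_right sum.distrib)

lemma matrix_inv_mult:
  assumes "invertible (M :: complex^'n^'n)"
  shows "M ** matrix_inv M = mat 1" "matrix_inv M ** M = mat 1"
proof -
  have "M ** matrix_inv M = mat 1 \<and> matrix_inv M ** M = mat 1"
    unfolding matrix_inv_def by (rule someI_ex) (use assms invertible_def in blast)
  then show "M ** matrix_inv M = mat 1" "matrix_inv M ** M = mat 1" by auto
qed

section \<open>The action and its automorphy cocycle\<close>

lemma sp_act_eqI:
  assumes "invertible (autom_mat \<gamma> \<tau>)"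
    and "Z ** autom_mat \<gamma> \<tau> = map_matrix of_int (blkA \<gamma>) ** \<tau> + map_matrix of_int (blkB \<gamma>)"
  shows "sp_act \<gamma> \<tau> = Z"
proof -
  have "sp_act \<gamma> \<tau> = Z ** (autom_mat \<gamma> \<tau> ** matrix_inv (autom_mat \<gamma> \<tau>))"
    unfolding sp_act_def assms(2)[symmetric] by (simp add: matrix_mul_assoc)
  then show ?thesis by (simp add: matrix_inv_mult[OF assms(1)])
qed

lemma sp_act_mult_autom:
  assumes "invertible (autom_mat \<gamma> \<tau>)"
  shows "sp_act \<gamma> \<tau> ** autom_mat \<gamma> \<tau> = map_matrix of_int (blkA \<gamma>) ** \<tau> + map_matrix of_int (blkB \<gamma>)"
  unfolding sp_act_def matrix_mul_assoc[symmetric] matrix_inv_mult[OF assms] by simp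

lemma blk_sel_mult:
  fixes \<gamma>\<^sub>1 \<gamma>\<^sub>2 :: "int^('g::finite + 'g)^('g + 'g)"
  shows "blkA (\<gamma>\<^sub>1 ** \<gamma>\<^sub>2) = blkA \<gamma>\<^sub>1 ** blkA \<gamma>\<^sub>2 + blkB \<gamma>\<^sub>1 ** blkC \<gamma>\<^sub>2"
    "blkB (\<gamma>\<^sub>1 ** \<gamma>\<^sub>2) = blkA \<gamma>\<^sub>1 ** blkB \<gamma>\<^sub>2 + blkB \<gamma>\<^sub>1 ** blkD \<gamma>\<^sub>2"
    "blkC (\<gamma>\<^sub>1 ** \<gamma>\<^sub>2) = blkC \<gamma>\<^sub>1 ** blkA \<gamma>\<^sub>2 + blkD \<gamma>\<^sub>1 ** blkC \<gamma>\<^sub>2"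
    "blkD (\<gamma>\<^sub>1 ** \<gamma>\<^sub>2) = blkC \<gamma>\<^sub>1 ** blkB \<gamma>\<^sub>2 + blkD \<gamma>\<^sub>1 ** blkD \<gamma>\<^sub>2"
  unfolding blk_mult[of "blkA \<gamma>\<^sub>1" "blkB \<gamma>\<^sub>1" "blkC \<gamma>\<^sub>1" "blkD \<gamma>\<^sub>1" "blkA \<gamma>\<^sub>2" "blkB \<gamma>\<^sub>2" "blkC \<gamma>\<^sub>2" "blkD \<gamma>\<^sub>2",
      unfolded blk_blocks] by simp_all

lemma map_matrix_of_int_add:
  "map_matrix of_int (A + B) = (map_matrix of_int A + map_matrix of_int B :: 'a::ring_1^'n^'m)"
  by (simp add: vec_eq_iff map_matrix_def)

text \<open>The cocycle relation: multiplying by the inner automorphy matrix clears the inverse in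
  \<open>sp_act\<close>.\<close>

lemma autom_mat_mult:
  assumes "invertible (autom_mat \<gamma>\<^sub>2 \<tau>)"
  shows "autom_mat (\<gamma>\<^sub>1 ** \<gamma>\<^sub>2) \<tau> = autom_mat \<gamma>\<^sub>1 (sp_act \<gamma>\<^sub>2 \<tau>) ** autom_mat \<gamma>\<^sub>2 \<tau>"
proof -
  have "autom_mat \<gamma>\<^sub>1 (sp_act \<gamma>\<^sub>2 \<tau>) ** autom_mat \<gamma>\<^sub>2 \<tau> =
     map_matrix of_int (blkC \<gamma>\<^sub>1) ** (sp_act \<gamma>\<^sub>2 \<tau> ** autom_mat \<gamma>\<^sub>2 \<tau>) + map_matrix of_int (blkD \<gamma>\<^sub>1) ** autom_mat \<gamma>\<^sub>2 \<tau>"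
    unfolding autom_mat_def[of \<gamma>\<^sub>1] by (simp add: matrix_add_rdistrib matrix_mul_assoc)
  also have "\<dots> = autom_mat (\<gamma>\<^sub>1 ** \<gamma>\<^sub>2) \<tau>"
    unfolding sp_act_mult_autom[OF assms] unfolding autom_mat_def blk_sel_mult map_matrix_of_int_add map_matrix_of_int_mult
    by (simp add: matrix_add_rdistrib matrix_add_ldistrib matrix_mul_assoc)
  finally show ?thesis ..
qed

lemma sp_act_mult:
  assumes i2: "invertible (autom_mat \<gamma>\<^sub>2 \<tau>)" and i1: "invertible (autom_mat \<gamma>\<^sub>1 (sp_act \<gamma>\<^sub>2 \<tau>))"
  shows "sp_act (\<gamma>\<^sub>1 ** \<gamma>\<^sub>2) \<tau> = sp_act \<gamma>\<^sub>1 (sp_act \<gamma>\<^sub>2 \<tau>)"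
proof (rule sp_act_eqI)
  show "invertible (autom_mat (\<gamma>\<^sub>1 ** \<gamma>\<^sub>2) \<tau>)"
    unfolding autom_mat_mult[OF i2] by (intro invertible_mult i1 i2)
  have "sp_act \<gamma>\<^sub>1 (sp_act \<gamma>\<^sub>2 \<tau>) ** autom_mat (\<gamma>\<^sub>1 ** \<gamma>\<^sub>2) \<tau>
     = (sp_act \<gamma>\<^sub>1 (sp_act \<gamma>\<^sub>2 \<tau>) ** autom_mat \<gamma>\<^sub>1 (sp_act \<gamma>\<^sub>2 \<tau>)) ** autom_mat \<gamma>\<^sub>2 \<tau>"
    unfolding autom_mat_mult[OF i2] by (simp add: matrix_mul_assoc)
  also have "\<dots> = map_matrix of_int (blkA \<gamma>\<^sub>1) ** (sp_act \<gamma>\<^sub>2 \<tau> ** autom_mat \<gamma>\<^sub>2 \<tau>) + map_matrix of_int (blkB \<gamma>\<^sub>1) ** autom_mat \<gamma>\<^sub>2 \<tau>"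
    unfolding sp_act_mult_autom[OF i1] by (simp add: matrix_add_rdistrib matrix_mul_assoc)
  also have "\<dots> = map_matrix of_int (blkA (\<gamma>\<^sub>1 ** \<gamma>\<^sub>2)) ** \<tau> + map_matrix of_int (blkB (\<gamma>\<^sub>1 ** \<gamma>\<^sub>2))"
    unfolding sp_act_mult_autom[OF i2] unfolding autom_mat_def blk_sel_mult map_matrix_of_int_add map_matrix_of_int_mult
    by (simp add: matrix_add_rdistrib matrix_add_ldistrib matrix_mul_assoc)
  finally show "sp_act \<gamma>\<^sub>1 (sp_act \<gamma>\<^sub>2 \<tau>) ** autom_mat (\<gamma>\<^sub>1 ** \<gamma>\<^sub>2) \<tau>
     = map_matrix of_int (blkA (\<gamma>\<^sub>1 ** \<gamma>\<^sub>2)) ** \<tau> + map_matrix of_int (blkB (\<gamma>\<^sub>1 ** \<gamma>\<^sub>2))" .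
qed

text \<open>The permutation of characteristics is recorded only through its effect on quadratic
  forms, which composes without explicit formulas. Invertibility and stability of
  \<open>siegel\<close> are part of the property because they too are obtained generator by
  generator.\<close>

definition permutes_Xi :: "int^(2+2)^(2+2) \<Rightarrow> bool"
  where "permutes_Xi \<gamma> \<longleftrightarrow> (\<forall>\<tau>\<in>siegel. invertible (autom_mat \<gamma> \<tau>) \<and> sp_act \<gamma> \<tau> \<in> siegel \<and>
    (\<forall>c'. \<exists>c. (\<forall>x. quad c x = quad c' (adj2 \<gamma> x)) \<and>
      Xi_at (\<lambda>v. theta v (sp_act \<gamma> \<tau>) ^ 4) c = det (autom_mat \<gamma> \<tau>) ^ 8 * Xi_at (\<lambda>v. theta v \<tau> ^ 4) c'))"

lemma permutes_Xi_mult: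
  assumes "permutes_Xi \<gamma>\<^sub>1" "permutes_Xi \<gamma>\<^sub>2"
  shows "permutes_Xi (\<gamma>\<^sub>1 ** \<gamma>\<^sub>2)"
  unfolding permutes_Xi_def
proof (intro ballI conjI allI)
  fix \<tau> :: "complex^2^2" and c'' :: "bit^(2+2)"
  assume \<tau>: "\<tau> \<in> siegel"
  have i2: "invertible (autom_mat \<gamma>\<^sub>2 \<tau>)" and \<tau>2: "sp_act \<gamma>\<^sub>2 \<tau> \<in> siegel"
    using assms(2) \<tau> unfolding permutes_Xi_def by blast+
  have i1: "invertible (autom_mat \<gamma>\<^sub>1 (sp_act \<gamma>\<^sub>2 \<tau>))" and \<tau>1: "sp_act \<gamma>\<^sub>1 (sp_act \<gamma>\<^sub>2 \<tau>) \<in> siegel"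
    using assms(1) \<tau>2 unfolding permutes_Xi_def by blast+
  note am = autom_mat_mult[OF i2, of \<gamma>\<^sub>1] and sa = sp_act_mult[OF i2 i1]
  show "invertible (autom_mat (\<gamma>\<^sub>1 ** \<gamma>\<^sub>2) \<tau>)" unfolding am by (intro invertible_mult i1 i2)
  show "sp_act (\<gamma>\<^sub>1 ** \<gamma>\<^sub>2) \<tau> \<in> siegel" unfolding sa by (rule \<tau>1)
  obtain c' where c': "\<And>x. quad c' x = quad c'' (adj2 \<gamma>\<^sub>2 x)"
    "Xi_at (\<lambda>v. theta v (sp_act \<gamma>\<^sub>2 \<tau>) ^ 4) c' = det (autom_mat \<gamma>\<^sub>2 \<tau>) ^ 8 * Xi_at (\<lambda>v. theta v \<tau> ^ 4) c''"
    using assms(2) \<tau> unfolding permutes_Xi_def by blast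
  obtain c where c: "\<And>x. quad c x = quad c' (adj2 \<gamma>\<^sub>1 x)"
    "Xi_at (\<lambda>v. theta v (sp_act \<gamma>\<^sub>1 (sp_act \<gamma>\<^sub>2 \<tau>)) ^ 4) c
      = det (autom_mat \<gamma>\<^sub>1 (sp_act \<gamma>\<^sub>2 \<tau>)) ^ 8 * Xi_at (\<lambda>v. theta v (sp_act \<gamma>\<^sub>2 \<tau>) ^ 4) c'"
    using assms(1) \<tau>2 unfolding permutes_Xi_def by blast
  show "\<exists>c. (\<forall>x. quad c x = quad c'' (adj2 (\<gamma>\<^sub>1 ** \<gamma>\<^sub>2) x)) \<and>
      Xi_at (\<lambda>v. theta v (sp_act (\<gamma>\<^sub>1 ** \<gamma>\<^sub>2) \<tau>) ^ 4) c = det (autom_mat (\<gamma>\<^sub>1 ** \<gamma>\<^sub>2) \<tau>) ^ 8 * Xi_at (\<lambda>v. theta v \<tau> ^ 4) c''"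
    unfolding sa am det_mul power_mult_distrib adj2_mult
    by (rule exI[of _ c]) (simp add: c c')
qed

definition bvec :: "'a \<Rightarrow> 'a \<Rightarrow> 'a \<Rightarrow> 'a \<Rightarrow> 'a^(2+2)"
  where "bvec a b d e = (\<chi> k. case k of Inl i \<Rightarrow> if i = 1 then a else b | Inr i \<Rightarrow> if i = 1 then d else e)"

lemma bvec_nth [simp]: "bvec a b d e $ Inl 1 = a" "bvec a b d e $ Inl 2 = b" "bvec a b d e $ Inr 1 = d" "bvec a b d e $ Inr 2 = e"
  by (simp_all add: bvec_def)

lemma bvec_eq_iff: "x = y \<longleftrightarrow> x $ Inl 1 = y $ Inl 1 \<and> x $ Inl 2 = y $ Inl 2 \<and> x $ Inr 1 = y $ Inr 1 \<and> x $ Inr 2 = y $ Inr 2"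
  for x y :: "'a^(2+2)"
  unfolding vec_eq_iff forall_2_plus ..

lemma bvec_cases:
  obtains a b d e where "x = bvec a b d e"
  by (rule that[of "x $ Inl 1" "x $ Inl 2" "x $ Inr 1" "x $ Inr 2"]) (simp add: bvec_eq_iff)

lemma quad_bvec: "quad (bvec a b d e) (bvec x1 x2 y1 y2) = x1 * y1 + x2 * y2 + (a * x1 + b * x2 + d * y1 + e * y2)"
  by (simp only: quad_def sum_plus_UNIV sum_2 bvec_nth add.assoc)

lemma adj2_blk:
  "adj2 (blk A B C D) (bvec x1 x2 y1 y2) = bvec
    (of_int (D $ 1 $ 1) * x1 + of_int (D $ 2 $ 1) * x2 + (of_int (B $ 1 $ 1) * y1 + of_int (B $ 2 $ 1) * y2))
    (of_int (D $ 1 $ 2) * x1 + of_int (D $ 2 $ 2) * x2 + (of_int (B $ 1 $ 2) * y1 + of_int (B $ 2 $ 2) * y2))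
    (of_int (C $ 1 $ 1) * x1 + of_int (C $ 2 $ 1) * x2 + (of_int (A $ 1 $ 1) * y1 + of_int (A $ 2 $ 1) * y2))
    (of_int (C $ 1 $ 2) * x1 + of_int (C $ 2 $ 2) * x2 + (of_int (A $ 1 $ 2) * y1 + of_int (A $ 2 $ 2) * y2))"
  unfolding bvec_eq_iff
  by (simp only: adj2_def swap_halves_nth matrix_vector_mult_def transpose_def map_matrix_def vec_lambda_beta
      sum_plus_UNIV sum_2 blk_nth bvec_nth add_ac)

text \<open>\<open>\<kappa>\<close> may depend on the point, whereas \<open>s\<close> and
  \<open>\<sigma>\<close> may not. The characteristic sought for \<open>c'\<close> is its preimage
  under \<open>\<sigma>\<close>.\<close>

lemma permutes_Xi_generatorI:
  fixes \<sigma> :: "bit^(2+2) \<Rightarrow> bit^(2+2)"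
  assumes act: "\<And>\<tau>. \<tau> \<in> siegel \<Longrightarrow> invertible (autom_mat \<gamma> \<tau>) \<and> sp_act \<gamma> \<tau> \<in> siegel"
    and theta: "\<And>\<tau>. \<tau> \<in> siegel \<Longrightarrow> \<exists>\<kappa>. \<kappa> ^ 4 = det (autom_mat \<gamma> \<tau>) ^ 8 \<and>
        (\<forall>v. theta v (sp_act \<gamma> \<tau>) ^ 4 = \<kappa> * (s v * theta (\<sigma> v) \<tau> ^ 4))"
    and sq: "\<And>v. s v ^ 2 = 1"
    and s4: "\<And>x y c. s c * s x * s y * s (x + y + c) = 1"
    and bij: "bij \<sigma>"
    and aff: "\<And>x y c. \<sigma> (x + y + c) = \<sigma> x + \<sigma> y + \<sigma> c"
    and quad: "\<And>c x. quad c x = quad (\<sigma> c) (adj2 \<gamma> x)"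
  shows "permutes_Xi \<gamma>"
  unfolding permutes_Xi_def
proof (intro ballI conjI allI)
  fix \<tau> :: "complex^2^2" and c' :: "bit^(2+2)"
  assume \<tau>: "\<tau> \<in> siegel"
  show "invertible (autom_mat \<gamma> \<tau>)" "sp_act \<gamma> \<tau> \<in> siegel" using act[OF \<tau>] by auto
  obtain c where c: "c' = \<sigma> c" using bij unfolding bij_def surj_def by blast
  obtain \<kappa> where \<kappa>: "\<kappa> ^ 4 = det (autom_mat \<gamma> \<tau>) ^ 8"
    "\<And>v. theta v (sp_act \<gamma> \<tau>) ^ 4 = \<kappa> * (s v * theta (\<sigma> v) \<tau> ^ 4)"
    using theta[OF \<tau>] by blast
  have "Xi_at (\<lambda>v. theta v (sp_act \<gamma> \<tau>) ^ 4) c = \<kappa> ^ 4 * Xi_at (\<lambda>v. theta v \<tau> ^ 4) (\<sigma> c)"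
    by (rule Xi_at_transform[OF \<kappa>(2) sq s4 bij aff])
  then show "\<exists>c. (\<forall>x. quad c x = quad c' (adj2 \<gamma> x)) \<and>
      Xi_at (\<lambda>v. theta v (sp_act \<gamma> \<tau>) ^ 4) c = det (autom_mat \<gamma> \<tau>) ^ 8 * Xi_at (\<lambda>v. theta v \<tau> ^ 4) c'"
    unfolding c \<kappa>(1) using quad by (intro exI[of _ c]) simp
qed

section \<open>The three kinds of generators\<close>

lemma bit_cancel: "(x :: bit) + x = 0" "x + (x + y) = y" "(x :: bit) * x = x" "x * (x * y) = x * y"
  by (cases x; simp)+

lemma map_matrix_mat2: "map_matrix f (mat2 a b c d) = mat2 (f a) (f b) (f c) (f d)"
  by (simp add: mat2_eq_iff map_matrix_def)

lemma map_matrix_of_int_one: "map_matrix of_int (mat 1) = (mat 1 :: 'a::ring_1^'n^'n)"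
  by (simp add: map_matrix_def mat_def vec_eq_iff)

lemma map_matrix_of_int_zero: "map_matrix of_int 0 = (0 :: 'a::ring_1^'n^'m)"
  by (simp add: map_matrix_def vec_eq_iff)

lemma exp_pi_i_of_int: "exp (pi * \<i> * of_int k) = (if of_int k = (0 :: bit) then 1 else - 1 :: complex)"
proof (cases "even k")
  case True
  then obtain l where "k = 2 * l" by (elim evenE)
  then show ?thesis using exp_pi_i_int_even[of l] by simp
next
  case False
  then obtain l where l: "k = 2 * l + 1" by (elim oddE)
  have "exp (pi * \<i> * of_int k) = exp (pi * \<i> * (2 * of_int l)) * exp (pi * \<i>)"
    unfolding l exp_add[symmetric] by (simp add: algebra_simps)
  then show ?thesis unfolding exp_pi_i_int_even using l by simp
qed

lemma translation_permutes_Xi: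
  assumes "transpose S = S"
  shows "permutes_Xi (blk (mat 1) S 0 (mat 1))"
proof -
  define r s t where "r = S $ 1 $ 1" and "s = S $ 1 $ 2" and "t = S $ 2 $ 2"
  have S: "S = mat2 r s s t"
    using arg_cong[OF assms, of "\<lambda>M. M $ 1 $ 2"] by (simp add: mat2_eq_iff transpose_def r_def s_def t_def)
  let ?\<gamma> = "blk (mat 1) S 0 (mat 1)"
  \<comment> \<open>\<open>\<sigma>\<close> and \<open>sg\<close> are the characteristic and the
    sign of \<open>th2_translation_power4\<close>, read modulo 2.\<close>
  define \<sigma> where "\<sigma> = (\<lambda>v :: bit^(2+2). bvec (v $ Inl 1) (v $ Inl 2)
     (v $ Inr 1 + of_int r + of_int r * v $ Inl 1 + of_int s * v $ Inl 2)
     (v $ Inr 2 + of_int t + of_int t * v $ Inl 2 + of_int s * v $ Inl 1))"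
  define sg where "sg = (\<lambda>v :: bit^(2+2). if v $ Inl 1 * of_int r + v $ Inl 2 * of_int t = 0 then 1 else - 1 :: complex)"
  have am: "autom_mat ?\<gamma> \<tau> = mat 1" for \<tau>
    by (simp add: autom_mat_def map_matrix_of_int_one map_matrix_of_int_zero)
  have inv: "invertible (mat 1 :: complex^2^2)" unfolding invertible_def by (intro exI[of _ "mat 1"]) simp
  have act: "sp_act ?\<gamma> \<tau> = \<tau> + map_matrix of_int S" for \<tau>
    by (rule sp_act_eqI) (simp_all add: am inv map_matrix_of_int_one)
  have act': "sp_act ?\<gamma> \<tau> $ 1 $ 1 = \<tau> $ 1 $ 1 + of_int r" "sp_act ?\<gamma> \<tau> $ 1 $ 2 = \<tau> $ 1 $ 2 + of_int s"
    "sp_act ?\<gamma> \<tau> $ 2 $ 1 = \<tau> $ 2 $ 1 + of_int s" "sp_act ?\<gamma> \<tau> $ 2 $ 2 = \<tau> $ 2 $ 2 + of_int t" for \<tau>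
    unfolding act unfolding S map_matrix_mat2 by simp_all
  have sie: "sp_act ?\<gamma> \<tau> \<in> siegel" if "\<tau> \<in> siegel" for \<tau>
    using that unfolding siegel2_iff act' by (simp add: upper2_def)
  show ?thesis
  proof (rule permutes_Xi_generatorI[where s = sg and \<sigma> = \<sigma>])
    show "invertible (autom_mat ?\<gamma> \<tau>) \<and> sp_act ?\<gamma> \<tau> \<in> siegel" if "\<tau> \<in> siegel" for \<tau>
      using inv sie[OF that] unfolding am by simp
    show "\<exists>\<kappa>. \<kappa> ^ 4 = det (autom_mat ?\<gamma> \<tau>) ^ 8 \<and> (\<forall>v. theta v (sp_act ?\<gamma> \<tau>) ^ 4 = \<kappa> * (sg v * theta (\<sigma> v) \<tau> ^ 4))"
      if \<tau>: "\<tau> \<in> siegel" for \<tau>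
    proof (intro exI[of _ 1] conjI allI)
      fix v :: "bit^(2+2)"
      define a b d e where "a = (of_bit (v $ Inl 1) :: int)" and "b = (of_bit (v $ Inl 2) :: int)"
        and "d = (of_bit (v $ Inr 1) :: int)" and "e = (of_bit (v $ Inr 2) :: int)"
      have 1: "theta v (sp_act ?\<gamma> \<tau>) ^ 4 = th2 a b d e (\<tau> $ 1 $ 1 + of_int r) (\<tau> $ 1 $ 2 + of_int s) (\<tau> $ 2 $ 2 + of_int t) ^ 4"
        unfolding theta_eq_th2[OF sie[OF \<tau>]] act' a_def b_def d_def e_def ..
      have 2: "theta (\<sigma> v) \<tau> ^ 4 = th2 a b (d + r + r * a + s * b) (e + t + t * b + s * a) (\<tau> $ 1 $ 1) (\<tau> $ 1 $ 2) (\<tau> $ 2 $ 2) ^ 4"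
        by (rule theta_power4_eq_th2[OF \<tau>]) (simp_all only: \<sigma>_def bvec_nth of_int_add of_int_mult a_def b_def d_def e_def of_int_of_bit)
      have 3: "exp (pi * \<i> * of_int (a * r + b * t)) = sg v"
        unfolding exp_pi_i_of_int sg_def by (simp only: of_int_add of_int_mult a_def b_def of_int_of_bit)
      show "theta v (sp_act ?\<gamma> \<tau>) ^ 4 = 1 * (sg v * theta (\<sigma> v) \<tau> ^ 4)"
        unfolding 1 2 th2_translation_power4 3 by simp
    qed (simp add: am)
    show "sg v ^ 2 = 1" for v by (simp add: sg_def)
    \<comment> \<open>For a character the product over \<open>c\<close>, \<open>x\<close>,
      \<open>y\<close> and \<open>x + y + c\<close> is a product of squares.\<close>
    have hom: "sg (x + y) = sg x * sg y" for x y
    proof -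
      define X Y where "X = x $ Inl 1 * of_int r + x $ Inl 2 * of_int t" and "Y = y $ Inl 1 * of_int r + y $ Inl 2 * of_int t"
      have "(x + y) $ Inl 1 * of_int r + (x + y) $ Inl 2 * of_int t = X + Y"
        by (simp only: X_def Y_def vector_add_component distrib_right add_ac)
      then show ?thesis unfolding sg_def X_def[symmetric] Y_def[symmetric] by (cases X; cases Y) simp_all
    qed
    show "sg c * sg x * sg y * sg (x + y + c) = 1" for x y c
      unfolding hom by (simp add: sg_def)
    have inv\<sigma>: "\<sigma> (\<sigma> v) = v" for v
      unfolding \<sigma>_def bvec_eq_iff bvec_nth by (simp only: add_ac bit_cancel add_0_left add_0_right simp_thms)
    show "bij \<sigma>" by (rule involuntory_imp_bij) (rule inv\<sigma>)
    show "\<sigma> (x + y + c) = \<sigma> x + \<sigma> y + \<sigma> c" for x y c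
      unfolding \<sigma>_def bvec_eq_iff by (simp only: vector_add_component bvec_nth distrib_left add_ac bit_cancel simp_thms)
    \<comment> \<open>Substitution produces \<open>r * y1^2 = r * y1\<close> and
      \<open>t * y2^2 = t * y2\<close>, which cancel against the shift of the lower row by the
      diagonal of \<open>S\<close>; the mixed term with \<open>s\<close> occurs twice.\<close>
    show "quad c x = quad (\<sigma> c) (adj2 ?\<gamma> x)" for c x
    proof -
      obtain a b d e where c: "c = bvec a b d e" by (rule bvec_cases)
      obtain x1 x2 y1 y2 where x: "x = bvec x1 x2 y1 y2" by (rule bvec_cases)
      define r' s' t' where "r' = (of_int r :: bit)" and "s' = (of_int s :: bit)" and "t' = (of_int t :: bit)"
      have "adj2 ?\<gamma> x = bvec (x1 + (r' * y1 + s' * y2)) (x2 + (s' * y1 + t' * y2)) y1 y2"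
        unfolding x adj2_blk S mat2_one mat2_zero r'_def s'_def t'_def by simp
      then show ?thesis
        unfolding c x \<sigma>_def bvec_nth quad_bvec r'_def[symmetric] s'_def[symmetric] t'_def[symmetric]
        by (simp only: quad_bvec) (simp only: distrib_left distrib_right mult_ac add_ac bit_cancel)
    qed
  qed
qed

lemma base_change_permutes_Xi:
  assumes UV: "U ** V = mat 1" and VU: "V ** U = mat 1"
  shows "permutes_Xi (blk U 0 0 (transpose V))"
proof -
  define u1 u2 u3 u4 where "u1 = U $ 1 $ 1" and "u2 = U $ 1 $ 2" and "u3 = U $ 2 $ 1" and "u4 = U $ 2 $ 2"
  define v1 v2 v3 v4 where "v1 = V $ 1 $ 1" and "v2 = V $ 1 $ 2" and "v3 = V $ 2 $ 1" and "v4 = V $ 2 $ 2"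
  have U: "U = mat2 u1 u2 u3 u4" and V: "V = mat2 v1 v2 v3 v4"
    by (simp_all add: mat2_entries u1_def u2_def u3_def u4_def v1_def v2_def v3_def v4_def)
  have uv: "u1 * v1 + u2 * v3 = 1" "u1 * v2 + u2 * v4 = 0" "u3 * v1 + u4 * v3 = 0" "u3 * v2 + u4 * v4 = 1"
    using UV unfolding U V mat2_one mat2_mult mat2_inject by blast+
  have vu: "v1 * u1 + v2 * u3 = 1" "v1 * u2 + v2 * u4 = 0" "v3 * u1 + v4 * u3 = 0" "v3 * u2 + v4 * u4 = 1"
    using VU unfolding U V mat2_one mat2_mult mat2_inject by blast+
  let ?\<gamma> = "blk U 0 0 (transpose V)"
  let ?U = "map_matrix of_int U :: complex^2^2" and ?V = "map_matrix of_int V :: complex^2^2"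
  have UVc: "?U ** ?V = mat 1" "?V ** ?U = mat 1"
    unfolding map_matrix_of_int_mult[symmetric] UV VU map_matrix_of_int_one by auto
  have mt: "map_matrix of_int (transpose V) = transpose ?V"
    by (simp add: map_matrix_def transpose_def)
  have am: "autom_mat ?\<gamma> \<tau> = transpose ?V" for \<tau>
    by (simp add: autom_mat_def map_matrix_of_int_zero mt)
  have tUV: "transpose ?U ** transpose ?V = mat 1" "transpose ?V ** transpose ?U = mat 1"
    unfolding matrix_transpose_mul[symmetric] UVc by simp_all
  have inv: "invertible (transpose ?V)" unfolding invertible_def using tUV by blast
  have act: "sp_act ?\<gamma> \<tau> = ?U ** \<tau> ** transpose ?U" for \<tau>
    by (rule sp_act_eqI) (simp_all add: am inv matrix_mul_assoc[symmetric] tUV map_matrix_of_int_zero)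
  have act': "sp_act ?\<gamma> \<tau> $ 1 $ 1 = of_int u1^2 * \<tau> $ 1 $ 1 + 2 * of_int u1 * of_int u2 * \<tau> $ 1 $ 2 + of_int u2^2 * \<tau> $ 2 $ 2"
    "sp_act ?\<gamma> \<tau> $ 1 $ 2 = of_int u1 * of_int u3 * \<tau> $ 1 $ 1 + (of_int u1 * of_int u4 + of_int u2 * of_int u3) * \<tau> $ 1 $ 2 + of_int u2 * of_int u4 * \<tau> $ 2 $ 2"
    "sp_act ?\<gamma> \<tau> $ 2 $ 1 = sp_act ?\<gamma> \<tau> $ 1 $ 2"
    "sp_act ?\<gamma> \<tau> $ 2 $ 2 = of_int u3^2 * \<tau> $ 1 $ 1 + 2 * of_int u3 * of_int u4 * \<tau> $ 1 $ 2 + of_int u4^2 * \<tau> $ 2 $ 2"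
    if sym: "\<tau> $ 2 $ 1 = \<tau> $ 1 $ 2" for \<tau>
    unfolding act unfolding U map_matrix_mat2
    by (simp_all add: matrix_matrix_mult_def transpose_def sum_2 sym power2_eq_square algebra_simps)
  \<comment> \<open>The determinant is 1 or -1, so the factor 1 serves as \<open>\<kappa>\<close>
    below.\<close>
  have dt: "det (transpose ?V) ^ 8 = 1"
  proof -
    have "(u1 * u4 - u2 * u3) * (v1 * v4 - v2 * v3) = (u1 * v1 + u2 * v3) * (u3 * v2 + u4 * v4) - (u1 * v2 + u2 * v4) * (u3 * v1 + u4 * v3)"
      by (simp add: algebra_simps)
    then have "(u1 * u4 - u2 * u3) * (v1 * v4 - v2 * v3) = 1" unfolding uv by simp
    then have "v1 * v4 - v2 * v3 = 1 \<or> v1 * v4 - v2 * v3 = -1" using zmult_eq_1_iff by blast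
    moreover have d: "det (transpose ?V) = of_int (v1 * v4 - v2 * v3)"
      unfolding V map_matrix_mat2 transpose_mat2 det_mat2 by simp
    ultimately show ?thesis unfolding d by (elim disjE) (simp_all del: of_int_mult of_int_diff)
  qed
  have sie: "sp_act ?\<gamma> \<tau> \<in> siegel" if \<tau>: "\<tau> \<in> siegel" for \<tau>
  proof -
    have sym: "\<tau> $ 2 $ 1 = \<tau> $ 1 $ 2" using \<tau> by (simp add: siegel2_iff)
    have tr: "transpose \<tau> = \<tau>" and pd: "pos_def_matrix (map_matrix Im \<tau>)" using \<tau> by (auto simp: siegel_def)
    have "transpose (sp_act ?\<gamma> \<tau>) = sp_act ?\<gamma> \<tau>"
      unfolding act matrix_transpose_mul tr transpose_transpose by (simp add: matrix_mul_assoc)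
    moreover have "pos_def_matrix (map_matrix Im (sp_act ?\<gamma> \<tau>))"
      unfolding pos_def_matrix_def
    proof (intro allI impI)
      fix x :: "real^2" assume x: "x \<noteq> 0"
      \<comment> \<open>\<open>y\<close> is \<open>U^t x\<close>: the new form at \<open>x\<close>
        is the old form at \<open>y\<close>, and \<open>U\<close> is invertible.\<close>
      define y :: "real^2" where "y = vector [of_int u1 * x $ 1 + of_int u3 * x $ 2, of_int u2 * x $ 1 + of_int u4 * x $ 2]"
      have "y \<noteq> 0"
      proof
        assume "y = 0"
        then have z: "of_int u1 * x $ 1 + of_int u3 * x $ 2 = 0" "of_int u2 * x $ 1 + of_int u4 * x $ 2 = 0"
          by (simp_all add: y_def vec_eq_iff forall_2)
        have e: "x $ 1 = of_int (u1 * v1 + u2 * v3) * x $ 1 + of_int (u3 * v1 + u4 * v3) * x $ 2"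
          "x $ 2 = of_int (u1 * v2 + u2 * v4) * x $ 1 + of_int (u3 * v2 + u4 * v4) * x $ 2"
          unfolding uv by simp_all
        have f: "of_int (u1 * v1 + u2 * v3) * x $ 1 + of_int (u3 * v1 + u4 * v3) * x $ 2
           = of_int v1 * (of_int u1 * x $ 1 + of_int u3 * x $ 2) + of_int v3 * (of_int u2 * x $ 1 + of_int u4 * x $ 2)"
          "of_int (u1 * v2 + u2 * v4) * x $ 1 + of_int (u3 * v2 + u4 * v4) * x $ 2
           = of_int v2 * (of_int u1 * x $ 1 + of_int u3 * x $ 2) + of_int v4 * (of_int u2 * x $ 1 + of_int u4 * x $ 2)"
          by (simp_all add: algebra_simps)
        have "x $ 1 = 0" "x $ 2 = 0"
          using trans[OF e(1) f(1)] trans[OF e(2) f(2)] unfolding z by simp_all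
        then show False using x by (simp add: vec_eq_iff forall_2)
      qed
      then have "y \<bullet> (map_matrix Im \<tau> *v y) > 0" using pd by (simp add: pos_def_matrix_def)
      also have "y \<bullet> (map_matrix Im \<tau> *v y) = x \<bullet> (map_matrix Im (sp_act ?\<gamma> \<tau>) *v x)"
        by (simp add: inner_vec_def sum_2 matrix_vector_mult_def map_matrix_def act'[OF sym] y_def sym power2_eq_square algebra_simps)
      finally show "x \<bullet> (map_matrix Im (sp_act ?\<gamma> \<tau>) *v x) > 0" .
    qed
    ultimately show ?thesis by (simp add: siegel_def)
  qed
  define \<sigma> where "\<sigma> = (\<lambda>v :: bit^(2+2). bvec (of_int u1 * v $ Inl 1 + of_int u3 * v $ Inl 2) (of_int u2 * v $ Inl 1 + of_int u4 * v $ Inl 2)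
     (of_int v1 * v $ Inr 1 + of_int v2 * v $ Inr 2) (of_int v3 * v $ Inr 1 + of_int v4 * v $ Inr 2))"
  \<comment> \<open>The inverse of \<open>\<sigma>\<close>, obtained by exchanging \<open>U\<close>
    and \<open>V\<close>.\<close>
  define \<rho> where "\<rho> = (\<lambda>v :: bit^(2+2). bvec (of_int v1 * v $ Inl 1 + of_int v3 * v $ Inl 2) (of_int v2 * v $ Inl 1 + of_int v4 * v $ Inl 2)
     (of_int u1 * v $ Inr 1 + of_int u2 * v $ Inr 2) (of_int u3 * v $ Inr 1 + of_int u4 * v $ Inr 2))"
  note buv = uv[THEN arg_cong[where f = "of_int :: int \<Rightarrow> bit"], unfolded of_int_add of_int_mult of_int_1 of_int_0]
    and bvu = vu[THEN arg_cong[where f = "of_int :: int \<Rightarrow> bit"], unfolded of_int_add of_int_mult of_int_1 of_int_0]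
  have buv': "of_int v1 * of_int u1 + of_int v3 * of_int u2 = (1 :: bit)" "of_int v2 * of_int u1 + of_int v4 * of_int u2 = (0 :: bit)"
    "of_int v1 * of_int u3 + of_int v3 * of_int u4 = (0 :: bit)" "of_int v2 * of_int u3 + of_int v4 * of_int u4 = (1 :: bit)"
    and bvu': "of_int u1 * of_int v1 + of_int u3 * of_int v2 = (1 :: bit)" "of_int u2 * of_int v1 + of_int u4 * of_int v2 = (0 :: bit)"
    "of_int u1 * of_int v3 + of_int u3 * of_int v4 = (0 :: bit)" "of_int u2 * of_int v3 + of_int u4 * of_int v4 = (1 :: bit)"
    using buv bvu by (simp_all only: mult.commute)
  have lin: "p1 * (q1 * x + q2 * y) + p2 * (q3 * x + q4 * y) = (q1 * p1 + q3 * p2) * x + (q2 * p1 + q4 * p2) * y"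
    for p1 p2 q1 q2 q3 q4 x y :: bit
    by (simp only: distrib_left distrib_right mult_ac add_ac)
  show ?thesis
  proof (rule permutes_Xi_generatorI[where s = "\<lambda>_. 1" and \<sigma> = \<sigma>])
    show "invertible (autom_mat ?\<gamma> \<tau>) \<and> sp_act ?\<gamma> \<tau> \<in> siegel" if "\<tau> \<in> siegel" for \<tau>
      using inv sie[OF that] unfolding am by simp
    show "\<exists>\<kappa>. \<kappa> ^ 4 = det (autom_mat ?\<gamma> \<tau>) ^ 8 \<and> (\<forall>v. theta v (sp_act ?\<gamma> \<tau>) ^ 4 = \<kappa> * (1 * theta (\<sigma> v) \<tau> ^ 4))"
      if \<tau>: "\<tau> \<in> siegel" for \<tau>
    proof (intro exI[of _ 1] conjI allI)
      fix v :: "bit^(2+2)"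
      have sym: "\<tau> $ 2 $ 1 = \<tau> $ 1 $ 2" using \<tau> by (simp add: siegel2_iff)
      define a b d e where "a = (of_bit (v $ Inl 1) :: int)" and "b = (of_bit (v $ Inl 2) :: int)"
        and "d = (of_bit (v $ Inr 1) :: int)" and "e = (of_bit (v $ Inr 2) :: int)"
      have 1: "theta v (sp_act ?\<gamma> \<tau>) = th2 (u1 * a + u3 * b) (u2 * a + u4 * b) (v1 * d + v2 * e) (v3 * d + v4 * e) (\<tau> $ 1 $ 1) (\<tau> $ 1 $ 2) (\<tau> $ 2 $ 2)"
        unfolding theta_eq_th2[OF sie[OF \<tau>]] act'[OF sym] a_def[symmetric] b_def[symmetric] d_def[symmetric] e_def[symmetric]
        by (rule th2_base_change[OF uv vu])
      have 2: "theta (\<sigma> v) \<tau> ^ 4 = th2 (u1 * a + u3 * b) (u2 * a + u4 * b) (v1 * d + v2 * e) (v3 * d + v4 * e) (\<tau> $ 1 $ 1) (\<tau> $ 1 $ 2) (\<tau> $ 2 $ 2) ^ 4"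
        by (rule theta_power4_eq_th2[OF \<tau>]) (simp_all only: \<sigma>_def bvec_nth of_int_add of_int_mult a_def b_def d_def e_def of_int_of_bit)
      show "theta v (sp_act ?\<gamma> \<tau>) ^ 4 = 1 * (1 * theta (\<sigma> v) \<tau> ^ 4)"
        unfolding 1 2 by simp
    qed (simp only: am dt power_one)
    show "bij \<sigma>"
    proof (rule bij_betw_byWitness[where f' = \<rho>])
      show "\<forall>v\<in>UNIV. \<rho> (\<sigma> v) = v"
        unfolding \<sigma>_def \<rho>_def bvec_eq_iff bvec_nth lin
        by (simp only: buv bvu buv' bvu' mult_1_left mult_zero_left add_0_left add_0_right simp_thms ball_UNIV)
      show "\<forall>v\<in>UNIV. \<sigma> (\<rho> v) = v"
        unfolding \<sigma>_def \<rho>_def bvec_eq_iff bvec_nth lin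
        by (simp only: buv bvu buv' bvu' mult_1_left mult_zero_left add_0_left add_0_right simp_thms ball_UNIV)
    qed auto
    show "\<sigma> (x + y + c) = \<sigma> x + \<sigma> y + \<sigma> c" for x y c
      unfolding \<sigma>_def bvec_eq_iff by (simp only: vector_add_component bvec_nth distrib_left add_ac simp_thms)
    show "quad c x = quad (\<sigma> c) (adj2 ?\<gamma> x)" for c x
    proof -
      obtain a b d e where c: "c = bvec a b d e" by (rule bvec_cases)
      obtain x1 x2 y1 y2 where x: "x = bvec x1 x2 y1 y2" by (rule bvec_cases)
      define w1 w2 w3 w4 z1 z2 z3 z4 where "w1 = (of_int u1 :: bit)" and "w2 = (of_int u2 :: bit)" and "w3 = (of_int u3 :: bit)" and "w4 = (of_int u4 :: bit)"
        and "z1 = (of_int v1 :: bit)" and "z2 = (of_int v2 :: bit)" and "z3 = (of_int v3 :: bit)" and "z4 = (of_int v4 :: bit)"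
      note wz = w1_def w2_def w3_def w4_def z1_def z2_def z3_def z4_def
      have adj: "adj2 ?\<gamma> x = bvec (z1 * x1 + z2 * x2) (z3 * x1 + z4 * x2) (w1 * y1 + w3 * y2) (w2 * y1 + w4 * y2)"
        unfolding x adj2_blk U V transpose_mat2 mat2_zero wz by simp
      have "quad (\<sigma> c) (adj2 ?\<gamma> x) = (w1 * z1 + w2 * z3) * (x1 * y1) + (w3 * z1 + w4 * z3) * (x1 * y2) + (w1 * z2 + w2 * z4) * (x2 * y1)
          + (w3 * z2 + w4 * z4) * (x2 * y2)
        + (a * ((w1 * z1 + w2 * z3) * x1 + (w1 * z2 + w2 * z4) * x2) + b * ((w3 * z1 + w4 * z3) * x1 + (w3 * z2 + w4 * z4) * x2)
         + d * ((z1 * w1 + z3 * w2) * y1 + (z1 * w3 + z3 * w4) * y2) + e * ((z2 * w1 + z4 * w2) * y1 + (z2 * w3 + z4 * w4) * y2))"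
        unfolding adj c \<sigma>_def bvec_nth quad_bvec wz[symmetric] by (simp only: distrib_left distrib_right mult_ac add_ac)
      also have "\<dots> = quad c x"
        unfolding c x quad_bvec wz
        by (simp only: buv buv' mult_1_left mult_zero_left mult_zero_right add_0_left add_0_right)
      finally show ?thesis ..
    qed
  qed simp_all
qed

text \<open>Both \<open>\<sigma>\<close> and \<open>adj2\<close> swap the upper and lower entries of
  the first coordinate, so the quadratic forms match by commutativity. The automorphy determinant is
  the first diagonal entry \<open>p\<close>, and \<open>\<kappa> = - (p^2)\<close>.\<close>

lemma inversion_permutes_Xi: "permutes_Xi (sl2_first 0 (-1) 1 0)"
proof -
  let ?\<gamma> = "sl2_first 0 (-1) 1 0"
  define \<sigma> where "\<sigma> = (\<lambda>v :: bit^(2+2). bvec (v $ Inr 1) (v $ Inl 2) (v $ Inl 1) (v $ Inr 2))"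
  have am: "autom_mat ?\<gamma> \<tau> = mat2 (\<tau> $ 1 $ 1) (\<tau> $ 1 $ 2) 0 1" for \<tau>
    by (subst (1) mat2_entries[symmetric, of \<tau>]) (simp add: autom_mat_def sl2_first_def map_matrix_mat2)
  have p: "\<tau> $ 1 $ 1 \<noteq> 0" if "\<tau> \<in> siegel" for \<tau> :: "complex^2^2"
    using that by (auto simp: siegel2_iff upper2_def)
  have inv: "invertible (autom_mat ?\<gamma> \<tau>)" if "\<tau> \<in> siegel" for \<tau>
    using p[OF that] unfolding am by (simp add: invertible_det_nz det_mat2)
  have act: "sp_act ?\<gamma> \<tau> = mat2 (- 1 / \<tau> $ 1 $ 1) (\<tau> $ 1 $ 2 / \<tau> $ 1 $ 1) (\<tau> $ 1 $ 2 / \<tau> $ 1 $ 1) (\<tau> $ 2 $ 2 - \<tau> $ 1 $ 2 ^ 2 / \<tau> $ 1 $ 1)"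
    if \<tau>: "\<tau> \<in> siegel" for \<tau>
  proof (rule sp_act_eqI[OF inv[OF \<tau>]])
    have sym: "\<tau> $ 2 $ 1 = \<tau> $ 1 $ 2" using \<tau> by (simp add: siegel2_iff)
    have "map_matrix of_int (blkA ?\<gamma>) ** \<tau> = mat2 0 0 0 1 ** mat2 (\<tau> $ 1 $ 1) (\<tau> $ 1 $ 2) (\<tau> $ 2 $ 1) (\<tau> $ 2 $ 2)"
      unfolding mat2_entries by (simp add: sl2_first_def map_matrix_mat2)
    then have "map_matrix of_int (blkA ?\<gamma>) ** \<tau> + map_matrix of_int (blkB ?\<gamma>) = mat2 (- 1) 0 (\<tau> $ 1 $ 2) (\<tau> $ 2 $ 2)"
      by (simp add: sl2_first_def map_matrix_mat2 sym)
    then show "mat2 (- 1 / \<tau> $ 1 $ 1) (\<tau> $ 1 $ 2 / \<tau> $ 1 $ 1) (\<tau> $ 1 $ 2 / \<tau> $ 1 $ 1) (\<tau> $ 2 $ 2 - \<tau> $ 1 $ 2 ^ 2 / \<tau> $ 1 $ 1) ** autom_mat ?\<gamma> \<tau>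
       = map_matrix of_int (blkA ?\<gamma>) ** \<tau> + map_matrix of_int (blkB ?\<gamma>)"
      using p[OF \<tau>] by (simp add: am power2_eq_square field_simps)
  qed
  have sie: "sp_act ?\<gamma> \<tau> \<in> siegel" if \<tau>: "\<tau> \<in> siegel" for \<tau>
    using \<tau> upper2_partial_inversion unfolding act[OF \<tau>] siegel2_iff mat2_nth by blast
  show ?thesis
  proof (rule permutes_Xi_generatorI[where s = "\<lambda>_. 1" and \<sigma> = \<sigma>])
    show "invertible (autom_mat ?\<gamma> \<tau>) \<and> sp_act ?\<gamma> \<tau> \<in> siegel" if "\<tau> \<in> siegel" for \<tau>
      using inv[OF that] sie[OF that] by simp
    show "\<exists>\<kappa>. \<kappa> ^ 4 = det (autom_mat ?\<gamma> \<tau>) ^ 8 \<and> (\<forall>v. theta v (sp_act ?\<gamma> \<tau>) ^ 4 = \<kappa> * (1 * theta (\<sigma> v) \<tau> ^ 4))"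
      if \<tau>: "\<tau> \<in> siegel" for \<tau>
    proof (intro exI[of _ "- (\<tau> $ 1 $ 1 ^ 2)"] conjI allI)
      show "(- (\<tau> $ 1 $ 1 ^ 2)) ^ 4 = det (autom_mat ?\<gamma> \<tau>) ^ 8"
        unfolding am det_mat2 by (simp add: power_mult[symmetric])
      fix v :: "bit^(2+2)"
      have up: "upper2 (\<tau> $ 1 $ 1) (\<tau> $ 1 $ 2) (\<tau> $ 2 $ 2)" using \<tau> by (simp add: siegel2_iff)
      show "theta v (sp_act ?\<gamma> \<tau>) ^ 4 = - (\<tau> $ 1 $ 1 ^ 2) * (1 * theta (\<sigma> v) \<tau> ^ 4)"
        unfolding theta_eq_th2[OF sie[OF \<tau>]] theta_eq_th2[OF \<tau>]
        unfolding act[OF \<tau>] mat2_nth th2_partial_inversion_power4[OF up]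
        by (simp only: \<sigma>_def bvec_nth mult_1_left)
    qed
    have inv\<sigma>: "\<sigma> (\<sigma> v) = v" for v unfolding \<sigma>_def bvec_eq_iff by simp
    show "bij \<sigma>" by (rule involuntory_imp_bij) (rule inv\<sigma>)
    show "\<sigma> (x + y + c) = \<sigma> x + \<sigma> y + \<sigma> c" for x y c
      unfolding \<sigma>_def bvec_eq_iff by simp
    show "quad c x = quad (\<sigma> c) (adj2 ?\<gamma> x)" for c x
    proof -
      obtain a b d e where c: "c = bvec a b d e" by (rule bvec_cases)
      obtain x1 x2 y1 y2 where x: "x = bvec x1 x2 y1 y2" by (rule bvec_cases)
      have "adj2 ?\<gamma> x = bvec y1 x2 x1 y2"
        unfolding x sl2_first_def adj2_blk by simp
      then show ?thesis
        unfolding c x \<sigma>_def bvec_nth by (simp only: quad_bvec mult_ac add_ac)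
    qed
  qed simp_all
qed

lemma Sp_Z_permutes_Xi: "\<gamma> \<in> Sp_Z \<Longrightarrow> permutes_Xi \<gamma>"
  using Sp_Z_subset_gen
proof (rule Sp4_gen.induct)
qed (auto intro: translation_permutes_Xi base_change_permutes_Xi inversion_permutes_Xi permutes_Xi_mult)

lemma Xi2_modular: "modular_form 8 Gamma12 Xi2"
  unfolding modular_form_def
proof (intro conjI ballI)
  show "CARD(2) \<ge> 2" by simp
  show "siegel_holomorphic Xi2" by (rule Xi2_holomorphic)
  fix \<gamma> :: "int^(2+2)^(2+2)" and \<tau> :: "complex^2^2"
  assume \<gamma>: "\<gamma> \<in> Gamma12" and \<tau>: "\<tau> \<in> siegel"
  have "permutes_Xi \<gamma>" using \<gamma> by (intro Sp_Z_permutes_Xi) (simp add: Gamma12_def)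
  then obtain c where c: "\<And>x. quad c x = quad 0 (adj2 \<gamma> x)"
    "Xi_at (\<lambda>v. theta v (sp_act \<gamma> \<tau>) ^ 4) c = det (autom_mat \<gamma> \<tau>) ^ 8 * Xi_at (\<lambda>v. theta v \<tau> ^ 4) 0"
    using \<tau> unfolding permutes_Xi_def by blast
  have "c = 0" using c(1) quad_adj2_Gamma12[OF \<gamma>] by (intro quad_inject) simp
  then show "Xi2 (sp_act \<gamma> \<tau>) = det (autom_mat \<gamma> \<tau>) ^ 8 * Xi2 \<tau>"
    using c(2) by (simp add: Xi2_eq_Xi_at)
qed

section \<open>Factorization on diagonal matrices\<close>

lemma th2_diagonal:
  assumes "upper2 p 0 q"
  shows "th2 a b d e p 0 q = ctheta a d 0 p * ctheta b e 0 q"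
proof -
  have eq: "(exp (pi * \<i> * theta_form (half_shift m a) (half_shift n b) p 0 q d e))
   = exp (pi * \<i> * ((half_shift m a)^2 * p + 2 * (half_shift m a) * 0 + (half_shift m a) * of_int d))
   * exp (pi * \<i> * ((half_shift n b)^2 * q + 2 * (half_shift n b) * 0 + (half_shift n b) * of_int e))" for m n :: int
    unfolding exp_add[symmetric] by (rule arg_cong[where f = exp]) (simp add: algebra_simps)
  show ?thesis
    using th2_summable[OF assms, of a b d e] unfolding th2_def ctheta_def eq
    by (rule infsum_product_pairs)
qed

text \<open>Pairs with even sum are \<open>(u + v, u - v)\<close>, those with odd sum form the other
  coset. This substitution doubles the form \<open>m^2 + n^2\<close>.\<close>

lemma infsum_int_pairs_parity:
  fixes f :: "int \<times> int \<Rightarrow> complex"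
  assumes "f summable_on UNIV"
  shows "(\<Sum>\<^sub>\<infinity>x. f x) = (\<Sum>\<^sub>\<infinity>(u, v). f (u + v, u - v)) + (\<Sum>\<^sub>\<infinity>(u, v). f (u + v + 1, u - v))"
proof -
  let ?E = "{(m, n). even (m + n)} :: (int \<times> int) set" and ?O = "{(m, n). odd (m + n)} :: (int \<times> int) set"
  have "bij_betw (\<lambda>(u, v). (u + v, u - v)) UNIV ?E"
  proof (rule bij_betw_byWitness[where f' = "\<lambda>(m, n). ((m + n) div 2, (m - n) div 2)"])
    show "\<forall>x\<in>?E. (case (case x of (m, n) \<Rightarrow> ((m + n) div 2, (m - n) div 2)) of (u, v) \<Rightarrow> (u + v, u - v)) = x"
    proof clarify
      fix m n :: int assume "even (m + n)"
      then obtain k where k: "m + n = 2 * k" by (elim evenE)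
      then have m: "m = 2 * k - n" by simp
      have "(m + n) div 2 = k" "(m - n) div 2 = k - n" unfolding m by simp_all
      then show "(m + n) div 2 + (m - n) div 2 = m \<and> (m + n) div 2 - (m - n) div 2 = n"
        using m by simp
    qed
  qed auto
  from infsum_reindex_bij_betw[OF this, of f]
  have E: "(\<Sum>\<^sub>\<infinity>(u, v). f (u + v, u - v)) = infsum f ?E" by (simp add: case_prod_unfold)
  have "bij_betw (\<lambda>(u, v). (u + v + 1, u - v)) UNIV ?O"
  proof (rule bij_betw_byWitness[where f' = "\<lambda>(m, n). ((m + n) div 2, (m - n) div 2)"])
    show "\<forall>x\<in>?O. (case (case x of (m, n) \<Rightarrow> ((m + n) div 2, (m - n) div 2)) of (u, v) \<Rightarrow> (u + v + 1, u - v)) = x"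
    proof clarify
      fix m n :: int assume "odd (m + n)"
      then obtain k where k: "m + n = 2 * k + 1" by (elim oddE)
      then have m: "m = 2 * k + 1 - n" by simp
      have "(m + n) div 2 = k" "(m - n) div 2 = k - n" unfolding m by simp_all
      then show "(m + n) div 2 + (m - n) div 2 + 1 = m \<and> (m + n) div 2 - (m - n) div 2 = n"
        using m by simp
    qed
  qed auto
  from infsum_reindex_bij_betw[OF this, of f]
  have O: "(\<Sum>\<^sub>\<infinity>(u, v). f (u + v + 1, u - v)) = infsum f ?O" by (simp add: case_prod_unfold)
  have "infsum f (?E \<union> ?O) = infsum f ?E + infsum f ?O"
    by (rule infsum_Un_disjoint) (auto intro: summable_on_subset_banach[OF assms])
  moreover have "?E \<union> ?O = UNIV" by auto
  ultimately show ?thesis unfolding E O by simp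
qed

text \<open>A square is the two-variable series at \<open>diag(\<sigma>, \<sigma>)\<close>.
  Splitting its index set by parity diagonalizes the form again with period
  \<open>2 * \<sigma>\<close>; the odd class shifts the upper characteristic by
  \<open>(1, 1)\<close>.\<close>

lemma theta_constant_duplication:
  assumes "Im \<sigma> > 0"
  shows "ctheta 0 0 0 \<sigma> ^ 2 = ctheta 0 0 0 (2 * \<sigma>) ^ 2 + ctheta 1 0 0 (2 * \<sigma>) ^ 2"
    and "ctheta 0 1 0 \<sigma> ^ 2 = ctheta 0 0 0 (2 * \<sigma>) ^ 2 - ctheta 1 0 0 (2 * \<sigma>) ^ 2"
    and "ctheta 1 0 0 \<sigma> ^ 2 = 2 * ctheta 0 0 0 (2 * \<sigma>) * ctheta 1 0 0 (2 * \<sigma>)"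
proof -
  have up: "upper2 \<sigma> 0 \<sigma>" "upper2 (2 * \<sigma>) 0 (2 * \<sigma>)" using assms by (simp_all add: upper2_def)
  note split = infsum_int_pairs_parity[OF th2_summable[OF up(1)], folded th2_def]
  have e: "exp (pi * \<i> * w) = exp (pi * \<i> * w')" if "w = w'" for w w' using that by simp
  have "ctheta 0 0 0 \<sigma> ^ 2 = th2 0 0 0 0 \<sigma> 0 \<sigma>"
    unfolding th2_diagonal[OF up(1)] power2_eq_square ..
  also have "\<dots> = th2 0 0 0 0 (2 * \<sigma>) 0 (2 * \<sigma>) + th2 1 1 0 0 (2 * \<sigma>) 0 (2 * \<sigma>)"
    unfolding split[of 0 0 0 0] unfolding th2_def case_prod_unfold fst_conv snd_conv
    by (rule arg_cong2[where f = plus]; rule infsum_cong; rule e) (simp_all add: power2_eq_square field_simps)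
  finally show "ctheta 0 0 0 \<sigma> ^ 2 = ctheta 0 0 0 (2 * \<sigma>) ^ 2 + ctheta 1 0 0 (2 * \<sigma>) ^ 2"
    unfolding th2_diagonal[OF up(2)] power2_eq_square .
  have "ctheta 0 1 0 \<sigma> ^ 2 = th2 0 0 1 1 \<sigma> 0 \<sigma>"
    unfolding th2_diagonal[OF up(1)] power2_eq_square ..
  \<comment> \<open>The lower characteristic contributes \<open>(-1)^(m + n)\<close>, which is 1 on
    the even class and -1 on the odd one.\<close>
  also have "\<dots> = th2 0 0 0 0 (2 * \<sigma>) 0 (2 * \<sigma>) + exp (pi * \<i> * 1) * th2 1 1 0 0 (2 * \<sigma>) 0 (2 * \<sigma>)"
    unfolding split[of 0 0 1 1] unfolding th2_def case_prod_unfold fst_conv snd_conv infsum_cmult_right'[symmetric]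
      exp_add[symmetric] distrib_left[symmetric]
    by (rule arg_cong2[where f = plus]; rule infsum_cong; rule_tac k = "fst x" in exp_pi_i_cong)
       (simp_all add: power2_eq_square field_simps)
  finally show "ctheta 0 1 0 \<sigma> ^ 2 = ctheta 0 0 0 (2 * \<sigma>) ^ 2 - ctheta 1 0 0 (2 * \<sigma>) ^ 2"
    unfolding th2_diagonal[OF up(2)] power2_eq_square by simp
  have "ctheta 1 0 0 \<sigma> ^ 2 = th2 1 1 0 0 \<sigma> 0 \<sigma>"
    unfolding th2_diagonal[OF up(1)] power2_eq_square ..
  also have "\<dots> = th2 1 0 0 0 (2 * \<sigma>) 0 (2 * \<sigma>) + th2 2 1 0 0 (2 * \<sigma>) 0 (2 * \<sigma>)"
    unfolding split[of 1 1 0 0] unfolding th2_def case_prod_unfold fst_conv snd_conv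
    by (rule arg_cong2[where f = plus]; rule infsum_cong; rule e) (simp_all add: power2_eq_square field_simps)
  also have "th2 2 1 0 0 (2 * \<sigma>) 0 (2 * \<sigma>) = th2 0 1 0 0 (2 * \<sigma>) 0 (2 * \<sigma>)"
    using th2_shift_upper[of 0 1 1 0] by simp
  finally show "ctheta 1 0 0 \<sigma> ^ 2 = 2 * ctheta 0 0 0 (2 * \<sigma>) * ctheta 1 0 0 (2 * \<sigma>)"
    unfolding th2_diagonal[OF up(2)] by simp
qed

text \<open>By duplication this is
  \<open>(x^2 + y^2)^2 = (x^2 - y^2)^2 + (2 * x * y)^2\<close>.\<close>

lemma Jacobi_quartic_identity:
  assumes "Im \<sigma> > 0"
  shows "ctheta 0 0 0 \<sigma> ^ 4 = ctheta 0 1 0 \<sigma> ^ 4 + ctheta 1 0 0 \<sigma> ^ 4"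
proof -
  have p4: "w ^ 4 = (w ^ 2) ^ 2" for w :: complex by (simp add: power_mult[symmetric])
  show ?thesis
    unfolding p4[of "ctheta _ _ _ \<sigma>"] theta_constant_duplication[OF assms]
    by (simp add: power2_eq_square algebra_simps)
qed

text \<open>The reflection \<open>m \<mapsto> - 1 - m\<close> negates the half-integer
  \<open>m + 1/2\<close> and thereby changes the sign of every term.\<close>

lemma ctheta_odd: "ctheta 1 1 0 \<sigma> = 0"
proof -
  have "bij (\<lambda>m :: int. - 1 - m)"
    by (rule bij_betw_byWitness[where f' = "\<lambda>m. - 1 - m"]) auto
  define g where "g = (\<lambda>m :: int. exp (pi * \<i> * ((half_shift m 1)^2 * \<sigma> + 2 * (half_shift m 1) * 0 + (half_shift m 1) * of_int 1)))"
  have "g (- 1 - m) = - g m" for m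
  proof -
    have "g (- 1 - m) = exp (pi * \<i> * (1 + ((half_shift m 1)^2 * \<sigma> + 2 * (half_shift m 1) * 0 + (half_shift m 1) * of_int 1)))"
      unfolding g_def by (rule exp_pi_i_cong[where k = "- 1 - m"]) (simp add: power2_eq_square field_simps)
    then show ?thesis unfolding g_def by (simp only: distrib_left[of "pi * \<i>" 1] exp_add mult_1_right exp_pi_i mult_minus1)
  qed
  moreover have "infsum (\<lambda>m. g (- 1 - m)) UNIV = infsum g UNIV"
    by (rule infsum_reindex_bij_betw) fact
  ultimately have "infsum g UNIV = - infsum g UNIV" by (simp add: infsum_uminus)
  then have "infsum g UNIV = 0" by (simp add: eq_neg_iff_add_eq_0)
  then show ?thesis unfolding ctheta_def g_def .
qed

lemma theta_genus_1: "theta v \<tau> = ctheta (of_bit (v $ Inl 1)) (of_bit (v $ Inr 1)) 0 (\<tau> $ 1 $ 1)"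
  for \<tau> :: "complex^1^1"
proof -
  have "bij (\<lambda>m. (\<chi> i. m) :: int^1)"
    by (rule bij_betw_byWitness[where f' = "\<lambda>v. v $ 1"]) (auto simp: vec_eq_iff forall_1)
  note re = infsum_reindex_bij_betw[OF this, symmetric]
  show ?thesis
    unfolding theta_def re ctheta_def of_bit_eq_of_int
    by (intro infsum_cong) (simp add: Let_def power2_eq_square mult_ac)
qed

lemma siegel1_Im_pos:
  assumes "\<tau> \<in> (siegel :: (complex^1^1) set)"
  shows "Im (\<tau> $ 1 $ 1) > 0"
proof -
  have "(\<chi> i. (1 :: real)) \<noteq> (0 :: real^1)" by (simp add: vec_eq_iff)
  then have "(\<chi> i. (1 :: real)) \<bullet> (map_matrix Im \<tau> *v (\<chi> i. (1 :: real))) > 0"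
    using assms by (simp add: siegel_def pos_def_matrix_def)
  then show ?thesis by (simp add: inner_vec_def matrix_vector_mult_def map_matrix_def)
qed

lemma sum_bit_pairs: "(\<Sum>p\<in>UNIV. f p) = f (0, 0) + f (0, 1) + f (1, 0) + f (1, 1 :: bit)"
  for f :: "bit \<times> bit \<Rightarrow> complex"
proof -
  have eq: "(UNIV :: (bit \<times> bit) set) = {(0, 0), (0, 1), (1, 0), (1, 1)}"
    by (auto simp: bit_not_one_iff)
  show ?thesis unfolding eq by (simp add: add_ac)
qed

lemma sum_bvec: "(\<Sum>x\<in>UNIV. f x) = (\<Sum>p\<in>UNIV. \<Sum>p'\<in>UNIV. f (bvec (fst p) (fst p') (snd p) (snd p')))"
  for f :: "bit^(2+2) \<Rightarrow> complex"
proof -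
  have "bij (\<lambda>(p, p'). bvec (fst p) (fst p') (snd p) (snd p') :: bit^(2+2))"
    by (rule bij_betw_byWitness[where f' = "\<lambda>x. ((x $ Inl 1, x $ Inr 1), (x $ Inl 2, x $ Inr 2))"])
       (auto simp: bvec_eq_iff)
  from sum.reindex_bij_betw[OF this, of f]
  show ?thesis by (simp add: sum.cartesian_product case_prod_unfold)
qed

lemma Xi2_diag2:
  assumes \<tau>\<^sub>1: "\<tau>\<^sub>1 \<in> siegel" and \<tau>\<^sub>2: "\<tau>\<^sub>2 \<in> siegel"
  shows "Xi2 (diag2 \<tau>\<^sub>1 \<tau>\<^sub>2) = Xi1 \<tau>\<^sub>1 * Xi1 \<tau>\<^sub>2"
proof -
  define p q where "p = \<tau>\<^sub>1 $ 1 $ 1" and "q = \<tau>\<^sub>2 $ 1 $ 1"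
  have im: "Im p > 0" "Im q > 0"
    using siegel1_Im_pos assms by (auto simp: p_def q_def)
  have nth: "diag2 \<tau>\<^sub>1 \<tau>\<^sub>2 $ 1 $ 1 = p" "diag2 \<tau>\<^sub>1 \<tau>\<^sub>2 $ 1 $ 2 = 0" "diag2 \<tau>\<^sub>1 \<tau>\<^sub>2 $ 2 $ 1 = 0" "diag2 \<tau>\<^sub>1 \<tau>\<^sub>2 $ 2 $ 2 = q"
    by (simp_all add: diag2_def p_def q_def)
  have up: "upper2 p 0 q" using im by (simp add: upper2_def)
  have sie: "diag2 \<tau>\<^sub>1 \<tau>\<^sub>2 \<in> siegel" using up by (simp add: siegel2_iff nth)
  define f where "f = (\<lambda>\<sigma> r. ctheta (of_bit (fst r)) (of_bit (snd r)) 0 \<sigma> ^ 4)"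
  have t: "theta (bvec a b d e) (diag2 \<tau>\<^sub>1 \<tau>\<^sub>2) ^ 4 = f p (a, d) * f q (b, e)" for a b d e
    unfolding theta_eq_th2[OF sie] nth bvec_nth th2_diagonal[OF up] by (simp add: f_def power_mult_distrib)
  have z: "(0 :: bit^(2+2)) = bvec 0 0 0 0" by (simp add: bvec_eq_iff)
  have add: "bvec a b d e + bvec a' b' d' e' + bvec 0 0 0 0 = bvec (a + a') (b + b') (d + d') (e + e')" for a b d e a' b' d' e' :: bit
    by (simp add: bvec_eq_iff)
  \<comment> \<open>\<open>S\<close> and \<open>Q\<close> are the genus 1 versions of the double sum
    and of the sum of squares.\<close>
  define S where "S = (\<lambda>g :: bit \<times> bit \<Rightarrow> complex. \<Sum>r\<in>UNIV. \<Sum>s\<in>UNIV. g (0, 0) * g r * g s * g (fst r + fst s, snd r + snd s))"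
  define Q where "Q = (\<lambda>g :: bit \<times> bit \<Rightarrow> complex. \<Sum>r\<in>UNIV. g r ^ 2)"
  have 1: "(\<Sum>x\<in>UNIV. \<Sum>y\<in>UNIV. theta 0 (diag2 \<tau>\<^sub>1 \<tau>\<^sub>2) ^ 4 * theta x (diag2 \<tau>\<^sub>1 \<tau>\<^sub>2) ^ 4 * theta y (diag2 \<tau>\<^sub>1 \<tau>\<^sub>2) ^ 4
        * theta (x + y + 0) (diag2 \<tau>\<^sub>1 \<tau>\<^sub>2) ^ 4) = S (f p) * S (f q)"
  proof -
    have "(\<Sum>x\<in>UNIV. \<Sum>y\<in>UNIV. theta 0 (diag2 \<tau>\<^sub>1 \<tau>\<^sub>2) ^ 4 * theta x (diag2 \<tau>\<^sub>1 \<tau>\<^sub>2) ^ 4 * theta y (diag2 \<tau>\<^sub>1 \<tau>\<^sub>2) ^ 4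
        * theta (x + y + 0) (diag2 \<tau>\<^sub>1 \<tau>\<^sub>2) ^ 4)
      = (\<Sum>r\<in>UNIV. \<Sum>r'\<in>UNIV. \<Sum>s\<in>UNIV. \<Sum>s'\<in>UNIV.
          (f p (0, 0) * f p r * f p s * f p (fst r + fst s, snd r + snd s))
          * (f q (0, 0) * f q r' * f q s' * f q (fst r' + fst s', snd r' + snd s')))"
      unfolding z sum_bvec add t prod.collapse by (intro sum.cong refl) (simp only: mult_ac)
    then show ?thesis unfolding S_def by (simp only: sum_product[symmetric])
  qed
  have 2: "(\<Sum>x\<in>UNIV. (theta x (diag2 \<tau>\<^sub>1 \<tau>\<^sub>2) ^ 4) ^ 2) = Q (f p) * Q (f q)"
    unfolding sum_bvec t prod.collapse Q_def sum_product by (simp only: power_mult_distrib)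
  have odd: "f \<sigma> (1, 1) = 0" for \<sigma> by (simp add: f_def ctheta_odd)
  have jac: "f \<sigma> (0, 0) = f \<sigma> (0, 1) + f \<sigma> (1, 0)" if "Im \<sigma> > 0" for \<sigma>
    using Jacobi_quartic_identity[OF that] by (simp add: f_def)
  \<comment> \<open>Two distinct nonzero characteristics bring in all three of them, including the
    odd one, so only dependent pairs survive.\<close>
  have S: "S (f \<sigma>) = f \<sigma> (0, 0) ^ 4 + 3 * f \<sigma> (0, 0) ^ 2 * (f \<sigma> (0, 1) ^ 2 + f \<sigma> (1, 0) ^ 2)" for \<sigma>
    unfolding S_def sum_bit_pairs fst_conv snd_conv by (simp add: odd power2_eq_square power4_eq_xxxx algebra_simps)
  have Q: "Q (f \<sigma>) = f \<sigma> (0, 0) ^ 2 + (f \<sigma> (0, 1) ^ 2 + f \<sigma> (1, 0) ^ 2)" for \<sigma>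
    unfolding Q_def sum_bit_pairs by (simp add: odd)
  have Xi1: "Xi1 \<tau> = f \<sigma> (0, 0) ^ 2 * f \<sigma> (0, 1) * f \<sigma> (1, 0)" if "\<sigma> = \<tau> $ 1 $ 1" for \<tau> \<sigma>
    unfolding Xi1_def theta_genus_1 char1_def that by (simp add: f_def power_mult[symmetric])
  have red: "f \<sigma> (0, 0) ^ 2 - (f \<sigma> (0, 1) ^ 2 + f \<sigma> (1, 0) ^ 2) = 2 * f \<sigma> (0, 1) * f \<sigma> (1, 0)" if "Im \<sigma> > 0" for \<sigma>
    unfolding jac[OF that] by (simp add: power2_eq_square algebra_simps)
  \<comment> \<open>Here \<open>a\<close> stands for the constant at characteristic 0 and
    \<open>s\<close> for the sum of the squares of the two other even ones. The combination, not a
    product by itself, factors because the coefficients 1, 8 and -6 reduce the bracket to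
    \<open>3 * (a^2 - s) * (a'^2 - s')\<close>.\<close>
  have alg: "((a^4 + 3 * a^2 * s) * (a'^4 + 3 * a'^2 * s') + 8 * (a * a')^4 - 6 * (a * a')^2 * ((a^2 + s) * (a'^2 + s'))) / 12
      = a^2 * a'^2 * ((a^2 - s) * (a'^2 - s')) / 4" for a a' s s' :: complex
    by (simp add: power2_eq_square power4_eq_xxxx field_simps)
  have "Xi2 (diag2 \<tau>\<^sub>1 \<tau>\<^sub>2) = (S (f p) * S (f q) + 8 * (f p (0, 0) * f q (0, 0)) ^ 4 - 6 * (f p (0, 0) * f q (0, 0)) ^ 2 * (Q (f p) * Q (f q))) / 12"
    unfolding Xi2_eq_Xi_at Xi_at_def 1 2 unfolding z t ..
  also have "\<dots> = f p (0, 0) ^ 2 * f q (0, 0) ^ 2 * ((2 * f p (0, 1) * f p (1, 0)) * (2 * f q (0, 1) * f q (1, 0))) / 4"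
    unfolding S Q alg red[OF im(1)] red[OF im(2)] ..
  also have "\<dots> = Xi1 \<tau>\<^sub>1 * Xi1 \<tau>\<^sub>2"
    unfolding Xi1[OF p_def] Xi1[OF q_def] by simp
  finally show ?thesis .
qed

theorem proposition18:
  shows "modular_form 8 Gamma12 Xi2 \<and>
    (\<forall>\<tau>\<^sub>1\<in>siegel. \<forall>\<tau>\<^sub>2\<in>siegel. Xi2 (diag2 \<tau>\<^sub>1 \<tau>\<^sub>2) = Xi1 \<tau>\<^sub>1 * Xi1 \<tau>\<^sub>2)"
  using Xi2_modular Xi2_diag2 by blast

end
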